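(* Let $E$ be an arbitrary directed graph, $K$ a field, and $L=L_K(E)$ the Leavitt path algebra of $E$ over $K$. The following are equivalent: (a) $L$ contains at most finitely many prime ideals; (b) $L$ contains at most finitely many prime ideals and all of them are graded ideals; (c) the graph $E$ satisfies Condition (K), there are only finitely many hereditary saturated subsets $H$ of $E^0$, and for each of them the corresponding set $B_H$ of breaking vertices is finite; (d) $L$ has at most finitely many two-sided ideals.
   Context: A directed graph $E=(E^0,E^1,r,s)$ consists of sets $E^0$ (vertices) and $E^1$ (edges), of arbitrary cardinality, with maps $r,s:E^1\to E^0$ (range, source). A vertex $v$ is regular if $s^{-1}(v)$ is finite and non-empty, and an infinite emitter if $s^{-1}(v)$ is infinite. The Leavitt path algebra $L_K(E)$ is the (not necessarily unital) $K$-algebra generated by pairwise orthogonal idempotents $\{v:v\in E^0\}$ and elements $\{e,e^*:e\in E^1\}$ subject to: (1) $s(e)e=e=er(e)$; (2) $r(e)e^*=e^*=e^*s(e)$; (3) $e^*e=r(e)$ and $e^*f=0$ for edges $e\ne f$; (4) $v=\sum_{s(e)=v}ee^*$ for every regular vertex $v$. It is $\mathbb{Z}$-graded, $L=\bigoplus_n L_n$, by $\deg v=0$, $\deg e=1$, $\deg e^*=-1$; an ideal $I$ is graded if $I=\bigoplus_n(I\cap L_n)$. A path of positive length is $\mu=e_1\cdots e_n$ with $r(e_i)=s(e_{i+1})$; vertices are paths of length $0$. A path is closed, based at $s(e_1)$, if $r(e_n)=s(e_1)$; a closed path is simple if $s(e_i)\ne s(e_1)$ for all $i\ge2$. $E$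 satisfies Condition (K) if every vertex that is the base of a simple closed path $c$ is also the base of a simple closed path $c'\neq c$. Write $u\ge v$ if there is a path from $u$ to $v$. A set $H\subseteq E^0$ is hereditary if $v\in H$, $v\ge w$ imply $w\in H$; a hereditary set is saturated if for every regular vertex $v$, $r(s^{-1}(v))\subseteq H$ implies $v\in H$. For $H$ hereditary saturated, $B_H$ (the breaking vertices) is the set of infinite emitters $w\in E^0\setminus H$ with $0<|s^{-1}(w)\cap r^{-1}(E^0\setminus H)|<\infty$. Ideals are two-sided. A proper ideal $P$ is prime if for all two-sided ideals $A,B$, $AB\subseteq P$ implies $A\subseteq P$ or $B\subseteq P$. *)

theory Defs
  imports
    "HOL-Library.Poly_Mapping"
    "HOL-Algebra.QuotRing"
    "HOL-Algebra.Ideal_Product"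
    "Graph_Theory.Arc_Walk"
begin

section \<open>Two-sided ideals of rings that need not have an identity\<close>

text \<open>
  The locale \<^locale>\<open>ideal\<close> includes \<^locale>\<open>ring\<close>, hence an identity. The definitions below
  never mention the \<open>one\<close> field of the record; on a unital ring \<open>two_sided_ideal\<close> agrees with
  \<^locale>\<open>ideal\<close>.
\<close>

definition two_sided_ideal :: "('a, 'm) ring_scheme \<Rightarrow> 'a set \<Rightarrow> bool" where
  "two_sided_ideal R I \<longleftrightarrow>
     additive_subgroup I R \<and>
     (\<forall>a\<in>I. \<forall>x\<in>carrier R. x \<otimes>\<^bsub>R\<^esub> a \<in> I \<and> a \<otimes>\<^bsub>R\<^esub> x \<in> I)"

lemma ideal_iff_two_sided_ideal: "ideal I R \<longleftrightarrow> ring R \<and> two_sided_ideal R I"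
  by (auto simp: ideal_def ideal_axioms_def two_sided_ideal_def)

definition prime_two_sided_ideal :: "('a, 'm) ring_scheme \<Rightarrow> 'a set \<Rightarrow> bool" where
  "prime_two_sided_ideal R P \<longleftrightarrow>
     two_sided_ideal R P \<and> P \<noteq> carrier R \<and>
     (\<forall>A B. two_sided_ideal R A \<longrightarrow> two_sided_ideal R B \<longrightarrow>
        ideal_prod R A B \<subseteq> P \<longrightarrow> A \<subseteq> P \<or> B \<subseteq> P)"

text \<open>
  \<open>A\<close> is the internal direct sum of the family \<open>M\<close>: summation is a bijection onto \<open>A\<close> from the
  families of elements \<open>c i \<in> M i\<close> with finite support.
\<close>

definition internal_direct_sum ::
    "('a, 'm) ring_scheme \<Rightarrow> ('i \<Rightarrow> 'a set) \<Rightarrow> 'a set \<Rightarrow> bool" where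
  "internal_direct_sum R M A \<longleftrightarrow>
     bij_betw (\<lambda>c. \<Oplus>\<^bsub>R\<^esub>i\<in>{i. c i \<noteq> \<zero>\<^bsub>R\<^esub>}. c i)
       {c. (\<forall>i. c i \<in> M i) \<and> finite {i. c i \<noteq> \<zero>\<^bsub>R\<^esub>}} A"


section \<open>The Leavitt path algebra\<close>

datatype 'g free_monoid = Word (letters: "'g list")

text \<open>
  The operation is written additively because \<^type>\<open>poly_mapping\<close> forms monoid algebras over
  additive, not necessarily commutative, monoids.
\<close>

instantiation free_monoid :: (type) monoid_add
begin

definition zero_free_monoid :: "'a free_monoid" where
  "0 = Word []"

definition plus_free_monoid :: "'a free_monoid \<Rightarrow> 'a free_monoid \<Rightarrow> 'a free_monoid" where
  "x + y = Word (letters x @ letters y)"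

instance
  by standard (simp_all add: zero_free_monoid_def plus_free_monoid_def)

end

datatype ('v, 'e) lpa_gen = Vertex 'v | Edge 'e | Ghost 'e

text \<open>The unital free algebra on all generators, with word concatenation as product.\<close>

type_synonym ('v, 'e, 'k) lpa_poly = "('v, 'e) lpa_gen free_monoid \<Rightarrow>\<^sub>0 'k"

definition lpa_gens :: "('v, 'e) pre_digraph \<Rightarrow> ('v, 'e) lpa_gen set" where
  "lpa_gens E = Vertex ` verts E \<union> Edge ` arcs E \<union> Ghost ` arcs E"

text \<open>
  The non-unital free algebra on the generators of \<open>E\<close>: only nonempty words occur. The \<open>one\<close>
  field of the record has no meaning.
\<close>

definition free_nonunital_algebra ::
    "('v, 'e) pre_digraph \<Rightarrow> ('v, 'e, 'k::field) lpa_poly ring" where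
  "free_nonunital_algebra E =
     \<lparr>carrier = {p. \<forall>w\<in>Poly_Mapping.keys p. letters w \<noteq> [] \<and> set (letters w) \<subseteq> lpa_gens E},
      mult = (*), one = undefined, zero = 0, add = (+)\<rparr>"

definition lpa_mon :: "('v, 'e) lpa_gen \<Rightarrow> ('v, 'e, 'k::field) lpa_poly" where
  "lpa_mon g = Poly_Mapping.single (Word [g]) 1"

abbreviation vtx :: "'v \<Rightarrow> ('v, 'e, 'k::field) lpa_poly" where
  "vtx v \<equiv> lpa_mon (Vertex v)"

abbreviation edg :: "'e \<Rightarrow> ('v, 'e, 'k::field) lpa_poly" where
  "edg e \<equiv> lpa_mon (Edge e)"

abbreviation gho :: "'e \<Rightarrow> ('v, 'e, 'k::field) lpa_poly" where
  "gho e \<equiv> lpa_mon (Ghost e)"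

text \<open>Throughout, the source of an edge is its \<^const>\<open>tail\<close> and the range is its \<^const>\<open>head\<close>.\<close>

definition regular_vertex :: "('v, 'e) pre_digraph \<Rightarrow> 'v \<Rightarrow> bool" where
  "regular_vertex E v \<longleftrightarrow> v \<in> verts E \<and> finite (out_arcs E v) \<and> out_arcs E v \<noteq> {}"

definition lpa_relators :: "('v, 'e) pre_digraph \<Rightarrow> ('v, 'e, 'k::field) lpa_poly set" where
  "lpa_relators E =
     {vtx v * vtx v - vtx v | v. v \<in> verts E}
   \<union> {vtx u * vtx v | u v. u \<in> verts E \<and> v \<in> verts E \<and> u \<noteq> v}
   \<union> {vtx (tail E e) * edg e - edg e | e. e \<in> arcs E}
   \<union> {edg e * vtx (head E e) - edg e | e. e \<in> arcs E}
   \<union> {vtx (head E e) * gho e - gho e | e. e \<in> arcs E}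
   \<union> {gho e * vtx (tail E e) - gho e | e. e \<in> arcs E}
   \<union> {gho e * edg e - vtx (head E e) | e. e \<in> arcs E}
   \<union> {gho e * edg f | e f. e \<in> arcs E \<and> f \<in> arcs E \<and> e \<noteq> f}
   \<union> {vtx v - (\<Sum>e\<in>out_arcs E v. edg e * gho e) | v. regular_vertex E v}"

text \<open>
  Closure under scalars is required explicitly, because the free algebra is not unital and its ring
  ideals need not be subspaces.
\<close>

definition lpa_relation_ideal :: "('v, 'e) pre_digraph \<Rightarrow> ('v, 'e, 'k::field) lpa_poly set" where
  "lpa_relation_ideal E =
     \<Inter>{J. two_sided_ideal (free_nonunital_algebra E) J \<and>
          (\<forall>k. \<forall>p\<in>J. Poly_Mapping.map ((*) k) p \<in> J) \<and>
          lpa_relators E \<subseteq> J}"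

text \<open>
  \<^const>\<open>FactRing\<close> only uses cosets, so it makes sense without an identity. Only the ring structure
  of the quotient is recorded. The argument of type \<^typ>\<open>'k itself\<close> selects the field.
\<close>

definition leavitt_path_algebra ::
    "'k::field itself \<Rightarrow> ('v, 'e) pre_digraph \<Rightarrow> ('v, 'e, 'k) lpa_poly set ring" where
  "leavitt_path_algebra K E = FactRing (free_nonunital_algebra E) (lpa_relation_ideal E)"

fun gen_degree :: "('v, 'e) lpa_gen \<Rightarrow> int" where
  "gen_degree (Vertex v) = 0"
| "gen_degree (Edge e) = 1"
| "gen_degree (Ghost e) = -1"

definition word_degree :: "('v, 'e) lpa_gen free_monoid \<Rightarrow> int" where
  "word_degree w = sum_list (map gen_degree (letters w))"

definition lpa_component ::
    "'k::field itself \<Rightarrow> ('v, 'e) pre_digraph \<Rightarrow> int \<Rightarrow> ('v, 'e, 'k) lpa_poly set set" where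
  "lpa_component K E n =
     {lpa_relation_ideal E +>\<^bsub>free_nonunital_algebra E\<^esub> p | p.
        p \<in> carrier (free_nonunital_algebra E) \<and> (\<forall>w\<in>Poly_Mapping.keys p. word_degree w = n)}"

definition graded_ideal ::
    "'k::field itself \<Rightarrow> ('v, 'e) pre_digraph \<Rightarrow> ('v, 'e, 'k) lpa_poly set set \<Rightarrow> bool" where
  "graded_ideal K E I \<longleftrightarrow>
     two_sided_ideal (leavitt_path_algebra K E) I \<and>
     internal_direct_sum (leavitt_path_algebra K E) (\<lambda>n. I \<inter> lpa_component K E n) I"


section \<open>Graph conditions\<close>

definition simple_closed_path :: "('v, 'e) pre_digraph \<Rightarrow> 'v \<Rightarrow> 'e list \<Rightarrow> bool" where
  "simple_closed_path E v c \<longleftrightarrow>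
     c \<noteq> [] \<and> pre_digraph.awalk E v c v \<and> (\<forall>e\<in>set (tl c). tail E e \<noteq> v)"

definition condition_K :: "('v, 'e) pre_digraph \<Rightarrow> bool" where
  "condition_K E \<longleftrightarrow>
     (\<forall>v\<in>verts E. \<forall>c. simple_closed_path E v c \<longrightarrow>
        (\<exists>c'. c' \<noteq> c \<and> simple_closed_path E v c'))"

definition hereditary :: "('v, 'e) pre_digraph \<Rightarrow> 'v set \<Rightarrow> bool" where
  "hereditary E H \<longleftrightarrow>
     H \<subseteq> verts E \<and> (\<forall>v w p. v \<in> H \<longrightarrow> pre_digraph.awalk E v p w \<longrightarrow> w \<in> H)"

definition hereditary_saturated :: "('v, 'e) pre_digraph \<Rightarrow> 'v set \<Rightarrow> bool" where
  "hereditary_saturated E H \<longleftrightarrow>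
     hereditary E H \<and> (\<forall>v. regular_vertex E v \<longrightarrow> head E ` out_arcs E v \<subseteq> H \<longrightarrow> v \<in> H)"

definition breaking_vertices :: "('v, 'e) pre_digraph \<Rightarrow> 'v set \<Rightarrow> 'v set" where
  "breaking_vertices E H =
     {w \<in> verts E - H. infinite (out_arcs E w) \<and>
        finite {e \<in> out_arcs E w. head E e \<in> verts E - H} \<and>
        {e \<in> out_arcs E w. head E e \<in> verts E - H} \<noteq> {}}"

end

theory Submission
  imports Defs "HOL-Computational_Algebra.Primes"
begin

text \<open>
  An ideal \<open>I\<close> determines the hereditary saturated set \<open>H\<close> of the vertices in it and the set \<open>S\<close> of
  those breaking vertices \<open>w\<close> whose element \<open>w - \<Sum> e e\<^sup>*\<close>, summed over the arcs leading outside
  \<open>H\<close>, is in it. Multiplying an element outside \<open>I\<close> by suitable paths and ghost paths produces,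
  modulo \<open>I\<close>, either a nonzero multiple of a breaking element outside \<open>I\<close> or a combination of a vertex
  outside \<open>H\<close> with closed paths; Condition (K) allows one to remove the closed paths. So under
  Condition (K) the ideal is determined by \<open>(H, S)\<close>: there are finitely many ideals if the graph data
  are finite, and \<open>I\<close> equals the largest graded ideal contained in it.

  Conversely, an ideal that is maximal among those avoiding an idempotent is prime. Ideals that contain
  prescribed elements and avoid a given idempotent are annihilators of spaces of functions on paths.
  They separate the sets \<open>H\<close>, and the breaking vertices of one \<open>H\<close>. If Condition (K) fails at \<open>v\<close>, with
  \<open>c\<close> the only simple closed path there, then for each prime number \<open>p\<close> there is a prime ideal that
  avoids \<open>v\<close> and contains \<open>v + c + \<dots> + c\<^bsup>p-1\<^esup>\<close>. They are distinct, because for different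
  \<open>p\<close> these elements together generate \<open>v\<close>.
\<close>

section \<open>The free algebra\<close>

text \<open>Everything is computed modulo an arbitrary ideal. The relations then yield memberships
  only; that an element lies outside an ideal has to be seen on a module where it acts as nonzero.
  So the forward direction rewrites words, while the converse is built on functions on paths.

  The obstacle in reducing an element is an infinite emitter \<open>w\<close>: there the sum
  relation is absent, so an element may annihilate all arcs leaving \<open>w\<close> without being
  in \<open>I\<close>. The breaking element of \<open>w\<close> is the typical example and accounts
  for the second alternative of \<open>reduction\<close>.

  The sums v + ... + c^(p-1) correspond to (x^p - 1)/(x - 1) in the Laurent polynomials in
  \<open>c\<close>. The difference of two of them is again such a sum up to a power of
  \<open>c\<close>, so the Euclidean algorithm runs on their lengths over every field, and coprime
  lengths give the local unit \<open>v\<close>. In this way the prime numbers index infinitely many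
  prime ideals even if the field is finite.\<close>

lemma poly_mapping_eq_sum_single:
  "p = (\<Sum>w\<in>Poly_Mapping.keys p. Poly_Mapping.single w (poly_mapping.lookup p w))"
  by (rule poly_mapping_eqI)
    (auto simp: lookup_sum lookup_single when_def not_in_keys_iff_lookup_eq_zero)

lemma poly_mapping_span_induct [case_names single add]:
  assumes single: "\<And>w c. P (Poly_Mapping.single w c)"
    and add: "\<And>p q. P p \<Longrightarrow> P q \<Longrightarrow> P (p + q)"
  shows "P (p :: 'a \<Rightarrow>\<^sub>0 'b::comm_monoid_add)"
proof -
  have P0: "P 0" using single[of undefined 0] by simp
  have "P (\<Sum>w\<in>A. Poly_Mapping.single w (poly_mapping.lookup p w))" if "finite A" for A
    using that by (induction A rule: finite_induct) (auto intro: single add P0)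
  from this[OF finite_keys, of p] show ?thesis
    by (simp only: poly_mapping_eq_sum_single[symmetric])
qed

text \<open>Scalars live in the ambient unital algebra as multiples of the empty word, so scalar
  multiplication is multiplication by a central element.\<close>

abbreviation cst :: "'k \<Rightarrow> ('a::monoid_add \<Rightarrow>\<^sub>0 'k::zero)" where
  "cst k \<equiv> Poly_Mapping.single 0 k"

lemma cst_commute: "cst k * p = p * cst (k :: 'k::comm_semiring_0)"
  by (induction p rule: poly_mapping_span_induct)
    (simp_all add: mult_single mult.commute distrib_left distrib_right)

lemma cst_left_commute: "p * (cst (k :: 'k::comm_semiring_0) * q) = cst k * (p * q)"
  by (metis cst_commute mult.assoc)

lemma cst_times_single: "cst k * Poly_Mapping.single w c = Poly_Mapping.single w (k * c)"
  by (simp add: mult_single)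

lemma single_Cons:
  "Poly_Mapping.single (Word (g # w)) c = lpa_mon g * Poly_Mapping.single (Word w) (c :: 'k::field)"
  by (simp add: lpa_mon_def mult_single plus_free_monoid_def)

lemma Word_Nil: "Word [] = 0"
  by (simp add: zero_free_monoid_def)

text \<open>The empty path becomes the unit of the ambient algebra and not a vertex. Paths therefore
  carry their end point along, as in \<open>pe p * vtx v\<close>.\<close>

definition pe :: "'e list \<Rightarrow> ('v, 'e, 'k::field) lpa_poly" where
  "pe p = Poly_Mapping.single (Word (map Edge p)) 1"

text \<open>Reversal makes \<open>gh p\<close> the adjoint of \<open>pe p\<close>: the ghost of the
  first arc is the rightmost letter and meets the first arc of a real path.\<close>

definition gh :: "'e list \<Rightarrow> ('v, 'e, 'k::field) lpa_poly" where
  "gh p = Poly_Mapping.single (Word (map Ghost (rev p))) 1"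

lemma pe_Nil [simp]: "pe [] = 1"
  by (simp add: pe_def Word_Nil)

lemma gh_Nil [simp]: "gh [] = 1"
  by (simp add: gh_def Word_Nil)

lemma pe_append: "pe (p @ q) = pe p * pe q"
  by (simp add: pe_def mult_single plus_free_monoid_def)

lemma pe_Cons: "pe (e # p) = edg e * pe p"
  by (simp add: pe_def single_Cons)

lemma gh_Cons: "gh (e # p) = gh p * gho e"
  by (simp add: gh_def lpa_mon_def mult_single plus_free_monoid_def)

section \<open>Ideals containing the Leavitt relations\<close>

text \<open>
  Generators outside the graph are put into the ideal, so that the ideals of the Leavitt path algebra
  become ideals of the whole unital free algebra and computing modulo \<open>I\<close> needs no membership
  conditions.
\<close>

locale leavitt_ideal = wf_digraph E for E :: "('v, 'e) pre_digraph" +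
  fixes I :: "('v, 'e, 'k::field) lpa_poly set"
  assumes zero_mem: "0 \<in> I"
    and add_mem: "p \<in> I \<Longrightarrow> q \<in> I \<Longrightarrow> p + q \<in> I"
    and lmult_mem: "p \<in> I \<Longrightarrow> a * p \<in> I"
    and rmult_mem: "p \<in> I \<Longrightarrow> p * a \<in> I"
    and const_coeff: "p \<in> I \<Longrightarrow> poly_mapping.lookup p 0 = 0"
    and relators_mem: "lpa_relators E \<subseteq> I"
    and invalid_mem: "g \<notin> lpa_gens E \<Longrightarrow> lpa_mon g \<in> I"
begin

lemma uminus_mem: "p \<in> I \<Longrightarrow> - p \<in> I"
  using lmult_mem[of p "-1"] by simp

lemma diff_mem: "p \<in> I \<Longrightarrow> q \<in> I \<Longrightarrow> p - q \<in> I"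
  using add_mem[of p "- q"] uminus_mem[of q] by simp

lemma sum_mem: "(\<And>x. x \<in> A \<Longrightarrow> f x \<in> I) \<Longrightarrow> sum f A \<in> I"
  by (induction A rule: infinite_finite_induct) (auto intro: zero_mem add_mem)

lemma cst_mult_cancel: "cst k * p \<in> I \<Longrightarrow> k \<noteq> 0 \<Longrightarrow> p \<in> I"
  using lmult_mem[of "cst k * p" "cst (inverse k)"]
  by (simp add: mult.assoc[symmetric] cst_times_single)

definition cong :: "('v, 'e, 'k) lpa_poly \<Rightarrow> ('v, 'e, 'k) lpa_poly \<Rightarrow> bool" (infix \<open>\<asymp>\<close> 50) where
  "x \<asymp> y \<longleftrightarrow> x - y \<in> I"

lemma cong_refl [simp, intro]: "x \<asymp> x"
  by (simp add: cong_def zero_mem)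

lemma cong_sym: "x \<asymp> y \<Longrightarrow> y \<asymp> x"
  using uminus_mem by (fastforce simp: cong_def)

lemma cong_trans [trans]: "x \<asymp> y \<Longrightarrow> y \<asymp> z \<Longrightarrow> x \<asymp> z"
  using add_mem by (fastforce simp: cong_def)

lemma cong_add: "x \<asymp> x' \<Longrightarrow> y \<asymp> y' \<Longrightarrow> x + y \<asymp> x' + y'"
  using add_mem by (fastforce simp: cong_def algebra_simps)

lemma cong_diff: "x \<asymp> x' \<Longrightarrow> y \<asymp> y' \<Longrightarrow> x - y \<asymp> x' - y'"
  using diff_mem[of "x - x'" "y - y'"] by (simp add: cong_def algebra_simps)

lemma cong_lmult: "x \<asymp> y \<Longrightarrow> a * x \<asymp> a * y"
  using lmult_mem by (fastforce simp: cong_def right_diff_distrib[symmetric])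

lemma cong_rmult: "x \<asymp> y \<Longrightarrow> x * a \<asymp> y * a"
  using rmult_mem by (fastforce simp: cong_def left_diff_distrib[symmetric])

lemma cong_sum: "(\<And>a. a \<in> A \<Longrightarrow> f a \<asymp> g a) \<Longrightarrow> sum f A \<asymp> sum g A"
  by (induction A rule: infinite_finite_induct) (auto intro: cong_add)

lemma cong_0_iff: "x \<asymp> 0 \<longleftrightarrow> x \<in> I"
  by (simp add: cong_def)

lemma cong_mem_iff: "x \<asymp> y \<Longrightarrow> x \<in> I \<longleftrightarrow> y \<in> I"
  by (metis cong_0_iff cong_sym cong_trans)

lemma cong_0_lmult: "x \<asymp> 0 \<Longrightarrow> a * x \<asymp> 0"
  by (simp add: cong_0_iff lmult_mem)

lemma cong_0_rmult: "x \<asymp> 0 \<Longrightarrow> x * a \<asymp> 0"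
  by (simp add: cong_0_iff rmult_mem)

lemma cong_both_0: "x \<in> I \<Longrightarrow> y \<in> I \<Longrightarrow> x \<asymp> y"
  by (simp add: cong_def diff_mem)

section \<open>The Leavitt relations as congruences, and products of ghost paths with paths\<close>

lemma vtx_invalid: "v \<notin> verts E \<Longrightarrow> vtx v \<in> I"
  by (rule invalid_mem) (auto simp: lpa_gens_def)

lemma edg_invalid: "e \<notin> arcs E \<Longrightarrow> edg e \<in> I"
  by (rule invalid_mem) (auto simp: lpa_gens_def)

lemma gho_invalid: "e \<notin> arcs E \<Longrightarrow> gho e \<in> I"
  by (rule invalid_mem) (auto simp: lpa_gens_def)

lemma vtx_idem: "vtx v * vtx v \<asymp> vtx v"
proof (cases "v \<in> verts E")
  case True
  thus ?thesis unfolding cong_def by (intro subsetD[OF relators_mem]) (auto simp: lpa_relators_def)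
qed (auto intro!: cong_both_0 lmult_mem vtx_invalid)

lemma vtx_orth: "u \<noteq> v \<Longrightarrow> vtx u * vtx v \<asymp> 0"
proof -
  assume "u \<noteq> v"
  consider "u \<in> verts E" "v \<in> verts E" | "u \<notin> verts E" | "v \<notin> verts E" by blast
  thus ?thesis
  proof cases
    case 1
    with \<open>u \<noteq> v\<close> show ?thesis
      unfolding cong_0_iff by (intro subsetD[OF relators_mem]) (auto simp: lpa_relators_def)
  qed (simp_all add: cong_0_iff lmult_mem rmult_mem vtx_invalid)
qed

lemma tail_edg: "vtx (tail E e) * edg e \<asymp> edg e"
proof (cases "e \<in> arcs E")
  case True
  thus ?thesis unfolding cong_def by (intro subsetD[OF relators_mem]) (auto simp: lpa_relators_def)
qed (auto intro!: cong_both_0 lmult_mem edg_invalid)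

lemma edg_head: "edg e * vtx (head E e) \<asymp> edg e"
proof (cases "e \<in> arcs E")
  case True
  thus ?thesis unfolding cong_def by (intro subsetD[OF relators_mem]) (auto simp: lpa_relators_def)
qed (auto intro!: cong_both_0 rmult_mem edg_invalid)

lemma head_gho: "vtx (head E e) * gho e \<asymp> gho e"
proof (cases "e \<in> arcs E")
  case True
  thus ?thesis unfolding cong_def by (intro subsetD[OF relators_mem]) (auto simp: lpa_relators_def)
qed (auto intro!: cong_both_0 lmult_mem gho_invalid)

lemma gho_tail: "gho e * vtx (tail E e) \<asymp> gho e"
proof (cases "e \<in> arcs E")
  case True
  thus ?thesis unfolding cong_def by (intro subsetD[OF relators_mem]) (auto simp: lpa_relators_def)
qed (auto intro!: cong_both_0 rmult_mem gho_invalid)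

lemma gho_edg_same: "e \<in> arcs E \<Longrightarrow> gho e * edg e \<asymp> vtx (head E e)"
  unfolding cong_def by (intro subsetD[OF relators_mem]) (auto simp: lpa_relators_def)

lemma gho_edg_diff: "e \<noteq> f \<Longrightarrow> gho e * edg f \<asymp> 0"
proof -
  assume "e \<noteq> f"
  consider "e \<in> arcs E" "f \<in> arcs E" | "e \<notin> arcs E" | "f \<notin> arcs E" by blast
  thus ?thesis
  proof cases
    case 1
    with \<open>e \<noteq> f\<close> show ?thesis
      unfolding cong_0_iff by (intro subsetD[OF relators_mem]) (auto simp: lpa_relators_def)
  qed (simp_all add: cong_0_iff lmult_mem rmult_mem edg_invalid gho_invalid)
qed

lemma regular_cong: "regular_vertex E v \<Longrightarrow> vtx v \<asymp> (\<Sum>e\<in>out_arcs E v. edg e * gho e)"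
  unfolding cong_def by (rule subsetD[OF relators_mem], unfold lpa_relators_def) blast

lemma vtx_edg: "vtx u * edg e \<asymp> (if u = tail E e then edg e else 0)"
proof (cases "u = tail E e")
  case False
  have "vtx u * edg e \<asymp> vtx u * (vtx (tail E e) * edg e)"
    by (intro cong_lmult cong_sym[OF tail_edg])
  also have "\<dots> = (vtx u * vtx (tail E e)) * edg e" by (simp add: mult.assoc)
  also have "\<dots> \<asymp> 0" by (intro cong_0_rmult vtx_orth False)
  finally show ?thesis using False by simp
qed (simp add: tail_edg)

lemma gho_vtx: "gho e * vtx u \<asymp> (if u = tail E e then gho e else 0)"
proof (cases "u = tail E e")
  case False
  have "gho e * vtx u \<asymp> (gho e * vtx (tail E e)) * vtx u"
    by (intro cong_rmult cong_sym[OF gho_tail])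
  also have "\<dots> = gho e * (vtx (tail E e) * vtx u)" by (simp add: mult.assoc)
  also have "\<dots> \<asymp> 0" using False by (intro cong_0_lmult vtx_orth) auto
  finally show ?thesis using False by simp
qed (simp add: gho_tail)

lemma edg_vtx: "edg e * vtx u \<asymp> (if u = head E e then edg e else 0)"
proof (cases "u = head E e")
  case False
  have "edg e * vtx u \<asymp> (edg e * vtx (head E e)) * vtx u"
    by (intro cong_rmult cong_sym[OF edg_head])
  also have "\<dots> = edg e * (vtx (head E e) * vtx u)" by (simp add: mult.assoc)
  also have "\<dots> \<asymp> 0" using False by (intro cong_0_lmult vtx_orth) auto
  finally show ?thesis using False by simp
qed (simp add: edg_head)

lemma gho_edg: "e \<in> arcs E \<Longrightarrow> gho e * edg f \<asymp> (if e = f then vtx (head E e) else 0)"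
  using gho_edg_same[of e] gho_edg_diff[of e f] by auto

lemma vtx_pe:
  assumes "awalk u p v"
  shows "vtx u' * (pe p * vtx v) \<asymp> (if u' = u then pe p * vtx v else 0)"
proof (cases p)
  case Nil
  thus ?thesis using assms by (auto simp: awalk_Nil_iff vtx_idem vtx_orth)
next
  case (Cons e q)
  have u: "u = tail E e" using assms Cons by (simp add: awalk_simps)
  have "vtx u' * (pe p * vtx v) = (vtx u' * edg e) * (pe q * vtx v)"
    by (simp add: Cons pe_Cons mult.assoc)
  also have "\<dots> \<asymp> (if u' = u then edg e else 0) * (pe q * vtx v)"
    unfolding u by (rule cong_rmult[OF vtx_edg])
  finally show ?thesis by (auto simp: Cons pe_Cons mult.assoc)
qed

text \<open>Ghost arcs and arcs meet in the middle, where equal ones cancel and different ones give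
  0; so the product survives exactly if \<open>p\<close> is a prefix of \<open>q\<close>. The length
  hypothesis excludes a remainder made of ghost arcs.\<close>

lemma gh_vtx_pe:
  assumes "awalk u p w" "awalk u' q v" "length p \<le> length q"
  shows "gh p * (vtx u * (pe q * vtx v))
      \<asymp> (if u = u' \<and> take (length p) q = p then pe (drop (length p) q) * vtx v else 0)"
  using assms
proof (induction p arbitrary: u u' q)
  case Nil
  thus ?case using vtx_pe[OF Nil(2), of u] by auto
next
  case (Cons e p)
  then obtain f q' where q: "q = f # q'" by (cases q) auto
  have e: "u = tail E e" "e \<in> arcs E" "awalk (head E e) p w" "u' = tail E f" "f \<in> arcs E"
      "awalk (head E f) q' v" using Cons.prems by (auto simp: awalk_simps q)
  have "gh (e # p) * (vtx u * (pe q * vtx v)) = gh p * ((gho e * vtx u) * (edg f * (pe q' * vtx v)))"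
    by (simp add: gh_Cons pe_Cons q mult.assoc)
  also have "\<dots> \<asymp> gh p * (gho e * (edg f * (pe q' * vtx v)))"
    using gho_tail e by (intro cong_lmult cong_rmult) auto
  also have "\<dots> = gh p * ((gho e * edg f) * (pe q' * vtx v))" by (simp add: mult.assoc)
  also have "\<dots> \<asymp> gh p * ((if e = f then vtx (head E e) else 0) * (pe q' * vtx v))"
    by (intro cong_lmult cong_rmult gho_edg e)
  also have "\<dots> \<asymp> (if u = u' \<and> take (length (e # p)) q = e # p
      then pe (drop (length (e # p)) q) * vtx v else 0)"
  proof (cases "e = f")
    case True
    thus ?thesis using Cons.IH[OF e(3) e(6)] Cons.prems(3) e by (auto simp: q)
  qed (auto simp: q)
  finally show ?case .
qed

lemma gh_vtx_pe_same: "awalk u p v \<Longrightarrow> gh p * (vtx u * (pe p * vtx v)) \<asymp> vtx v"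
  using gh_vtx_pe[of u p v u p v] by simp

lemma vtx_gen_unit: "\<exists>v. lpa_mon g * vtx v \<asymp> lpa_mon g"
  by (cases g) (metis vtx_idem, metis edg_head, metis gho_tail)

lemma single_word_unit:
  assumes "w \<noteq> []"
  shows "\<exists>v. Poly_Mapping.single (Word w) c * vtx v \<asymp> Poly_Mapping.single (Word w) c"
proof -
  obtain w' g where w: "w = w' @ [g]" using assms by (metis append_butlast_last_id)
  have eq: "Poly_Mapping.single (Word w) c = Poly_Mapping.single (Word w') c * lpa_mon g"
    by (simp add: w lpa_mon_def mult_single plus_free_monoid_def)
  obtain v where "lpa_mon g * vtx v \<asymp> lpa_mon g" using vtx_gen_unit by blast
  from cong_lmult[OF this, of "Poly_Mapping.single (Word w') c"] show ?thesis
    by (auto simp: eq mult.assoc)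
qed

text \<open>Each nonempty word is fixed from the right by one vertex, determined by its last letter.
  The sum over the set of these vertices fixes all words at once, because the other summands are
  orthogonal. This substitutes for an identity element.\<close>

lemma local_unit:
  assumes "poly_mapping.lookup p 0 = 0"
  shows "\<exists>V. finite V \<and> V \<subseteq> verts E \<and> p * (\<Sum>v\<in>V. vtx v) \<asymp> p"
proof -
  have "\<forall>w\<in>Poly_Mapping.keys p. \<exists>v. Poly_Mapping.single w (poly_mapping.lookup p w) * vtx v
      \<asymp> Poly_Mapping.single w (poly_mapping.lookup p w)"
  proof
    fix w assume "w \<in> Poly_Mapping.keys p"
    hence "letters w \<noteq> []" using assms
      by (metis Word_Nil free_monoid.collapse in_keys_iff)
    from single_word_unit[OF this] show "\<exists>v. Poly_Mapping.single w (poly_mapping.lookup p w) * vtx v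
      \<asymp> Poly_Mapping.single w (poly_mapping.lookup p w)" by simp
  qed
  then obtain s where s: "\<And>w. w \<in> Poly_Mapping.keys p \<Longrightarrow>
      Poly_Mapping.single w (poly_mapping.lookup p w) * vtx (s w) \<asymp> Poly_Mapping.single w (poly_mapping.lookup p w)"
    by metis
  define V where "V = s ` Poly_Mapping.keys p"
  have fV: "finite V" by (simp add: V_def)
  have "Poly_Mapping.single w (poly_mapping.lookup p w) * (\<Sum>v\<in>V. vtx v) \<asymp> Poly_Mapping.single w (poly_mapping.lookup p w)"
    if w: "w \<in> Poly_Mapping.keys p" for w
  proof -
    let ?m = "Poly_Mapping.single w (poly_mapping.lookup p w)"
    have "vtx (s w) * (\<Sum>v\<in>V. vtx v) = (\<Sum>v\<in>V. vtx (s w) * vtx v)"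
      by (simp add: sum_distrib_left)
    also have "\<dots> \<asymp> (\<Sum>v\<in>V. if v = s w then vtx (s w) else 0)"
      by (intro cong_sum) (auto simp: vtx_idem vtx_orth)
    also have "\<dots> = vtx (s w)" using w fV by (simp add: V_def)
    finally have 1: "vtx (s w) * (\<Sum>v\<in>V. vtx v) \<asymp> vtx (s w)" .
    have "?m * (\<Sum>v\<in>V. vtx v) \<asymp> (?m * vtx (s w)) * (\<Sum>v\<in>V. vtx v)"
      by (intro cong_rmult cong_sym[OF s[OF w]])
    also have "\<dots> = ?m * (vtx (s w) * (\<Sum>v\<in>V. vtx v))" by (simp add: mult.assoc)
    also have "\<dots> \<asymp> ?m * vtx (s w)" by (intro cong_lmult 1)
    also have "\<dots> \<asymp> ?m" by (rule s[OF w])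
    finally show ?thesis .
  qed
  hence "(\<Sum>w\<in>Poly_Mapping.keys p. Poly_Mapping.single w (poly_mapping.lookup p w) * (\<Sum>v\<in>V. vtx v))
      \<asymp> (\<Sum>w\<in>Poly_Mapping.keys p. Poly_Mapping.single w (poly_mapping.lookup p w))"
    by (intro cong_sum)
  hence 2: "p * (\<Sum>v\<in>V. vtx v) \<asymp> p"
    by (simp only: sum_distrib_right[symmetric] poly_mapping_eq_sum_single[symmetric])
  have "(\<Sum>v\<in>V. vtx v) - (\<Sum>v\<in>V \<inter> verts E. vtx v)
      = (\<Sum>v\<in>V - V \<inter> verts E. vtx v :: ('v, 'e, 'k) lpa_poly)"
    by (rule sum_diff[symmetric]) (use fV in auto)
  moreover have "(\<Sum>v\<in>V - V \<inter> verts E. vtx v :: ('v, 'e, 'k) lpa_poly) \<in> I" by (intro sum_mem vtx_invalid) auto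
  ultimately have "(\<Sum>v\<in>V \<inter> verts E. vtx v) \<asymp> (\<Sum>v\<in>V. vtx v)"
    by (intro cong_sym[of "(\<Sum>v\<in>V. vtx v)"]) (simp add: cong_def)
  hence "p * (\<Sum>v\<in>V \<inter> verts E. vtx v) \<asymp> p" using 2 by (meson cong_lmult cong_trans)
  thus ?thesis using fV by (intro exI[of _ "V \<inter> verts E"]) auto
qed

lemma vtx_local_mem:
  assumes "poly_mapping.lookup p 0 = 0" and "\<And>v. v \<in> verts E \<Longrightarrow> p * vtx v \<in> I"
  shows "p \<in> I"
proof -
  obtain V where V: "finite V" "V \<subseteq> verts E" "p * (\<Sum>v\<in>V. vtx v) \<asymp> p"
    using local_unit[OF assms(1)] by blast
  have "p * (\<Sum>v\<in>V. vtx v) \<in> I"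
    unfolding sum_distrib_left using V(2) by (intro sum_mem assms(2)) auto
  thus ?thesis using V(3) cong_mem_iff by blast
qed

end

section \<open>Reduction\<close>

definition live_arcs :: "('v, 'e) pre_digraph \<Rightarrow> 'v set \<Rightarrow> 'v \<Rightarrow> 'e set" where
  "live_arcs E H w = {e \<in> out_arcs E w. head E e \<in> verts E - H}"

text \<open>For an infinite \<open>F\<close> the sum has the default value 0, hence the finiteness
  assumptions wherever its product with an arc is computed.\<close>

definition arc_proj :: "'e set \<Rightarrow> ('v, 'e, 'k::field) lpa_poly" where
  "arc_proj F = (\<Sum>e\<in>F. edg e * gho e)"

definition breaking_elt ::
    "('v, 'e) pre_digraph \<Rightarrow> 'v set \<Rightarrow> 'v \<Rightarrow> ('v, 'e, 'k::field) lpa_poly" where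
  "breaking_elt E H w = vtx w - arc_proj (live_arcs E H w)"

definition ideal_vertices ::
    "('v, 'e) pre_digraph \<Rightarrow> ('v, 'e, 'k::field) lpa_poly set \<Rightarrow> 'v set" where
  "ideal_vertices E I = {v \<in> verts E. vtx v \<in> I}"

section \<open>Separating real paths from ghost arcs\<close>

context leavitt_ideal
begin

text \<open>Modulo \<open>I\<close>, these are the elements ending at \<open>v\<close> that can be
  written without ghost arcs. Indexing the coefficients by a set of paths keeps the terms distinct,
  so that a shortest one can be singled out.\<close>

definition real_span :: "'v \<Rightarrow> ('v, 'e, 'k) lpa_poly set" where
  "real_span v = {x. \<exists>A k. finite A \<and> (\<forall>p\<in>A. \<exists>u. awalk u p v) \<and>
     x \<asymp> (\<Sum>p\<in>A. cst (k p) * (pe p * vtx v))}"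

lemma real_span_zero: "0 \<in> real_span v"
  unfolding real_span_def by (auto intro!: exI[of _ "{}"])

lemma real_span_cong: "y \<in> real_span v \<Longrightarrow> x \<asymp> y \<Longrightarrow> x \<in> real_span v"
  unfolding real_span_def using cong_trans by blast

lemma real_span_single: "awalk u p v \<Longrightarrow> cst c * (pe p * vtx v) \<in> real_span v"
  unfolding real_span_def by (auto intro!: exI[of _ "{p}"] exI[of _ "\<lambda>_. c"])

lemma real_span_add:
  assumes "x \<in> real_span v" "y \<in> real_span v"
  shows "x + y \<in> real_span v"
proof -
  obtain A k where A: "finite A" "\<forall>p\<in>A. \<exists>u. awalk u p v"
    "x \<asymp> (\<Sum>p\<in>A. cst (k p) * (pe p * vtx v))" using assms(1) unfolding real_span_def by blast
  obtain B l where B: "finite B" "\<forall>p\<in>B. \<exists>u. awalk u p v"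
    "y \<asymp> (\<Sum>p\<in>B. cst (l p) * (pe p * vtx v))" using assms(2) unfolding real_span_def by blast
  define m where "m = (\<lambda>p. (if p \<in> A then k p else 0) + (if p \<in> B then l p else 0))"
  have "(\<Sum>p\<in>A \<union> B. cst (m p) * (pe p * vtx v :: ('v, 'e, 'k) lpa_poly))
      = (\<Sum>p\<in>A \<union> B. (if p \<in> A then cst (k p) * (pe p * vtx v) else 0))
        + (\<Sum>p\<in>A \<union> B. (if p \<in> B then cst (l p) * (pe p * vtx v) else 0))"
    unfolding sum.distrib[symmetric]
    by (intro sum.cong) (auto simp: m_def single_add distrib_right)
  also have "\<dots> = (\<Sum>p\<in>A. cst (k p) * (pe p * vtx v)) + (\<Sum>p\<in>B. cst (l p) * (pe p * vtx v))"
    using A(1) B(1) by (intro arg_cong2[where f = "(+)"])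
      (auto simp: sum.If_cases Int_absorb1)
  finally have "x + y \<asymp> (\<Sum>p\<in>A \<union> B. cst (m p) * (pe p * vtx v))"
    using cong_add[OF A(3) B(3)] by simp
  thus ?thesis unfolding real_span_def using A B by (auto intro!: exI[of _ "A \<union> B"] exI[of _ m])
qed

lemma real_span_sum: "(\<And>a. a \<in> A \<Longrightarrow> f a \<in> real_span v) \<Longrightarrow> sum f A \<in> real_span v"
  by (induction A rule: infinite_finite_induct) (auto intro: real_span_zero real_span_add)

text \<open>The letters act on the path from the last one to the first: a vertex keeps or kills it,
  an arc prolongs it or kills it, a ghost arc removes its first arc or kills it. Each letter
  shortens the path by at most one. Only when the path is used up can a ghost arc reach
  \<open>v\<close>; it then stays the rightmost factor, and further letters go into
  \<open>z\<close>.\<close>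

lemma word_path_cases:
  assumes "awalk u p v"
  shows "Poly_Mapping.single (Word w) 1 * (pe p * vtx v) \<asymp> 0 \<or>
    (\<exists>q u'. awalk u' q v \<and> length p \<le> length q + length w \<and>
      Poly_Mapping.single (Word w) 1 * (pe p * vtx v) \<asymp> pe q * vtx v) \<or>
    (length p < length w \<and> (\<exists>e z. e \<in> out_arcs E v \<and>
      Poly_Mapping.single (Word w) 1 * (pe p * vtx v) \<asymp> z * gho e))"
proof (induction w)
  case Nil
  thus ?case using assms by (intro disjI2 disjI1 exI[of _ p] exI[of _ u]) (auto simp: Word_Nil)
next
  case (Cons g w)
  let ?X = "Poly_Mapping.single (Word w) 1 * (pe p * vtx v) :: ('v, 'e, 'k) lpa_poly"
  have eq: "Poly_Mapping.single (Word (g # w)) 1 * (pe p * vtx v) = lpa_mon g * ?X"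
    by (subst single_Cons) (simp add: mult.assoc)
  consider (zero) "?X \<asymp> 0"
    | (path) q u' where "awalk u' q v" "length p \<le> length q + length w" "?X \<asymp> pe q * vtx v"
    | (ghost) e z where "length p < length w" "e \<in> out_arcs E v" "?X \<asymp> z * gho e"
    using Cons.IH by blast
  thus ?case
  proof cases
    case zero
    thus ?thesis unfolding eq by (intro disjI1) (rule cong_0_lmult)
  next
    case ghost
    have "lpa_mon g * ?X \<asymp> (lpa_mon g * z) * gho e"
      using cong_lmult[OF ghost(3)] by (simp add: mult.assoc)
    thus ?thesis unfolding eq using ghost by (intro disjI2) auto
  next
    case path
    have X: "lpa_mon g * ?X \<asymp> lpa_mon g * (pe q * vtx v)" by (rule cong_lmult[OF path(3)])
    show ?thesis
    proof (cases g)
      case (Vertex x)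
      have "lpa_mon g * ?X \<asymp> (if x = u' then pe q * vtx v else 0)"
        using cong_trans[OF X, unfolded Vertex, OF vtx_pe[OF path(1)]] by (simp add: Vertex)
      thus ?thesis unfolding eq using path by (cases "x = u'") auto
    next
      case (Edge f)
      show ?thesis
      proof (cases "f \<in> arcs E \<and> head E f = u'")
        case True
        hence "awalk (tail E f) (f # q) v" using path(1) by (simp add: awalk_simps)
        moreover have "lpa_mon g * ?X \<asymp> pe (f # q) * vtx v"
          using X by (simp add: Edge pe_Cons mult.assoc)
        ultimately show ?thesis unfolding eq using path(2)
          by (intro disjI2 disjI1 exI[of _ "f # q"] exI[of _ "tail E f"]) auto
      next
        case False
        have "edg f * vtx u' \<in> I"
          using False edg_vtx[of f u'] edg_invalid[of f] by (auto simp: cong_0_iff rmult_mem)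
        hence 0: "(edg f * vtx u') * (pe q * vtx v) \<asymp> 0" by (simp add: cong_0_iff rmult_mem)
        have "vtx u' * (pe q * vtx v) \<asymp> pe q * vtx v" using vtx_pe[OF path(1), of u'] by simp
        from cong_lmult[OF cong_sym[OF this], of "edg f"]
        have "edg f * (pe q * vtx v) \<asymp> (edg f * vtx u') * (pe q * vtx v)" by (simp add: mult.assoc)
        with X 0 have "lpa_mon g * ?X \<asymp> 0" unfolding Edge by (meson cong_trans)
        thus ?thesis unfolding eq by blast
      qed
    next
      case (Ghost f)
      show ?thesis
      proof (cases "f \<in> arcs E")
        case False
        hence "lpa_mon g * ?X \<asymp> 0"
          unfolding Ghost by (simp add: cong_0_iff rmult_mem gho_invalid)
        thus ?thesis unfolding eq by blast
      next
        case f: True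
        show ?thesis
        proof (cases q)
          case Nil
          have **: "lpa_mon g * ?X \<asymp> (if v = tail E f then 1 * gho f else 0)"
            using cong_trans[OF X[unfolded Ghost Nil pe_Nil mult_1_left] gho_vtx[of f v]]
            unfolding Ghost mult_1_left .
          have *: "length p < length (g # w)" using path(2) Nil by simp
          show ?thesis
          proof (cases "v = tail E f")
            case True
            hence "lpa_mon g * ?X \<asymp> 1 * gho f" using ** by simp
            with True f * show ?thesis unfolding eq
              by (intro disjI2 conjI exI[of _ f] exI[of _ 1]) auto
          next
            case False
            thus ?thesis unfolding eq using ** by simp
          qed
        next
          case (Cons h q')
          have h: "awalk (head E h) q' v" using path(1) by (simp add: Cons awalk_simps)
          have "lpa_mon g * ?X \<asymp> (gho f * edg h) * (pe q' * vtx v)"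
            using X by (simp add: Ghost Cons pe_Cons mult.assoc)
          also have "\<dots> \<asymp> (if f = h then vtx (head E f) else 0) * (pe q' * vtx v)"
            by (intro cong_rmult gho_edg f)
          also have "\<dots> \<asymp> (if f = h then pe q' * vtx v else 0)"
            using vtx_pe[OF h, of "head E h"] by auto
          finally have "lpa_mon g * ?X \<asymp> (if f = h then pe q' * vtx v else 0)" .
          moreover have "length p \<le> length q' + length (g # w)" using path(2) Cons by simp
          ultimately show ?thesis unfolding eq using h by (cases "f = h") auto
        qed
      qed
    qed
  qed
qed

text \<open>A path at least as long as every word of \<open>x\<close> cannot be used up, which
  excludes the ghost alternative of \<open>word_path_cases\<close>.\<close>

lemma long_path_real:
  assumes "awalk u p v" "\<And>w. w \<in> Poly_Mapping.keys x \<Longrightarrow> length (letters w) \<le> length p"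
  shows "x * (pe p * vtx v) \<in> real_span v"
proof -
  have "Poly_Mapping.single w c * (pe p * vtx v) \<in> real_span v"
    if "length (letters w) \<le> length p" for w and c :: 'k
  proof -
    let ?X = "Poly_Mapping.single w 1 * (pe p * vtx v) :: ('v, 'e, 'k) lpa_poly"
    have eq: "Poly_Mapping.single w c * (pe p * vtx v) = cst c * ?X"
      by (simp add: mult.assoc[symmetric] cst_times_single)
    from word_path_cases[OF assms(1), of "letters w"] that
    consider "?X \<asymp> 0" | q u' where "awalk u' q v" "?X \<asymp> pe q * vtx v" by auto
    thus ?thesis unfolding eq
    proof cases
      case 1
      from cong_0_lmult[OF this] show "cst c * ?X \<in> real_span v"
        by (rule real_span_cong[OF real_span_zero])
    next
      case 2
      from cong_lmult[OF 2(2)] show "cst c * ?X \<in> real_span v"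
        by (rule real_span_cong[OF real_span_single[OF 2(1)]])
    qed
  qed
  hence "(\<Sum>w\<in>Poly_Mapping.keys x. Poly_Mapping.single w (poly_mapping.lookup x w) * (pe p * vtx v))
      \<in> real_span v" by (intro real_span_sum) (use assms(2) in auto)
  thus ?thesis
    by (simp only: sum_distrib_right[symmetric] poly_mapping_eq_sum_single[symmetric])
qed

lemma arc_proj_edg:
  assumes "finite F" "F \<subseteq> arcs E"
  shows "arc_proj F * edg e \<asymp> (if e \<in> F then edg e else 0)"
proof -
  have "arc_proj F * edg e = (\<Sum>f\<in>F. edg f * (gho f * edg e))"
    by (simp add: arc_proj_def sum_distrib_right mult.assoc)
  also have "\<dots> \<asymp> (\<Sum>f\<in>F. if f = e then edg e else 0)"
  proof (rule cong_sum)
    fix f assume "f \<in> F"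
    hence f: "f \<in> arcs E" using assms by auto
    show "edg f * (gho f * edg e) \<asymp> (if f = e then edg e else 0)"
      using cong_trans[OF cong_lmult[OF gho_edg[OF f, of e], of "edg f"]] edg_head[of f]
      by (auto split: if_splits)
  qed
  finally show ?thesis using assms by simp
qed

lemma gho_arc_proj:
  assumes "finite F" "F \<subseteq> arcs E"
  shows "gho e * arc_proj F \<asymp> (if e \<in> F then gho e else 0)"
proof (cases "e \<in> arcs E")
  case False
  thus ?thesis using assms by (auto simp: cong_0_iff intro: rmult_mem gho_invalid)
next
  case e: True
  have "gho e * arc_proj F = (\<Sum>f\<in>F. (gho e * edg f) * gho f)"
    by (simp add: arc_proj_def sum_distrib_left mult.assoc)
  also have "\<dots> \<asymp> (\<Sum>f\<in>F. if f = e then gho e else 0)"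
  proof (rule cong_sum)
    fix f assume "f \<in> F"
    show "(gho e * edg f) * gho f \<asymp> (if f = e then gho e else 0)"
      using cong_trans[OF cong_rmult[OF gho_edg[OF e, of f], of "gho f"]] head_gho[of e]
      by (auto split: if_splits)
  qed
  finally show ?thesis using assms by simp
qed

lemma arc_proj_absorb:
  assumes "finite F'" "F' \<subseteq> arcs E" "F \<subseteq> F'"
  shows "arc_proj F * arc_proj F' \<asymp> arc_proj F"
proof -
  have "arc_proj F * arc_proj F' = (\<Sum>e\<in>F. edg e * (gho e * arc_proj F'))"
    by (simp add: arc_proj_def[of F] sum_distrib_right mult.assoc)
  also have "\<dots> \<asymp> (\<Sum>e\<in>F. edg e * gho e)"
  proof (intro cong_sum cong_lmult)
    fix e assume "e \<in> F"
    thus "gho e * arc_proj F' \<asymp> gho e" using gho_arc_proj[OF assms(1,2), of e] assms(3) by auto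
  qed
  finally show ?thesis by (simp add: arc_proj_def)
qed

lemma arc_proj_absorb_right:
  assumes "finite F'" "F' \<subseteq> arcs E" "F \<subseteq> F'" "t \<asymp> t * arc_proj F"
  shows "t \<asymp> t * arc_proj F'"
proof -
  have "t * arc_proj F' \<asymp> (t * arc_proj F) * arc_proj F'" by (rule cong_rmult[OF assms(4)])
  also have "\<dots> = t * (arc_proj F * arc_proj F')" by (simp add: mult.assoc)
  also have "\<dots> \<asymp> t * arc_proj F" by (rule cong_lmult[OF arc_proj_absorb[OF assms(1-3)]])
  also have "\<dots> \<asymp> t" by (rule cong_sym[OF assms(4)])
  finally show ?thesis by (rule cong_sym)
qed

text \<open>The words that still end in a ghost arc of \<open>v\<close> are collected in
  \<open>t\<close>. They involve only finitely many arcs \<open>F\<close>, so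
  \<open>arc_proj F\<close> fixes \<open>t\<close> from the right; later arguments use nothing else
  about \<open>t\<close>.\<close>

lemma real_ghost_decomposition:
  assumes "v \<in> verts E"
  shows "\<exists>y t F. y \<in> real_span v \<and> finite F \<and> F \<subseteq> out_arcs E v \<and>
    t \<asymp> t * arc_proj F \<and> x * vtx v \<asymp> y + t"
proof (induction x rule: poly_mapping_span_induct)
  case (single w c)
  let ?X = "Poly_Mapping.single w 1 * vtx v :: ('v, 'e, 'k) lpa_poly"
  have eq: "Poly_Mapping.single w c * vtx v = cst c * ?X"
    by (simp add: mult.assoc[symmetric] cst_times_single)
  have "awalk v [] v" using assms by (simp add: awalk_simps)
  from word_path_cases[OF this, of "letters w"]
  consider "?X \<asymp> 0" | q u' where "awalk u' q v" "?X \<asymp> pe q * vtx v"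
    | e z where "e \<in> out_arcs E v" "?X \<asymp> z * gho e" by auto
  thus ?case
  proof cases
    case 1
    hence "cst c * ?X \<asymp> 0 + 0" by (simp add: cong_0_lmult)
    thus ?thesis unfolding eq
      by (intro exI[of _ 0] exI[of _ "{}"]) (auto intro: real_span_zero)
  next
    case 2
    have "cst c * ?X \<asymp> cst c * (pe q * vtx v) + 0" using cong_lmult[OF 2(2)] by simp
    thus ?thesis unfolding eq using real_span_single[OF 2(1)]
      by (intro exI[of _ "cst c * (pe q * vtx v)"] exI[of _ 0] exI[of _ "{}"]) auto
  next
    case 3
    have "cst c * ?X \<asymp> 0 + (cst c * z) * gho e" using cong_lmult[OF 3(2)] by (simp add: mult.assoc)
    moreover have "(cst c * z) * gho e \<asymp> (cst c * z) * gho e * arc_proj {e}"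
      using cong_lmult[OF cong_sym[OF gho_arc_proj[of "{e}" e]], of "cst c * z"] 3(1)
      by (simp add: mult.assoc)
    ultimately show ?thesis unfolding eq using 3(1)
      by (intro exI[of _ 0] exI[of _ "(cst c * z) * gho e"] exI[of _ "{e}"])
        (auto intro: real_span_zero)
  qed
next
  case (add x x')
  obtain y t F where 1: "y \<in> real_span v" "finite F" "F \<subseteq> out_arcs E v"
    "t \<asymp> t * arc_proj F" "x * vtx v \<asymp> y + t" using add(1) by blast
  obtain y' t' F' where 2: "y' \<in> real_span v" "finite F'" "F' \<subseteq> out_arcs E v"
    "t' \<asymp> t' * arc_proj F'" "x' * vtx v \<asymp> y' + t'" using add(2) by blast
  have F: "finite (F \<union> F')" "F \<union> F' \<subseteq> arcs E" using 1 2 by auto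
  have "t + t' \<asymp> t * arc_proj (F \<union> F') + t' * arc_proj (F \<union> F')"
    by (intro cong_add arc_proj_absorb_right[OF F _ 1(4)] arc_proj_absorb_right[OF F _ 2(4)]) auto
  hence "t + t' \<asymp> (t + t') * arc_proj (F \<union> F')" by (simp add: distrib_right)
  moreover have "(x + x') * vtx v \<asymp> (y + y') + (t + t')"
    using cong_add[OF 1(5) 2(5)] by (simp add: algebra_simps)
  ultimately show ?case using real_span_add[OF 1(1) 2(1)] F 1(3) 2(3)
    by (intro exI[of _ "y + y'"] exI[of _ "t + t'"] exI[of _ "F \<union> F'"]) auto
qed

text \<open>A shortest path \<open>p1\<close> with nonzero coefficient is cancelled by its ghost
  path. No path in the sum is shorter, so no ghost arcs survive: every other path either extends
  \<open>p1\<close> by a closed path, since both end at \<open>v\<close>, or is sent to 0.\<close>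

lemma real_span_normalize:
  assumes "y \<in> real_span v" "y \<notin> I"
  shows "\<exists>a k C c. k \<noteq> 0 \<and> finite C \<and> (\<forall>p\<in>C. p \<noteq> [] \<and> awalk v p v) \<and>
    a * y \<asymp> cst k * vtx v + (\<Sum>p\<in>C. cst (c p) * (pe p * vtx v))"
proof -
  obtain A0 k where A0: "finite A0" "\<forall>p\<in>A0. \<exists>u. awalk u p v"
    "y \<asymp> (\<Sum>p\<in>A0. cst (k p) * (pe p * vtx v))" using assms(1) unfolding real_span_def by blast
  define A where "A = {p \<in> A0. k p \<noteq> 0}"
  have fA: "finite A" using A0 by (simp add: A_def)
  have "(\<Sum>p\<in>A0. cst (k p) * (pe p * vtx v)) = (\<Sum>p\<in>A. cst (k p) * (pe p * vtx v) :: ('v, 'e, 'k) lpa_poly)"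
    using A0(1) by (intro sum.mono_neutral_right) (auto simp: A_def)
  with A0 have yA: "y \<asymp> (\<Sum>p\<in>A. cst (k p) * (pe p * vtx v))" by simp
  have "A \<noteq> {}" using yA assms(2) by (auto simp: cong_0_iff)
  then obtain p1 where p1: "p1 \<in> A" "\<And>p. p \<in> A \<Longrightarrow> length p1 \<le> length p"
    using ex_has_least_nat[of "\<lambda>p. p \<in> A" _ length] by (metis all_not_in_conv)
  obtain s where s: "\<And>p. p \<in> A \<Longrightarrow> awalk (s p) p v"
    using A0(2) unfolding A_def by (metis (no_types, lifting) mem_Collect_eq)
  define a :: "('v, 'e, 'k) lpa_poly" where "a = gh p1 * vtx (s p1)"
  define B where "B = {p \<in> A. s p1 = s p \<and> take (length p1) p = p1}"
  define C where "C = drop (length p1) ` (B - {p1})"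
  have fB: "finite B" using fA by (simp add: B_def)
  have p1B: "p1 \<in> B" using p1 by (simp add: B_def)
  have split: "p1 @ drop (length p1) p = p" if "p \<in> B" for p
    using that unfolding B_def by (metis (mono_tags, lifting) append_take_drop_id mem_Collect_eq)
  \<comment> \<open>All paths in \<open>B\<close> begin with \<open>p1\<close>, so dropping this
    prefix merges no two terms.\<close>
  have inj: "inj_on (drop (length p1)) (B - {p1})"
    by (rule inj_onI) (metis split DiffD1)
  have "a * y \<asymp> (\<Sum>p\<in>A. cst (k p) * (gh p1 * (vtx (s p1) * (pe p * vtx v))))"
    using cong_lmult[OF yA, of a] by (simp add: a_def sum_distrib_left mult.assoc cst_left_commute)
  also have "\<dots> \<asymp> (\<Sum>p\<in>A. cst (k p) * (if s p1 = s p \<and> take (length p1) p = p1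
      then pe (drop (length p1) p) * vtx v else 0))"
    by (intro cong_sum cong_lmult) (rule gh_vtx_pe[OF s[OF p1(1)] s p1(2)])
  also have "\<dots> = (\<Sum>p\<in>A. if p \<in> B then cst (k p) * (pe (drop (length p1) p) * vtx v) else 0)"
    by (intro sum.cong) (auto simp: B_def)
  also have "\<dots> = (\<Sum>p\<in>B. cst (k p) * (pe (drop (length p1) p) * vtx v))"
    using fA by (subst sum.inter_restrict[symmetric]) (auto intro!: sum.cong simp: B_def)
  also have "\<dots> = cst (k p1) * vtx v + (\<Sum>p\<in>B - {p1}. cst (k p) * (pe (drop (length p1) p) * vtx v))"
    by (subst sum.remove[OF fB p1B]) simp
  also have "(\<Sum>p\<in>B - {p1}. cst (k p) * (pe (drop (length p1) p) * vtx v))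
      = (\<Sum>p\<in>C. cst (k (p1 @ p)) * (pe p * vtx v) :: ('v, 'e, 'k) lpa_poly)"
    unfolding C_def by (subst sum.reindex[OF inj]) (auto intro!: sum.cong simp: split)
  finally have main: "a * y \<asymp> cst (k p1) * vtx v + (\<Sum>p\<in>C. cst (k (p1 @ p)) * (pe p * vtx v))" .
  have "q \<noteq> [] \<and> awalk v q v" if qC: "q \<in> C" for q
  proof -
    obtain p where p: "p \<in> B" "p \<noteq> p1" "q = drop (length p1) p" using qC unfolding C_def by blast
    have "p = p1 @ q" using split[OF p(1)] p(3) by simp
    moreover have "awalk (s p1) p v" "awalk (s p1) p1 v"
      using s[of p] s[OF p1(1)] p(1) by (auto simp: B_def)
    ultimately show ?thesis using p(2) by (auto simp: awalk_append_iff dest: awalk_ends)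
  qed
  moreover have "k p1 \<noteq> 0" using p1 by (simp add: A_def)
  moreover have "finite C" using fB by (simp add: C_def)
  ultimately show ?thesis
    using main by (intro exI[of _ a] exI[of _ "k p1"] exI[of _ C] exI[of _ "\<lambda>p. k (p1 @ p)"]) simp
qed

end

section \<open>Breaking elements and the reduction of an element outside the ideal\<close>

context leavitt_ideal
begin

lemma arc_to_ideal_vertex:
  assumes "e \<in> arcs E" "head E e \<in> ideal_vertices E I"
  shows "edg e \<in> I" "gho e \<in> I"
proof -
  have "vtx (head E e) \<in> I" using assms by (simp add: ideal_vertices_def)
  thus "edg e \<in> I" "gho e \<in> I"
    using cong_mem_iff[OF edg_head[of e]] cong_mem_iff[OF head_gho[of e]]
    by (auto intro: lmult_mem rmult_mem)
qed

lemma mult_arc_proj_mem: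
  assumes "\<And>e. e \<in> F \<Longrightarrow> x * edg e \<in> I"
  shows "x * arc_proj F \<in> I"
  unfolding arc_proj_def sum_distrib_left mult.assoc[symmetric]
  by (intro sum_mem rmult_mem assms)

lemma arc_proj_mult_mem:
  assumes "\<And>e. e \<in> F \<Longrightarrow> gho e * x \<in> I"
  shows "arc_proj F * x \<in> I"
  unfolding arc_proj_def sum_distrib_right mult.assoc
  by (intro sum_mem lmult_mem assms)

lemma arc_proj_vtx:
  assumes "F \<subseteq> out_arcs E w"
  shows "arc_proj F * vtx w \<asymp> arc_proj F"
  unfolding arc_proj_def sum_distrib_right mult.assoc
proof (intro cong_sum cong_lmult)
  fix e assume "e \<in> F"
  hence "tail E e = w" using assms by auto
  thus "gho e * vtx w \<asymp> gho e" using gho_tail[of e] by simp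
qed

lemma live_arcs_subset: "live_arcs E H w \<subseteq> out_arcs E w"
  by (auto simp: live_arcs_def)

context
  fixes w
  assumes w: "w \<in> verts E" and fin: "finite (live_arcs E (ideal_vertices E I) w)"
begin

abbreviation (input) "bre \<equiv> breaking_elt E (ideal_vertices E I) w"

text \<open>An arc into the ideal vertices is itself in \<open>I\<close>, and a live arc is
  cancelled by the subtracted projection. Thus the breaking element annihilates every arc leaving
  \<open>w\<close>.\<close>

lemma breaking_elt_edg_mem:
  assumes "e \<in> out_arcs E w"
  shows "bre * edg e \<in> I"
proof -
  let ?L = "live_arcs E (ideal_vertices E I) w"
  have L: "?L \<subseteq> arcs E" using live_arcs_subset by fastforce
  have "bre * edg e = vtx w * edg e - arc_proj ?L * edg e"
    by (simp add: breaking_elt_def left_diff_distrib)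
  also have "\<dots> \<asymp> edg e - (if e \<in> ?L then edg e else 0)"
    using vtx_edg[of w e] assms by (intro cong_diff arc_proj_edg fin L) auto
  finally have "bre * edg e \<asymp> (if e \<in> ?L then 0 else edg e)" by (simp split: if_splits)
  moreover have "e \<notin> ?L \<Longrightarrow> edg e \<in> I"
    using assms arc_to_ideal_vertex[of e] by (auto simp: live_arcs_def)
  ultimately show ?thesis using cong_mem_iff zero_mem by (auto split: if_splits)
qed

lemma gho_breaking_elt_mem:
  assumes "e \<in> out_arcs E w"
  shows "gho e * bre \<in> I"
proof -
  let ?L = "live_arcs E (ideal_vertices E I) w"
  have L: "?L \<subseteq> arcs E" using live_arcs_subset by fastforce
  have "gho e * bre = gho e * vtx w - gho e * arc_proj ?L"
    by (simp add: breaking_elt_def right_diff_distrib)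
  also have "\<dots> \<asymp> gho e - (if e \<in> ?L then gho e else 0)"
    using gho_vtx[of e w] assms by (intro cong_diff gho_arc_proj fin L) auto
  finally have "gho e * bre \<asymp> (if e \<in> ?L then 0 else gho e)" by (simp split: if_splits)
  moreover have "e \<notin> ?L \<Longrightarrow> gho e \<in> I"
    using assms arc_to_ideal_vertex[of e] by (auto simp: live_arcs_def)
  ultimately show ?thesis using cong_mem_iff zero_mem by (auto split: if_splits)
qed

lemma breaking_elt_vtx: "bre * vtx w \<asymp> bre"
  using cong_diff[OF vtx_idem arc_proj_vtx[OF live_arcs_subset]]
  by (simp add: breaking_elt_def left_diff_distrib)

lemma breaking_elt_idem: "bre * bre \<asymp> bre"
proof -
  let ?L = "live_arcs E (ideal_vertices E I) w"
  have "bre * arc_proj ?L \<in> I"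
    using live_arcs_subset by (intro mult_arc_proj_mem breaking_elt_edg_mem) blast
  hence "bre * vtx w - bre * arc_proj ?L \<asymp> bre - 0"
    by (intro cong_diff breaking_elt_vtx) (simp add: cong_0_iff)
  thus ?thesis by (simp add: breaking_elt_def[of E _ w] right_diff_distrib)
qed

text \<open>Every closed path of positive length starts with an arc leaving \<open>w\<close>, which
  the breaking element on the left annihilates. Only the vertex term is left.\<close>

lemma breaking_elt_compress:
  assumes "\<And>p. p \<in> C \<Longrightarrow> p \<noteq> [] \<and> awalk w p w"
  shows "bre * (cst k * vtx w + (\<Sum>p\<in>C. cst (c p) * (pe p * vtx w))) * bre \<asymp> cst k * bre"
proof -
  have "(bre * vtx w) * bre \<asymp> bre"
    using cong_rmult[OF breaking_elt_vtx] breaking_elt_idem cong_trans by blast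
  moreover have "bre * (cst (c p) * (pe p * vtx w)) \<in> I" if pC: "p \<in> C" for p
  proof -
    obtain e p' where p: "p = e # p'" using assms[OF pC] by (cases p) auto
    hence "e \<in> out_arcs E w" using assms[OF pC] by (auto simp: awalk_simps)
    from rmult_mem[OF breaking_elt_edg_mem[OF this], of "pe p' * vtx w"]
    have "bre * (pe p * vtx w) \<in> I" by (simp add: p pe_Cons mult.assoc)
    thus ?thesis by (simp add: cst_left_commute lmult_mem)
  qed
  hence "(\<Sum>p\<in>C. bre * (cst (c p) * (pe p * vtx w))) * bre \<in> I" by (rule rmult_mem[OF sum_mem])
  ultimately have "cst k * ((bre * vtx w) * bre)
      + (\<Sum>p\<in>C. bre * (cst (c p) * (pe p * vtx w))) * bre \<asymp> cst k * bre + 0"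
    by (intro cong_add cong_lmult) (simp_all add: cong_0_iff)
  thus ?thesis
    by (simp add: distrib_left distrib_right sum_distrib_left cst_left_commute mult.assoc)
qed

end

text \<open>\<open>x\<close> is multiplied on the right by a path \<open>p\<close> that is as long
  as possible without falling into \<open>I\<close>, up to the length \<open>m\<close> of the
  longest word. If \<open>p\<close> has length \<open>m\<close>, all ghost arcs are absorbed and
  \<open>real_span_normalize\<close> applies. If it stops earlier, at \<open>w\<close>, the product
  \<open>X\<close> annihilates every arc leaving \<open>w\<close>. The sum relation then excludes a
  regular \<open>w\<close>, a sink has no ghost arcs, and an infinite emitter leads to its breaking
  element.\<close>

lemma reduction:
  assumes "poly_mapping.lookup x 0 = 0" "x \<notin> I"
  defines "H \<equiv> ideal_vertices E I"
  shows "(\<exists>a b v k C c. v \<in> verts E - H \<and> k \<noteq> 0 \<and> finite C \<and>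
        (\<forall>p\<in>C. p \<noteq> [] \<and> awalk v p v) \<and>
        a * x * b \<asymp> cst k * vtx v + (\<Sum>p\<in>C. cst (c p) * (pe p * vtx v))) \<or>
    (\<exists>a b w k. w \<in> verts E - H \<and> infinite (out_arcs E w) \<and> finite (live_arcs E H w) \<and>
        k \<noteq> 0 \<and> breaking_elt E H w \<notin> I \<and> a * x * b \<asymp> cst k * breaking_elt E H w)"
    (is "?closed \<or> ?breaking")
proof -
  obtain v0 where v0: "v0 \<in> verts E" "x * vtx v0 \<notin> I" using vtx_local_mem assms by blast
  define m where "m = Max (insert 0 ((\<lambda>w. length (letters w)) ` Poly_Mapping.keys x))"
  have m: "length (letters w) \<le> m" if "w \<in> Poly_Mapping.keys x" for w
    unfolding m_def using that by (intro Max_ge) auto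
  \<comment> \<open>The bound \<open>m\<close> guarantees a maximum even if there are arbitrarily
    long paths; nothing is lost, since a path of length \<open>m\<close> already absorbs all ghost
    arcs.\<close>
  define S where "S = {n. n \<le> m \<and> (\<exists>p w. length p = n \<and> awalk v0 p w \<and> x * (pe p * vtx w) \<notin> I)}"
  have S: "finite S" by (rule finite_subset[of _ "{..m}"]) (auto simp: S_def)
  have "0 \<in> S" using v0 by (auto simp: S_def awalk_simps)
  hence "Max S \<in> S" using S Max_in by blast
  then obtain p w where p: "length p = Max S" "Max S \<le> m" "awalk v0 p w" "x * (pe p * vtx w) \<notin> I"
    by (auto simp: S_def)
  define X where "X = x * (pe p * vtx w)"
  have X: "X \<notin> I" using p X_def by simp
  have w: "w \<in> verts E" using p(3) by (rule awalk_last_in_verts)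
  have wH: "w \<notin> H" using X by (auto simp: X_def H_def ideal_vertices_def intro: lmult_mem)
  have real_case: ?closed if y: "y \<in> real_span w" "y \<notin> I" "X \<asymp> y" for y
  proof -
    obtain a k C c where *: "k \<noteq> 0" "finite C" "\<forall>p\<in>C. p \<noteq> [] \<and> awalk w p w"
      "a * y \<asymp> cst k * vtx w + (\<Sum>p\<in>C. cst (c p) * (pe p * vtx w))"
      using real_span_normalize[OF y(1,2)] by blast
    have "a * X \<asymp> cst k * vtx w + (\<Sum>p\<in>C. cst (c p) * (pe p * vtx w))"
      using cong_trans[OF cong_lmult[OF y(3)] *(4)] .
    hence "a * x * (pe p * vtx w) \<asymp> cst k * vtx w + (\<Sum>p\<in>C. cst (c p) * (pe p * vtx w))"
      by (simp add: X_def mult.assoc)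
    with *(1-3) w wH show ?closed
      by (intro exI[of _ a] exI[of _ "pe p * vtx w"] exI[of _ w] exI[of _ k] exI[of _ C] exI[of _ c])
        simp
  qed
  show ?thesis
  proof (cases "length p = m")
    case True
    hence "X \<in> real_span w" unfolding X_def
      by (intro long_path_real[OF p(3)]) (use m in auto)
    from real_case[OF this X cong_refl] show ?thesis by (rule disjI1)
  next
    case False
    have Xedg: "X * edg e \<in> I" if e: "e \<in> out_arcs E w" for e
    proof (rule ccontr)
      assume "X * edg e \<notin> I"
      moreover have "X * edg e \<asymp> x * (pe (p @ [e]) * vtx (head E e))"
      proof -
        have "X * edg e = (x * pe p) * (vtx w * edg e)" by (simp add: X_def mult.assoc)
        also have "\<dots> \<asymp> (x * pe p) * edg e" using vtx_edg[of w e] e by (intro cong_lmult) auto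
        also have "\<dots> \<asymp> (x * pe p) * (edg e * vtx (head E e))"
          by (intro cong_lmult cong_sym[OF edg_head])
        finally show ?thesis by (simp add: pe_append pe_Cons mult.assoc)
      qed
      moreover have "awalk v0 (p @ [e]) (head E e)"
        using p(3) e by (intro awalk_appendI) (auto simp: arc_implies_awalk)
      moreover have "Suc (length p) \<le> m" using p(1,2) False by simp
      ultimately have "Suc (length p) \<in> S"
        unfolding S_def using cong_mem_iff
        by (intro CollectI conjI exI[of _ "p @ [e]"] exI[of _ "head E e"]) auto
      thus False using Max_ge[OF S] p(1) by fastforce
    qed
    obtain y t F where y: "y \<in> real_span w" "finite F" "F \<subseteq> out_arcs E w"
      "t \<asymp> t * arc_proj F" "(x * pe p) * vtx w \<asymp> y + t"
      using real_ghost_decomposition[OF w] by blast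
    have Xyt: "X \<asymp> y + t" using y(5) by (simp add: X_def mult.assoc)
    have Xproj: "X * arc_proj F' \<in> I" if "F' \<subseteq> out_arcs E w" for F'
      using that by (intro mult_arc_proj_mem Xedg) auto
    have XX: "X * vtx w \<asymp> X"
      unfolding X_def mult.assoc by (intro cong_lmult vtx_idem)
    consider (sink) "out_arcs E w = {}" | (regular) "regular_vertex E w" | (inf) "infinite (out_arcs E w)"
      using w by (auto simp: regular_vertex_def)
    thus ?thesis
    proof cases
      case sink
      hence "t \<asymp> 0" using y(3,4) by (simp add: arc_proj_def)
      hence "X \<asymp> y" using Xyt cong_add[OF cong_refl[of y], of t 0] cong_trans by fastforce
      moreover from this have "y \<notin> I" using X cong_mem_iff by blast
      ultimately show ?thesis using real_case[OF y(1)] by (intro disjI1)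
    next
      case regular
      have "X * vtx w \<asymp> X * arc_proj (out_arcs E w)"
        unfolding arc_proj_def by (intro cong_lmult regular_cong regular)
      hence False using Xproj[of "out_arcs E w"] X XX cong_mem_iff by blast
      thus ?thesis ..
    next
      case inf
      have Xt: "t \<asymp> X - y" using cong_sym[OF cong_diff[OF Xyt cong_refl[of y]]] by simp
      \<comment> \<open>Otherwise \<open>X\<close> and \<open>t\<close> agree modulo
        \<open>I\<close>. As \<open>X\<close> annihilates the projection that fixes
        \<open>t\<close>, both would lie in \<open>I\<close>.\<close>
      have yI: "y \<notin> I"
      proof
        assume "y \<in> I"
        hence "(X - y) * arc_proj F \<in> I"
          unfolding left_diff_distrib by (intro diff_mem Xproj y rmult_mem)
        hence "t \<in> I" using cong_mem_iff[OF y(4)] cong_mem_iff[OF cong_rmult[OF Xt]] by blast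
        thus False using X \<open>y \<in> I\<close> cong_mem_iff[OF Xyt] add_mem by blast
      qed
      have tedg: "t * edg e \<in> I" if "e \<notin> F" for e
      proof -
        have "F \<subseteq> arcs E" using y(3) by auto
        hence "arc_proj F * edg e \<in> I"
          using arc_proj_edg[OF y(2), of e] that by (simp add: cong_0_iff)
        hence "t * arc_proj F * edg e \<in> I" by (simp add: mult.assoc lmult_mem)
        thus ?thesis using cong_mem_iff[OF cong_rmult[OF y(4)]] by blast
      qed
      obtain a k C c where z: "k \<noteq> 0" "finite C" "\<And>p. p \<in> C \<Longrightarrow> p \<noteq> [] \<and> awalk w p w"
        "a * y \<asymp> cst k * vtx w + (\<Sum>p\<in>C. cst (c p) * (pe p * vtx w))"
        using real_span_normalize[OF y(1) yI] by blast
      define z where "z = cst k * vtx w + (\<Sum>p\<in>C. cst (c p) * (pe p * vtx w) :: ('v, 'e, 'k) lpa_poly)"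
      define q where "q = (breaking_elt E H w :: ('v, 'e, 'k) lpa_poly)"
      \<comment> \<open>Among infinitely many live arcs some \<open>e\<close> avoids
        \<open>F\<close> and the first arcs of the paths in \<open>C\<close>. It takes
        \<open>X\<close> and \<open>t\<close> into \<open>I\<close>, hence also \<open>y\<close>.
        Enclosing \<open>a * y\<close> between \<open>gho e\<close> and \<open>edg e\<close> leaves
        \<open>cst k\<close> times the head of \<open>e\<close>, which is not in
        \<open>I\<close>.\<close>
      have finL: "finite (live_arcs E H w)"
      proof (rule ccontr)
        assume "infinite (live_arcs E H w)"
        hence "infinite (live_arcs E H w - (F \<union> hd ` C))" using y(2) z(2) by simp
        then obtain e where e: "e \<in> live_arcs E H w" "e \<notin> F" "e \<notin> hd ` C"
          by (metis Diff_iff UnCI finite.emptyI ex_in_conv)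
        have e': "e \<in> arcs E" "tail E e = w" "head E e \<in> verts E - H"
          using e(1) by (auto simp: live_arcs_def)
        have "(X - t) * edg e \<in> I"
          unfolding left_diff_distrib using e' by (intro diff_mem Xedg tedg e) auto
        moreover have "X - t \<asymp> y" using cong_diff[OF Xyt cong_refl[of t]] by simp
        ultimately have "y * edg e \<in> I" using cong_mem_iff cong_rmult by blast
        hence "gho e * (a * y) * edg e \<in> I" by (simp add: mult.assoc lmult_mem)
        hence 1: "gho e * z * edg e \<in> I"
          using cong_mem_iff[OF cong_rmult[OF cong_lmult[OF z(4)]]] unfolding z_def by blast
        have "gho e * (cst (c p) * (pe p * vtx w)) \<in> I" if pC: "p \<in> C" for p
        proof -
          obtain h p' where h: "p = h # p'" using z(3)[OF pC] by (cases p) auto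
          hence "e \<noteq> h" using e(3) pC by (force simp: image_iff)
          hence "gho e * edg h \<in> I" using gho_edg_diff by (simp add: cong_0_iff)
          hence "(gho e * edg h) * (pe p' * vtx w) \<in> I" by (rule rmult_mem)
          thus ?thesis by (simp add: h pe_Cons cst_left_commute mult.assoc lmult_mem)
        qed
        hence 2: "(\<Sum>p\<in>C. gho e * (cst (c p) * (pe p * vtx w))) * edg e \<in> I"
          by (rule rmult_mem[OF sum_mem])
        have zeq: "gho e * z * edg e = cst k * (gho e * (vtx w * edg e))
            + (\<Sum>p\<in>C. gho e * (cst (c p) * (pe p * vtx w))) * edg e"
          by (simp add: z_def distrib_left distrib_right sum_distrib_left cst_left_commute mult.assoc)
        from diff_mem[OF 1 2] have "cst k * (gho e * (vtx w * edg e)) \<in> I"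
          unfolding zeq by simp
        hence "gho e * (vtx w * edg e) \<in> I" using z(1) cst_mult_cancel by blast
        moreover have "gho e * (vtx w * edg e) \<asymp> vtx (head E e)"
          using cong_trans[OF cong_lmult[OF tail_edg[of e], of "gho e"] gho_edg_same[OF e'(1)]]
          by (simp add: e'(2))
        ultimately show False using e'(3) cong_mem_iff by (auto simp: H_def ideal_vertices_def)
      qed
      note L = w finL[unfolded H_def]
      \<comment> \<open>Multiplication by \<open>q\<close> on the right fixes \<open>X\<close>,
        because \<open>X\<close> annihilates the live arcs, and removes \<open>t\<close>, because
        the ghost arcs of \<open>F\<close> annihilate \<open>q\<close>. So \<open>X\<close> is
        \<open>y * q\<close> modulo \<open>I\<close>, and a further factor \<open>q\<close> on the
        left of \<open>a * y\<close> removes the closed paths.\<close>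
      have "X * vtx w - X * arc_proj (live_arcs E H w) \<asymp> X - 0"
        using Xproj[OF live_arcs_subset] by (intro cong_diff XX) (simp add: cong_0_iff)
      hence "X * q \<asymp> X" by (simp add: q_def breaking_elt_def right_diff_distrib)
      hence "X \<asymp> (y + t) * q" using cong_rmult[OF Xyt, of q] cong_sym cong_trans by blast
      moreover have "t * q \<in> I"
      proof -
        have "arc_proj F * q \<in> I"
          using y(3) unfolding q_def H_def by (intro arc_proj_mult_mem gho_breaking_elt_mem L) auto
        hence "t * arc_proj F * q \<in> I" by (simp add: mult.assoc lmult_mem)
        thus ?thesis using cong_mem_iff[OF cong_rmult[OF y(4)]] by blast
      qed
      hence "y * q + t * q \<asymp> y * q + 0" by (intro cong_add) (simp_all add: cong_0_iff)
      hence "(y + t) * q \<asymp> y * q" by (simp add: distrib_right)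
      ultimately have Xyq: "X \<asymp> y * q" by (rule cong_trans)
      hence qI: "q \<notin> I" using X cong_mem_iff lmult_mem by blast
      have "(q * a) * X \<asymp> (q * a) * (y * q)" by (rule cong_lmult[OF Xyq])
      also have "\<dots> = q * (a * y) * q" by (simp add: mult.assoc)
      also have "\<dots> \<asymp> q * z * q" unfolding z_def by (intro cong_rmult cong_lmult z(4))
      also have "\<dots> \<asymp> cst k * q"
        unfolding z_def q_def H_def by (rule breaking_elt_compress[OF L z(3)])
      finally have "(q * a) * x * (pe p * vtx w) \<asymp> cst k * q" by (simp add: X_def mult.assoc)
      thus ?thesis using w wH inf finL z(1) qI
        by (intro disjI2 exI[of _ "q * a"] exI[of _ "pe p * vtx w"] exI[of _ w] exI[of _ k])
          (simp add: q_def)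
    qed
  qed
qed

end

section \<open>Condition (K)\<close>

context wf_digraph
begin

lemma first_return:
  assumes "awalk v p v" "p \<noteq> []"
  obtains d q where "p = d @ q" "simple_closed_path G v d" "awalk v q v"
proof -
  obtain e r where p: "p = e # r" using assms(2) by (cases p) auto
  define r1 r2 where "r1 = takeWhile (\<lambda>e. tail G e \<noteq> v) r" and "r2 = dropWhile (\<lambda>e. tail G e \<noteq> v) r"
  have r: "r = r1 @ r2" by (simp add: r1_def r2_def)
  have "awalk v ((e # r1) @ r2) v" using assms(1) by (simp add: p r)
  then obtain x where x: "awalk v (e # r1) x" "awalk x r2 v"
    by (metis awalk_append_iff)
  have "x = v"
  proof (cases r2)
    case Nil
    thus ?thesis using x by (simp add: awalk_simps)
  next
    case (Cons f s)
    hence "tail G f = v" unfolding r2_def by (metis (mono_tags) dropWhile_eq_Cons_conv)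
    thus ?thesis using x(2) Cons by (simp add: awalk_simps)
  qed
  moreover have "\<forall>f\<in>set r1. tail G f \<noteq> v" by (auto simp: r1_def dest: set_takeWhileD)
  ultimately show thesis using that[of "e # r1" r2] x by (auto simp: p r simple_closed_path_def)
qed

text \<open>The simple closed paths at \<open>v\<close> form a prefix code: a proper prefix would
  bring the longer one back to \<open>v\<close> before its end.\<close>

lemma simple_closed_path_append_eq:
  assumes "simple_closed_path G v c" "simple_closed_path G v d" "c @ x = d @ y"
  shows "c = d"
proof -
  have *: "s = []" if "simple_closed_path G v c" "simple_closed_path G v d" "c = d @ s" for c d s
  proof (rule ccontr)
    assume "s \<noteq> []"
    then obtain f s' where s: "s = f # s'" by (cases s) auto
    have d: "d \<noteq> []" "awalk v d v" using that(2) by (auto simp: simple_closed_path_def)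
    have "awalk v (d @ s) v" using that by (simp add: simple_closed_path_def)
    hence "tail G f = v" using d by (auto simp: s awalk_simps dest: awalk_ends)
    moreover have "f \<in> set (tl c)" using d by (simp add: that(3) s)
    ultimately show False using that(1) by (auto simp: simple_closed_path_def)
  qed
  from assms(3) obtain s where "c = d @ s \<or> d = c @ s" by (metis append_eq_append_conv2)
  thus ?thesis
  proof
    assume "c = d @ s"
    with *[OF assms(1,2) this] show ?thesis by simp
  next
    assume "d = c @ s"
    with *[OF assms(2,1) this] show ?thesis by simp
  qed
qed

text \<open>Factor both sides into simple closed paths; the factorisation is unique. Each step
  compares the first factor of \<open>p\<close> with \<open>c\<close> and cancels it, shortening
  \<open>p\<close> by at least one arc and lowering \<open>M\<close> by one. If all factors of
  \<open>p\<close> equal \<open>c\<close>, then \<open>p\<close> is exhausted while fewer than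
  \<open>N\<close> copies of \<open>c\<close> remain on the left, so \<open>c'\<close> faces a
  \<open>c\<close>. The lemma is used with \<open>M = N\<close> and nonempty \<open>p\<close>; the
  last hypothesis allows the induction to reach the empty path.\<close>

lemma closed_walk_shift_no_prefix:
  assumes "simple_closed_path G v c" "simple_closed_path G v c'" "c \<noteq> c'"
    and "awalk v p v" "length p \<le> M" "M \<le> N" "p = [] \<Longrightarrow> M < N"
  shows "concat (replicate M c) @ c' @ r \<noteq> p @ concat (replicate N c) @ c'"
  using assms(4-)
proof (induction M arbitrary: p)
  case 0
  then obtain j where "p = []" "N = Suc j" by (cases N) auto
  thus ?case using simple_closed_path_append_eq[OF assms(2,1), of r] assms(3) by auto
next
  case (Suc M)
  show ?case
  proof
    assume eq: "concat (replicate (Suc M) c) @ c' @ r = p @ concat (replicate N c) @ c'"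
    show False
    proof (cases "p = []")
      case True
      then obtain j where j: "N = Suc M + Suc j" using Suc.prems by (metis less_imp_Suc_add add_Suc_right)
      have "concat (replicate N c) = concat (replicate (Suc M) c) @ c @ concat (replicate j c)"
        unfolding j replicate_add by simp
      hence "c' @ r = c @ concat (replicate j c) @ c'" using eq True by simp
      thus False using simple_closed_path_append_eq[OF assms(2,1)] assms(3) by blast
    next
      case False
      then obtain d q where d: "p = d @ q" "simple_closed_path G v d" "awalk v q v"
        using first_return Suc.prems(1) by blast
      have "c @ (concat (replicate M c) @ c' @ r) = d @ (q @ concat (replicate N c) @ c')"
        using eq d by simp
      moreover from this have "c = d" using simple_closed_path_append_eq[OF assms(1) d(2)] by blast
      ultimately have "concat (replicate M c) @ c' @ r = q @ concat (replicate N c) @ c'" by simp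
      moreover have "length q \<le> M" using Suc.prems(2) d by (cases d) (auto simp: simple_closed_path_def)
      ultimately show False using Suc.IH[of q] d(3) Suc.prems(3) by simp
    qed
  qed
qed

lemma awalk_concat_replicate: "awalk v c v \<Longrightarrow> awalk v (concat (replicate n c)) v"
  by (induction n) (auto simp: awalk_simps dest: awalk_hd_in_verts)

end

context leavitt_ideal
begin

text \<open>With two simple closed paths \<open>d\<close> and \<open>d'\<close> at \<open>v\<close>,
  let \<open>q\<close> be \<open>d\<close> repeated \<open>N\<close> times followed by
  \<open>d'\<close>, where \<open>N\<close> bounds the lengths of the paths in \<open>C\<close>.
  Multiplying by \<open>gh q\<close> on the left and \<open>pe q\<close> on the right fixes
  \<open>v\<close>, and it kills each \<open>p\<close> in \<open>C\<close> because \<open>q\<close>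
  is not a prefix of \<open>p @ q\<close>.\<close>

lemma condition_K_isolate_vertex:
  assumes K: "condition_K E" and v: "v \<in> verts E" and C: "finite C"
    "\<And>p. p \<in> C \<Longrightarrow> p \<noteq> [] \<and> awalk v p v"
  shows "\<exists>a b. a * (cst k * vtx v + (\<Sum>p\<in>C. cst (c p) * (pe p * vtx v))) * b \<asymp> cst k * vtx v"
proof (cases "C = {}")
  case True
  thus ?thesis by (intro exI[of _ 1]) simp
next
  case False
  then obtain p0 where "p0 \<noteq> []" "awalk v p0 v" using C by blast
  then obtain d where d: "simple_closed_path E v d" using first_return by metis
  then obtain d' where d': "simple_closed_path E v d'" "d \<noteq> d'" using K v unfolding condition_K_def by metis
  define N where "N = Max (insert 0 (length ` C))"
  have N: "length p \<le> N" if "p \<in> C" for p unfolding N_def using that C by (intro Max_ge) auto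
  define q where "q = concat (replicate N d) @ d'"
  have q: "awalk v q v"
  proof -
    have "awalk v d v" "awalk v d' v" using d d'(1) by (simp_all add: simple_closed_path_def)
    thus ?thesis unfolding q_def by (rule awalk_appendI[OF awalk_concat_replicate])
  qed
  let ?a = "gh q * vtx v" and ?b = "pe q * vtx v"
  have vq: "vtx v * ?b \<asymp> ?b" using vtx_pe[OF q, of v] by simp
  have 1: "?a * vtx v * ?b \<asymp> vtx v"
  proof -
    have "?a * vtx v * ?b = gh q * (vtx v * (vtx v * ?b))" by (simp add: mult.assoc)
    also have "\<dots> \<asymp> gh q * (vtx v * ?b)" by (intro cong_lmult vq)
    also have "\<dots> \<asymp> vtx v" by (rule gh_vtx_pe_same[OF q])
    finally show ?thesis .
  qed
  have 2: "?a * (cst (c p) * (pe p * vtx v)) * ?b \<in> I" if p: "p \<in> C" for p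
  proof -
    have "take (length q) (p @ q) \<noteq> q"
    proof
      assume "take (length q) (p @ q) = q"
      then obtain r where "p @ q = q @ r" by (metis append_take_drop_id)
      thus False
        using closed_walk_shift_no_prefix[OF d d'(1) d'(2), of p N N r] C(2)[OF p] N[OF p]
        by (auto simp: q_def)
    qed
    hence 0: "gh q * (vtx v * (pe (p @ q) * vtx v)) \<asymp> 0"
      using gh_vtx_pe[OF q, of v "p @ q" v] C(2)[OF p] q by (auto simp: awalk_simps)
    have "?a * (pe p * vtx v) * ?b = (?a * pe p) * (vtx v * ?b)" by (simp only: mult.assoc)
    also have "(?a * pe p) * (vtx v * ?b) \<asymp> (?a * pe p) * ?b" by (intro cong_lmult vq)
    also have "(?a * pe p) * ?b = gh q * (vtx v * (pe (p @ q) * vtx v))"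
      by (simp only: pe_append mult.assoc)
    also note 0
    finally have "?a * (pe p * vtx v) * ?b \<asymp> 0" .
    hence "cst (c p) * (?a * (pe p * vtx v) * ?b) \<in> I" by (simp only: cong_0_iff lmult_mem)
    moreover have "?a * (cst (c p) * (pe p * vtx v)) = cst (c p) * (?a * (pe p * vtx v))"
      by (rule cst_left_commute)
    ultimately show ?thesis by (simp only: mult.assoc)
  qed
  have "?a * (cst k * vtx v) = cst k * (?a * vtx v)" by (rule cst_left_commute)
  hence "?a * (cst k * vtx v + (\<Sum>p\<in>C. cst (c p) * (pe p * vtx v))) * ?b
      = cst k * (?a * vtx v) * ?b + (\<Sum>p\<in>C. ?a * (cst (c p) * (pe p * vtx v)) * ?b)"
    by (simp only: distrib_left distrib_right sum_distrib_left sum_distrib_right)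
  also have "cst k * (?a * vtx v) * ?b = cst k * (?a * vtx v * ?b)" by (simp only: mult.assoc)
  also have "cst k * (?a * vtx v * ?b) + (\<Sum>p\<in>C. ?a * (cst (c p) * (pe p * vtx v)) * ?b)
      \<asymp> cst k * vtx v + 0"
    by (intro cong_add cong_lmult 1) (simp add: cong_0_iff sum_mem 2)
  finally show ?thesis by auto
qed

end

text \<open>An element of \<open>J\<close> outside \<open>I\<close> is reduced modulo
  \<open>I\<close>. By \<open>I \<subseteq> J\<close> the congruence also holds modulo
  \<open>J\<close>, so the reduced element lies in \<open>J\<close>. It yields a vertex or a
  breaking element in \<open>J\<close> but not in \<open>I\<close>, against the equality of the
  data. The closed paths are removed modulo \<open>J\<close>.\<close>

lemma leavitt_ideal_eqI:
  fixes I J :: "('v, 'e, 'k::field) lpa_poly set"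
  assumes I: "leavitt_ideal E I" and J: "leavitt_ideal E J" and sub: "I \<subseteq> J" and K: "condition_K E"
    and verts: "ideal_vertices E I = ideal_vertices E J"
    and brk: "\<And>w. w \<in> breaking_vertices E (ideal_vertices E J) \<Longrightarrow>
      breaking_elt E (ideal_vertices E J) w \<in> J \<Longrightarrow> breaking_elt E (ideal_vertices E J) w \<in> I"
  shows "I = J"
proof (rule ccontr)
  assume "I \<noteq> J"
  then obtain x where x: "x \<in> J" "x \<notin> I" using sub by blast
  interpret I: leavitt_ideal E I by (rule I)
  interpret J: leavitt_ideal E J by (rule J)
  have transfer: "y \<in> J" if "I.cong (a * x * b) y" for a b y
  proof -
    have "a * x * b - y \<in> J" using that sub by (auto simp: I.cong_def)
    moreover have "a * x * b \<in> J" by (intro J.lmult_mem J.rmult_mem x)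
    ultimately show ?thesis using J.diff_mem[of "a * x * b" "a * x * b - y"] by simp
  qed
  from I.reduction[OF J.const_coeff[OF x(1)] x(2)] show False
  proof (elim disjE exE conjE, goal_cases)
    case closed: (1 a b v k C c)
    from transfer[OF closed(5)]
    have z: "cst k * vtx v + (\<Sum>p\<in>C. cst (c p) * (pe p * vtx v)) \<in> J" .
    obtain a' b' where "J.cong (a' * (cst k * vtx v + (\<Sum>p\<in>C. cst (c p) * (pe p * vtx v))) * b')
        (cst k * vtx v)"
      using J.condition_K_isolate_vertex[OF K, of v C k c] closed(1,3,4) by blast
    hence "cst k * vtx v \<in> J" using z J.cong_mem_iff J.lmult_mem J.rmult_mem by blast
    hence "vtx v \<in> J" using closed(2) J.cst_mult_cancel by blast
    hence "v \<in> ideal_vertices E J" using closed(1) by (simp add: ideal_vertices_def)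
    thus False using closed(1) verts by blast
  next
    case breaking: (2 a b w k)
    let ?q = "breaking_elt E (ideal_vertices E I) w :: ('v, 'e, 'k) lpa_poly"
    have q: "?q \<in> J" using transfer[OF breaking(6)] breaking(4) J.cst_mult_cancel by blast
    show False
    \<comment> \<open>\<open>reduction\<close> also allows an infinite emitter without live arcs. It
      is no breaking vertex, and its breaking element is the vertex itself.\<close>
    proof (cases "live_arcs E (ideal_vertices E I) w = {}")
      case True
      hence "vtx w \<in> J" using q by (simp add: breaking_elt_def arc_proj_def)
      hence "w \<in> ideal_vertices E J" using breaking(1) by (simp add: ideal_vertices_def)
      thus False using breaking(1) verts by blast
    next
      case False
      hence "w \<in> breaking_vertices E (ideal_vertices E I)"
        using breaking(1-3) by (auto simp: breaking_vertices_def live_arcs_def)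
      thus False using brk[of w] q breaking(5) verts by simp
    qed
  qed
qed

section \<open>Finiteness and gradedness under Condition (K)\<close>

lemma (in leavitt_ideal) ideal_vertices_hereditary_saturated:
  "hereditary_saturated E (ideal_vertices E I)"
proof -
  have step: "vtx (head E e) \<in> I" if "e \<in> arcs E" "vtx (tail E e) \<in> I" for e
  proof -
    have "gho e * (vtx (tail E e) * edg e) \<in> I" using that by (intro lmult_mem rmult_mem)
    moreover have "gho e * (vtx (tail E e) * edg e) \<asymp> vtx (head E e)"
      using cong_trans[OF cong_lmult[OF tail_edg] gho_edg_same[OF that(1)]] .
    ultimately show ?thesis using cong_mem_iff by blast
  qed
  have "w \<in> ideal_vertices E I" if "awalk v p w" "v \<in> ideal_vertices E I" for v p w
    using that
  proof (induction p arbitrary: v)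
    case (Cons e p)
    thus ?case using step by (auto simp: awalk_simps ideal_vertices_def)
  qed (simp add: awalk_simps)
  moreover have "v \<in> ideal_vertices E I"
    if v: "regular_vertex E v" "head E ` out_arcs E v \<subseteq> ideal_vertices E I" for v
  proof -
    have "(\<Sum>e\<in>out_arcs E v. edg e * gho e) \<in> I"
      using v(2) by (intro sum_mem rmult_mem arc_to_ideal_vertex) auto
    thus ?thesis using regular_cong[OF v(1)] cong_mem_iff v(1)
      by (auto simp: ideal_vertices_def regular_vertex_def)
  qed
  ultimately show ?thesis
    by (auto simp: hereditary_saturated_def hereditary_def ideal_vertices_def)
qed

lemma leavitt_ideal_Int:
  assumes "leavitt_ideal E I" "leavitt_ideal E J"
  shows "leavitt_ideal E (I \<inter> J)"
proof -
  interpret I: leavitt_ideal E I by fact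
  interpret J: leavitt_ideal E J by fact
  show ?thesis
    by unfold_locales
      (auto intro: I.zero_mem J.zero_mem I.add_mem J.add_mem I.lmult_mem J.lmult_mem
        I.rmult_mem J.rmult_mem I.const_coeff I.invalid_mem J.invalid_mem
        subsetD[OF I.relators_mem] subsetD[OF J.relators_mem])
qed

text \<open>Two ideals with the same data are each compared with their intersection, which again has
  these data and provides the inclusion that \<open>leavitt_ideal_eqI\<close> requires.\<close>

lemma finite_leavitt_ideals:
  assumes K: "condition_K E" and fin: "finite {H. hereditary_saturated E H}"
    and brk: "\<And>H. hereditary_saturated E H \<Longrightarrow> finite (breaking_vertices E H)"
  shows "finite {I :: ('v, 'e, 'k::field) lpa_poly set. leavitt_ideal E I}"
proof -
  let ?S = "\<lambda>I :: ('v, 'e, 'k) lpa_poly set. {w \<in> breaking_vertices E (ideal_vertices E I).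
    breaking_elt E (ideal_vertices E I) w \<in> I}"
  let ?f = "\<lambda>I :: ('v, 'e, 'k) lpa_poly set. (ideal_vertices E I, ?S I)"
  have "inj_on ?f {I. leavitt_ideal E I}"
  proof (rule inj_onI)
    fix I J :: "('v, 'e, 'k) lpa_poly set"
    assume I: "I \<in> {I. leavitt_ideal E I}" and J: "J \<in> {I. leavitt_ideal E I}" and eq: "?f I = ?f J"
    have IJ: "leavitt_ideal E (I \<inter> J)" using I J leavitt_ideal_Int by blast
    have v: "ideal_vertices E (I \<inter> J) = ideal_vertices E I" "ideal_vertices E I = ideal_vertices E J"
      using eq by (auto simp: ideal_vertices_def)
    have "I \<inter> J = I"
      using I eq v by (intro leavitt_ideal_eqI[OF IJ _ _ K]) auto
    moreover have "I \<inter> J = J"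
      using J eq v by (intro leavitt_ideal_eqI[OF IJ _ _ K]) auto
    ultimately show "I = J" by simp
  qed
  moreover have "?f ` {I. leavitt_ideal E I}
      \<subseteq> (SIGMA H:{H. hereditary_saturated E H}. Pow (breaking_vertices E H))"
    using leavitt_ideal.ideal_vertices_hereditary_saturated by auto
  moreover have "finite (SIGMA H:{H. hereditary_saturated E H}. Pow (breaking_vertices E H))"
    using fin brk by (intro finite_SigmaI) auto
  ultimately show ?thesis using finite_subset finite_imageD by blast
qed

section \<open>Homogeneous components and the graded part of an ideal\<close>

definition keep :: "('a \<Rightarrow> bool) \<Rightarrow> ('a \<Rightarrow>\<^sub>0 'b::zero) \<Rightarrow> 'a \<Rightarrow>\<^sub>0 'b" where
  "keep P p = Poly_Mapping.mapp (\<lambda>w c. if P w then c else 0) p"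

lemma lookup_keep: "poly_mapping.lookup (keep P p) w = (if P w then poly_mapping.lookup p w else 0)"
  by (simp add: keep_def lookup_mapp when_def in_keys_iff)

lemma keep_zero [simp]: "keep P 0 = 0"
  by (rule poly_mapping_eqI) (simp add: lookup_keep)

lemma keep_add: "keep P (p + q :: _ \<Rightarrow>\<^sub>0 _::monoid_add) = keep P p + keep P q"
  by (rule poly_mapping_eqI) (simp add: lookup_keep lookup_add)

lemma keep_diff: "keep P (p - q :: _ \<Rightarrow>\<^sub>0 _::cancel_comm_monoid_add) = keep P p - keep P q"
  by (rule poly_mapping_eqI) (simp add: lookup_keep lookup_minus)

lemma keep_single: "keep P (Poly_Mapping.single w c) = (if P w then Poly_Mapping.single w c else 0)"
  by (rule poly_mapping_eqI) (auto simp: lookup_keep lookup_single when_def)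

lemma keys_keep: "Poly_Mapping.keys (keep P p) = {w \<in> Poly_Mapping.keys p. P w}"
  by (auto simp: in_keys_iff lookup_keep split: if_splits)

lemma keep_id: "(\<And>w. w \<in> Poly_Mapping.keys p \<Longrightarrow> P w) \<Longrightarrow> keep P p = p"
  by (rule poly_mapping_eqI) (auto simp: lookup_keep in_keys_iff)

lemma keep_none: "(\<And>w. w \<in> Poly_Mapping.keys p \<Longrightarrow> \<not> P w) \<Longrightarrow> keep P p = 0"
  by (rule poly_mapping_eqI) (auto simp: lookup_keep in_keys_iff)

lemma word_degree_add: "word_degree (x + y) = word_degree x + word_degree y"
  by (simp add: word_degree_def plus_free_monoid_def)

abbreviation component :: "int \<Rightarrow> ('v, 'e, 'k::field) lpa_poly \<Rightarrow> ('v, 'e, 'k) lpa_poly" where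
  "component n \<equiv> keep (\<lambda>w. word_degree w = n)"

lemma sum_components:
  assumes "finite N" "word_degree ` Poly_Mapping.keys p \<subseteq> N"
  shows "(\<Sum>n\<in>N. component n p) = p"
proof (rule poly_mapping_eqI)
  fix w
  have "(\<Sum>n\<in>N. poly_mapping.lookup (component n p) w)
      = (if word_degree w \<in> N then poly_mapping.lookup p w else 0)"
    using assms(1) by (simp add: lookup_keep)
  also have "\<dots> = poly_mapping.lookup p w"
    using assms(2) by (auto simp: in_keys_iff image_subset_iff)
  finally show "poly_mapping.lookup (\<Sum>n\<in>N. component n p) w = poly_mapping.lookup p w"
    by (simp add: lookup_sum)
qed

lemma component_single_mult:
  "component n (Poly_Mapping.single w c * p) = Poly_Mapping.single w c * component (n - word_degree w) p"
  by (induction p rule: poly_mapping_span_induct)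
    (auto simp: mult_single keep_single keep_add distrib_left word_degree_add)

lemma component_mult_single:
  "component n (p * Poly_Mapping.single w c) = component (n - word_degree w) p * Poly_Mapping.single w c"
  by (induction p rule: poly_mapping_span_induct)
    (auto simp: mult_single keep_single keep_add distrib_right word_degree_add)

definition homogeneous :: "int \<Rightarrow> ('v, 'e, 'k::field) lpa_poly \<Rightarrow> bool" where
  "homogeneous d p \<longleftrightarrow> (\<forall>w\<in>Poly_Mapping.keys p. word_degree w = d)"

lemma homogeneous_lpa_mon: "homogeneous (gen_degree g) (lpa_mon g)"
  by (simp add: homogeneous_def lpa_mon_def word_degree_def)

lemma homogeneous_mult: "homogeneous m p \<Longrightarrow> homogeneous n q \<Longrightarrow> homogeneous (m + n) (p * q)"
  using keys_mult[of p q] by (fastforce simp: homogeneous_def word_degree_add)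

lemma homogeneous_diff: "homogeneous n p \<Longrightarrow> homogeneous n q \<Longrightarrow> homogeneous n (p - q)"
  by (auto simp: homogeneous_def in_keys_iff lookup_minus)

lemma homogeneous_sum: "(\<And>x. x \<in> A \<Longrightarrow> homogeneous n (f x)) \<Longrightarrow> homogeneous n (sum f A)"
  using keys_sum[of f A] by (fastforce simp: homogeneous_def)

lemma homogeneous_component: "homogeneous d p \<Longrightarrow> component n p = (if n = d then p else 0)"
  by (auto simp: homogeneous_def intro: keep_id keep_none)

lemma homogeneous_vtx: "homogeneous 0 (vtx v)"
  using homogeneous_lpa_mon[of "Vertex v"] by simp

lemma homogeneous_edg: "homogeneous 1 (edg e)"
  using homogeneous_lpa_mon[of "Edge e"] by simp

lemma homogeneous_gho: "homogeneous (-1) (gho e)"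
  using homogeneous_lpa_mon[of "Ghost e"] by simp

text \<open>In this form the degree of the product is free and the addition of degrees remains as a
  separate equation.\<close>

lemmas homogeneous_mult' = homogeneous_mult[THEN back_subst[of "\<lambda>d. homogeneous d _"]]

lemma homogeneous_arc_proj: "homogeneous 0 (arc_proj F)"
  unfolding arc_proj_def
  by (intro homogeneous_sum homogeneous_mult'[OF homogeneous_edg homogeneous_gho]) simp

lemma homogeneous_breaking_elt: "homogeneous 0 (breaking_elt E H w)"
  unfolding breaking_elt_def by (intro homogeneous_diff homogeneous_vtx homogeneous_arc_proj)

lemma homogeneous_relator: "p \<in> lpa_relators E \<Longrightarrow> \<exists>d. homogeneous d p"
  unfolding lpa_relators_def
proof (elim UnE CollectE exE conjE, goal_cases)
  case (1 v)
  show ?case unfolding 1(1)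
    by (rule exI, rule homogeneous_diff[OF homogeneous_mult'[OF homogeneous_vtx homogeneous_vtx] homogeneous_vtx], simp)
next
  case (2 u v)
  show ?case unfolding 2(1)
    by (rule exI, rule homogeneous_mult[OF homogeneous_vtx homogeneous_vtx])
next
  case (3 e)
  show ?case unfolding 3(1)
    by (rule exI, rule homogeneous_diff[OF homogeneous_mult'[OF homogeneous_vtx homogeneous_edg] homogeneous_edg], simp)
next
  case (4 e)
  show ?case unfolding 4(1)
    by (rule exI, rule homogeneous_diff[OF homogeneous_mult'[OF homogeneous_edg homogeneous_vtx] homogeneous_edg], simp)
next
  case (5 e)
  show ?case unfolding 5(1)
    by (rule exI, rule homogeneous_diff[OF homogeneous_mult'[OF homogeneous_vtx homogeneous_gho] homogeneous_gho], simp)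
next
  case (6 e)
  show ?case unfolding 6(1)
    by (rule exI, rule homogeneous_diff[OF homogeneous_mult'[OF homogeneous_gho homogeneous_vtx] homogeneous_gho], simp)
next
  case (7 e)
  show ?case unfolding 7(1)
    by (rule exI, rule homogeneous_diff[OF homogeneous_mult'[OF homogeneous_gho homogeneous_edg] homogeneous_vtx], simp)
next
  case (8 e f)
  show ?case unfolding 8(1)
    by (rule exI, rule homogeneous_mult[OF homogeneous_gho homogeneous_edg])
next
  case (9 v)
  show ?case unfolding 9(1) arc_proj_def[symmetric]
    by (rule exI, rule homogeneous_diff[OF homogeneous_vtx homogeneous_arc_proj])
qed

definition homogeneous_core :: "('v, 'e, 'k::field) lpa_poly set \<Rightarrow> ('v, 'e, 'k) lpa_poly set" where
  "homogeneous_core I = {p. \<forall>n. component n p \<in> I}"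

context leavitt_ideal
begin

lemma homogeneous_in_core: "homogeneous d p \<Longrightarrow> p \<in> homogeneous_core I \<longleftrightarrow> p \<in> I"
  by (auto simp: homogeneous_core_def homogeneous_component zero_mem)

lemma homogeneous_core_subset: "homogeneous_core I \<subseteq> I"
proof
  fix p assume p: "p \<in> homogeneous_core I"
  have "(\<Sum>n\<in>word_degree ` Poly_Mapping.keys p. component n p) \<in> I"
    using p by (intro sum_mem) (simp add: homogeneous_core_def)
  thus "p \<in> I" using sum_components[of "word_degree ` Poly_Mapping.keys p" p] by simp
qed

text \<open>Multiplication by a monomial only shifts components, so the ideal laws are checked for
  monomials and extended by addition. The relators and the generators outside \<open>E\<close> are
  homogeneous, hence lie in the core as soon as they lie in \<open>I\<close>.\<close>

lemma leavitt_ideal_homogeneous_core: "leavitt_ideal E (homogeneous_core I)"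
proof
  have add: "p + q \<in> homogeneous_core I" if "p \<in> homogeneous_core I" "q \<in> homogeneous_core I" for p q
    using that by (auto simp: homogeneous_core_def keep_add intro: add_mem)
  show "0 \<in> homogeneous_core I" by (simp add: homogeneous_core_def zero_mem)
  show "p + q \<in> homogeneous_core I" if "p \<in> homogeneous_core I" "q \<in> homogeneous_core I" for p q
    using that by (rule add)
  show "a * p \<in> homogeneous_core I" if p: "p \<in> homogeneous_core I" for a p
  proof (induction a rule: poly_mapping_span_induct)
    case (single w c)
    thus ?case using p by (simp add: homogeneous_core_def component_single_mult lmult_mem)
  qed (simp add: distrib_right add)
  show "p * a \<in> homogeneous_core I" if p: "p \<in> homogeneous_core I" for a p
  proof (induction a rule: poly_mapping_span_induct)
    case (single w c)
    thus ?case using p by (simp add: homogeneous_core_def component_mult_single rmult_mem)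
  qed (simp add: distrib_left add)
  show "poly_mapping.lookup p 0 = 0" if "p \<in> homogeneous_core I" for p
    using that homogeneous_core_subset const_coeff by blast
  show "lpa_relators E \<subseteq> homogeneous_core I"
    using homogeneous_relator homogeneous_in_core relators_mem by blast
  show "lpa_mon g \<in> homogeneous_core I" if "g \<notin> lpa_gens E" for g
    using homogeneous_in_core[OF homogeneous_lpa_mon] invalid_mem[OF that] by blast
qed

text \<open>Vertices and breaking elements have degree 0, so the core contains the same ones as
  \<open>I\<close>, and \<open>leavitt_ideal_eqI\<close> applies.\<close>

lemma condition_K_homogeneous:
  assumes "condition_K E"
  shows "homogeneous_core I = I"
proof (rule leavitt_ideal_eqI[OF leavitt_ideal_homogeneous_core _ homogeneous_core_subset assms])
  show "leavitt_ideal E I" by unfold_locales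
  show "ideal_vertices E (homogeneous_core I) = ideal_vertices E I"
    using homogeneous_in_core[OF homogeneous_vtx] by (auto simp: ideal_vertices_def)
qed (use homogeneous_in_core[OF homogeneous_breaking_elt] in auto)

end

section \<open>Ideals from branching systems\<close>

lemma plus_eq_0_iff_free_monoid: "x + y = 0 \<longleftrightarrow> x = 0 \<and> (y :: 'g free_monoid) = 0"
  by (cases x; cases y) (simp add: plus_free_monoid_def zero_free_monoid_def)

lemma lookup_times_0:
  fixes p q :: "'g free_monoid \<Rightarrow>\<^sub>0 'k::field"
  shows "poly_mapping.lookup (p * q) 0 = poly_mapping.lookup p 0 * poly_mapping.lookup q 0"
proof (induction p rule: poly_mapping_span_induct)
  case (single w c)
  show ?case
    by (induction q rule: poly_mapping_span_induct)
      (auto simp: mult_single lookup_single when_def plus_eq_0_iff_free_monoid lookup_add algebra_simps)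
qed (simp add: lookup_add algebra_simps)

lemma lookup_lpa_mon_0: "poly_mapping.lookup (lpa_mon g) 0 = 0"
  by (simp add: lpa_mon_def lookup_single zero_free_monoid_def)

lemma lookup_relator_0: "p \<in> lpa_relators E \<Longrightarrow> poly_mapping.lookup p 0 = 0"
  unfolding lpa_relators_def
  by (elim UnE CollectE exE conjE)
    (simp_all only: lookup_minus lookup_times_0 lookup_lpa_mon_0 lookup_sum mult_zero_left
      mult_zero_right sum.neutral_const diff_self)

text \<open>
  The sets \<open>D v\<close> and the bijections \<open>f e\<close> of \<open>D (r e)\<close> with pairwise disjoint parts of \<open>D (s e)\<close>
  make the algebra act on functions. The sum condition given by the commuting shift \<open>\<sigma>\<close> and the
  number \<open>m\<close> cuts out a submodule; it is void for \<open>m = 0\<close>.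
\<close>

locale branching_system = wf_digraph E for E :: "('v, 'e) pre_digraph" +
  fixes D :: "'v \<Rightarrow> 'x set" and f :: "'e \<Rightarrow> 'x \<Rightarrow> 'x" and \<sigma> :: "'x \<Rightarrow> 'x" and m :: nat
  assumes D_disjoint: "x \<in> D u \<Longrightarrow> x \<in> D v \<Longrightarrow> u = v"
    and f_inj: "e \<in> arcs E \<Longrightarrow> inj_on (f e) (D (head E e))"
    and f_into: "e \<in> arcs E \<Longrightarrow> x \<in> D (head E e) \<Longrightarrow> f e x \<in> D (tail E e)"
    and f_disjoint: "e \<in> arcs E \<Longrightarrow> e' \<in> arcs E \<Longrightarrow> x \<in> D (head E e) \<Longrightarrow> x' \<in> D (head E e') \<Longrightarrow>
      f e x = f e' x' \<Longrightarrow> e = e'"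
    and f_cover: "regular_vertex E v \<Longrightarrow> x \<in> D v \<Longrightarrow> \<exists>e\<in>out_arcs E v. x \<in> f e ` D (head E e)"
    and shift_bij: "bij \<sigma>"
    and shift_D: "\<sigma> x \<in> D v \<longleftrightarrow> x \<in> D v"
    and shift_f: "e \<in> arcs E \<Longrightarrow> x \<in> D (head E e) \<Longrightarrow> f e (\<sigma> x) = \<sigma> (f e x)"
begin

text \<open>A generator acts on functions by precomposition with this partial map on points.
  Therefore an arc uses the inverse of \<open>f e\<close> and its ghost uses \<open>f e\<close>, and
  in \<open>run\<close> the first letter moves the point first.\<close>

fun step :: "('v, 'e) lpa_gen \<Rightarrow> 'x \<Rightarrow> 'x option" where
  "step (Vertex v) x = (if v \<in> verts E \<and> x \<in> D v then Some x else None)"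
| "step (Edge e) x = (if e \<in> arcs E \<and> x \<in> f e ` D (head E e)
     then Some (inv_into (D (head E e)) (f e) x) else None)"
| "step (Ghost e) x = (if e \<in> arcs E \<and> x \<in> D (head E e) then Some (f e x) else None)"

primrec run :: "('v, 'e) lpa_gen list \<Rightarrow> 'x \<Rightarrow> 'x option" where
  "run [] x = Some x"
| "run (g # w) x = (case step g x of None \<Rightarrow> None | Some y \<Rightarrow> run w y)"

definition ev :: "('x \<Rightarrow> 'k::field) \<Rightarrow> 'x option \<Rightarrow> 'k" where
  "ev \<phi> r = (case r of None \<Rightarrow> 0 | Some y \<Rightarrow> \<phi> y)"

definition act :: "('v, 'e, 'k::field) lpa_poly \<Rightarrow> ('x \<Rightarrow> 'k) \<Rightarrow> 'x \<Rightarrow> 'k" where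
  "act p \<phi> x = (\<Sum>w\<in>Poly_Mapping.keys p. poly_mapping.lookup p w * ev \<phi> (run (letters w) x))"

lemma ev_simps [simp]: "ev \<phi> None = 0" "ev \<phi> (Some y) = \<phi> y"
  by (simp_all add: ev_def)

lemma ev_zero: "ev (\<lambda>_. 0) r = 0"
  by (cases r) simp_all

lemma ev_add: "ev (\<lambda>x. \<phi> x + \<psi> x) r = ev \<phi> r + ev \<psi> r"
  by (cases r) simp_all

lemma run_append: "run (w @ w') x = (case run w x of None \<Rightarrow> None | Some y \<Rightarrow> run w' y)"
  by (induction w arbitrary: x) (auto split: option.split)

lemma act_superset:
  assumes "finite A" "Poly_Mapping.keys p \<subseteq> A"
  shows "act p \<phi> x = (\<Sum>w\<in>A. poly_mapping.lookup p w * ev \<phi> (run (letters w) x))"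
  unfolding act_def using assms by (intro sum.mono_neutral_left) (auto simp: in_keys_iff)

lemma act_single: "act (Poly_Mapping.single w c) \<phi> x = c * ev \<phi> (run (letters w) x)"
  by (subst act_superset[of "{w}"]) auto

lemma act_add: "act (p + q) \<phi> x = act p \<phi> x + act q \<phi> x"
  using keys_add[of p q]
  by (simp add: act_superset[of "Poly_Mapping.keys p \<union> Poly_Mapping.keys q"] lookup_add
      distrib_right sum.distrib)

lemma act_zero: "act 0 \<phi> x = 0"
  by (simp add: act_def)

lemma act_uminus: "act (- p) \<phi> x = - act p \<phi> x"
  using act_add[of p "- p" \<phi> x] by (simp add: act_zero eq_neg_iff_add_eq_0 add.commute)

lemma act_diff: "act (p - q) \<phi> x = act p \<phi> x - act q \<phi> x"
  using act_add[of p "- q" \<phi> x] by (simp add: act_uminus)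

lemma act_sum: "act (sum h A) \<phi> x = (\<Sum>a\<in>A. act (h a) \<phi> x)"
  by (induction A rule: infinite_finite_induct) (simp_all add: act_zero act_add)

lemma act_mult: "act (p * q) \<phi> = act p (act q \<phi>)"
proof
  fix x
  show "act (p * q) \<phi> x = act p (act q \<phi>) x"
  proof (induction p rule: poly_mapping_span_induct)
    case (single w c)
    show ?case
      by (induction q rule: poly_mapping_span_induct)
        (auto simp: mult_single act_single act_add plus_free_monoid_def run_append distrib_left
          ev_add split: option.split)
  qed (simp add: distrib_right act_add)
qed

lemma act_fun_zero: "act p (\<lambda>_. 0) x = 0"
  by (simp add: act_def ev_zero)

lemma act_one: "act 1 \<phi> x = \<phi> x"
proof -
  have "act (Poly_Mapping.single (Word []) 1) \<phi> x = \<phi> x" by (simp add: act_single)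
  thus ?thesis by (simp only: Word_Nil single_one)
qed

lemma act_lpa_mon: "act (lpa_mon g) \<phi> x = ev \<phi> (step g x)"
  by (simp add: lpa_mon_def act_single split: option.split)

lemma act_vtx: "act (vtx v) \<phi> x = (if v \<in> verts E \<and> x \<in> D v then \<phi> x else 0)"
  by (simp add: act_lpa_mon)

lemma act_gho: "act (gho e) \<phi> x = (if e \<in> arcs E \<and> x \<in> D (head E e) then \<phi> (f e x) else 0)"
  by (simp add: act_lpa_mon)

lemma act_edg: "act (edg e) \<phi> x = (if e \<in> arcs E \<and> x \<in> f e ` D (head E e)
     then \<phi> (inv_into (D (head E e)) (f e) x) else 0)"
  by (simp add: act_lpa_mon)

lemma act_edg_image: "e \<in> arcs E \<Longrightarrow> x \<in> D (head E e) \<Longrightarrow> act (edg e) \<phi> (f e x) = \<phi> x"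
  by (simp add: act_edg inv_into_f_f f_inj)

lemma act_edg_gho:
  "act (edg e * gho e) \<phi> x = (if e \<in> arcs E \<and> x \<in> f e ` D (head E e) then \<phi> x else 0)"
  by (auto simp: act_mult act_edg act_gho inv_into_into f_inv_into_f)

lemma act_arc_proj:
  assumes "finite F" "F \<subseteq> arcs E"
  shows "act (arc_proj F) \<phi> x = (if \<exists>e\<in>F. x \<in> f e ` D (head E e) then \<phi> x else 0)"
proof (cases "\<exists>e\<in>F. x \<in> f e ` D (head E e)")
  case True
  then obtain e where e: "e \<in> F" "x \<in> f e ` D (head E e)" by blast
  have "e' \<in> arcs E \<and> x \<in> f e' ` D (head E e') \<longleftrightarrow> e' = e" if "e' \<in> F" for e'
    using that e assms(2) f_disjoint[of e' e] by blast
  hence "act (arc_proj F) \<phi> x = (\<Sum>e'\<in>F. if e' = e then \<phi> x else 0)"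
    unfolding arc_proj_def act_sum act_edg_gho by (intro sum.cong) simp_all
  thus ?thesis using True e assms(1) by simp
next
  case False
  thus ?thesis by (auto simp: arc_proj_def act_sum act_edg_gho)
qed

definition balanced :: "('x \<Rightarrow> 'k::field) \<Rightarrow> bool" where
  "balanced \<phi> \<longleftrightarrow> (\<forall>x. (\<Sum>i<m. \<phi> ((\<sigma> ^^ i) x)) = 0)"

text \<open>The constant coefficient is prescribed because an element such as
  \<open>1 - vtx v\<close> acts as 0 if \<open>v\<close> is a vertex of \<open>E\<close> and
  \<open>D v\<close> contains every point, yet it must not enter a
  \<open>leavitt_ideal\<close>.\<close>

definition annihilator :: "('v, 'e, 'k::field) lpa_poly set" where
  "annihilator = {p. poly_mapping.lookup p 0 = 0 \<and> (\<forall>\<phi>. balanced \<phi> \<longrightarrow> (\<forall>x. act p \<phi> x = 0))}"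

lemma step_shift: "step g (\<sigma> x) = map_option \<sigma> (step g x)"
proof (cases g)
  case (Edge e)
  show ?thesis
  proof (cases "e \<in> arcs E")
    case e: True
    have *: "step g (\<sigma> (f e y)) = map_option \<sigma> (step g (f e y))" if y: "y \<in> D (head E e)" for y
    proof -
      have sy: "\<sigma> y \<in> D (head E e)" using y shift_D by blast
      have eq: "\<sigma> (f e y) = f e (\<sigma> y)" using shift_f[OF e y] by simp
      have "step g (f e z) = Some z" if "z \<in> D (head E e)" for z
        using e that f_inj[OF e] by (simp add: Edge inv_into_f_f)
      from this[OF sy] this[OF y] show ?thesis unfolding eq by simp
    qed
    show ?thesis
    proof (cases "x \<in> f e ` D (head E e)")
      case True
      thus ?thesis using * by blast
    next
      case False
      have "\<sigma> x \<notin> f e ` D (head E e)"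
      proof
        assume "\<sigma> x \<in> f e ` D (head E e)"
        then obtain y where y: "y \<in> D (head E e)" "\<sigma> x = f e y" by blast
        \<comment> \<open>Surjectivity of \<open>\<sigma>\<close> pulls the preimage back, so a
          point outside the image of \<open>f e\<close> cannot be shifted into it.\<close>
        obtain z where z: "y = \<sigma> z" using shift_bij by (metis bij_pointE)
        hence "z \<in> D (head E e)" using y shift_D by blast
        hence "\<sigma> x = \<sigma> (f e z)" using y z shift_f[OF e] by simp
        hence "x = f e z" using shift_bij by (simp add: bij_is_inj inj_eq)
        thus False using False \<open>z \<in> D (head E e)\<close> by blast
      qed
      thus ?thesis using False by (simp add: Edge)
    qed
  qed (simp add: Edge)
qed (auto simp: shift_D shift_f)

lemma run_shift: "run w (\<sigma> x) = map_option \<sigma> (run w x)"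
  by (induction w arbitrary: x) (auto simp: step_shift split: option.split)

lemma run_shift_pow: "run w ((\<sigma> ^^ i) x) = map_option (\<sigma> ^^ i) (run w x)"
proof (induction i)
  case (Suc i)
  thus ?case by (simp add: run_shift option.map_comp comp_def)
qed (cases "run w x"; simp)

text \<open>Words commute with \<open>\<sigma>\<close>, so each of them carries the \<open>m\<close>
  points of one sum to the \<open>m\<close> points of another. That balanced functions form a
  submodule makes \<open>annihilator\<close> closed under multiplication on the right.\<close>

lemma balanced_act:
  assumes "balanced \<phi>"
  shows "balanced (act p \<phi>)"
  unfolding balanced_def
proof
  fix x
  have 0: "(\<Sum>i<m. ev \<phi> (run w ((\<sigma> ^^ i) x))) = 0" for w
    using assms by (cases "run w x") (auto simp: run_shift_pow balanced_def)
  have "(\<Sum>i<m. act p \<phi> ((\<sigma> ^^ i) x)) = (\<Sum>w\<in>Poly_Mapping.keys p.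
      poly_mapping.lookup p w * (\<Sum>i<m. ev \<phi> (run (letters w) ((\<sigma> ^^ i) x))))"
    unfolding act_def by (subst sum.swap) (simp add: sum_distrib_left)
  thus "(\<Sum>i<m. act p \<phi> ((\<sigma> ^^ i) x)) = 0" by (simp add: 0)
qed

lemma act_relator:
  assumes "p \<in> lpa_relators E"
  shows "act p \<phi> x = 0"
  using assms unfolding lpa_relators_def
proof (elim UnE CollectE exE conjE, goal_cases)
  case (1 v)
  thus ?case by (simp add: act_diff act_mult act_vtx)
next
  case (2 u v)
  thus ?case using D_disjoint by (auto simp: act_mult act_vtx)
next
  case (3 e)
  thus ?case using f_into by (auto simp: act_diff act_mult act_vtx act_edg)
next
  case (4 e)
  thus ?case by (auto simp: act_diff act_mult act_vtx act_edg inv_into_into)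
next
  case (5 e)
  thus ?case by (auto simp: act_diff act_mult act_vtx act_gho)
next
  case (6 e)
  thus ?case using f_into by (auto simp: act_diff act_mult act_vtx act_gho)
next
  case (7 e)
  thus ?case by (auto simp: act_diff act_mult act_vtx act_gho act_edg_image)
next
  case (8 e f')
  thus ?case using f_disjoint by (auto simp: act_mult act_gho act_edg)
next
  case (9 v)
  hence "act p \<phi> x = act (vtx v) \<phi> x - act (arc_proj (out_arcs E v)) \<phi> x"
    by (simp add: act_diff arc_proj_def)
  also have "act (arc_proj (out_arcs E v)) \<phi> x
      = (if \<exists>e\<in>out_arcs E v. x \<in> f e ` D (head E e) then \<phi> x else 0)"
    using 9(2) by (intro act_arc_proj) (auto simp: regular_vertex_def)
  also have "(\<exists>e\<in>out_arcs E v. x \<in> f e ` D (head E e)) \<longleftrightarrow> x \<in> D v"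
    using f_cover[OF 9(2)] f_into by fastforce
  finally show ?case using 9(2) by (simp add: act_vtx regular_vertex_def)
qed

lemma leavitt_ideal_annihilator: "leavitt_ideal E (annihilator :: ('v, 'e, 'k::field) lpa_poly set)"
proof
  fix p q a :: "('v, 'e, 'k) lpa_poly"
  show "0 \<in> (annihilator :: ('v, 'e, 'k) lpa_poly set)" by (simp add: annihilator_def act_zero)
  show "p + q \<in> annihilator" if "p \<in> annihilator" "q \<in> annihilator"
    using that by (simp add: annihilator_def act_add lookup_add)
  show "a * p \<in> annihilator" if "p \<in> annihilator"
  proof -
    have "act (a * p) \<phi> x = 0" if "balanced \<phi>" for \<phi> x
    proof -
      have "act p \<phi> = (\<lambda>_. 0)" using \<open>p \<in> annihilator\<close> that by (auto simp: annihilator_def)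
      thus ?thesis by (simp add: act_mult act_fun_zero)
    qed
    thus ?thesis using that by (simp add: annihilator_def lookup_times_0)
  qed
  show "p * a \<in> annihilator" if "p \<in> annihilator"
    using that by (simp add: annihilator_def lookup_times_0 act_mult balanced_act)
  show "poly_mapping.lookup p 0 = 0" if "p \<in> annihilator" using that by (simp add: annihilator_def)
  show "lpa_relators E \<subseteq> (annihilator :: ('v, 'e, 'k) lpa_poly set)"
    by (auto simp: annihilator_def lookup_relator_0 act_relator)
  show "lpa_mon g \<in> (annihilator :: ('v, 'e, 'k) lpa_poly set)" if "g \<notin> lpa_gens E" for g
    using that by (cases g) (auto simp: annihilator_def lookup_lpa_mon_0 act_lpa_mon lpa_gens_def)
qed

end

text \<open>
  The path \<open>\<mu>\<close> at \<open>u\<close> stands for \<open>\<mu>\<close> followed forever by the chosen arcs \<open>\<gamma>\<close>, as long as they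
  exist. It is in normal form if it does not itself end in a chosen arc.
\<close>

lemma exists_ideal_hereditary_saturated:
  assumes "wf_digraph E" and H: "hereditary_saturated E H" and S: "S \<subseteq> breaking_vertices E H"
  shows "\<exists>I :: ('v, 'e, 'k::field) lpa_poly set. leavitt_ideal E I \<and> ideal_vertices E I = H \<and>
    (\<forall>w\<in>breaking_vertices E H. breaking_elt E H w \<in> I \<longleftrightarrow> w \<in> S)"
proof -
  interpret wf_digraph E by fact
  \<comment> \<open>Arcs are chosen where the images of the live arcs have to cover all of
    \<open>D v\<close>, including the empty path: at regular vertices by the sum relation, and at
    \<open>S\<close> so that the breaking element acts as 0. At the other breaking vertices the
    empty path stays uncovered.\<close>
  define \<gamma> where "\<gamma> v = (if v \<in> verts E - H \<and> (regular_vertex E v \<or> v \<in> S)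
    then Some (SOME e. e \<in> live_arcs E H v) else None)" for v
  have \<gamma>: "e \<in> live_arcs E H v" if "\<gamma> v = Some e" for v e
  proof -
    have "live_arcs E H v \<noteq> {}" if "v \<in> verts E - H" "regular_vertex E v"
      using that H by (fastforce simp: hereditary_saturated_def live_arcs_def)
    moreover have "live_arcs E H v \<noteq> {}" if "v \<in> S"
      using that S by (auto simp: breaking_vertices_def live_arcs_def)
    ultimately have "live_arcs E H v \<noteq> {}" using that by (auto simp: \<gamma>_def split: if_splits)
    thus ?thesis using that by (auto simp: \<gamma>_def some_in_eq split: if_splits)
  qed
  have Hsub: "H \<subseteq> verts E" and Hher: "\<And>v w p. v \<in> H \<Longrightarrow> awalk v p w \<Longrightarrow> w \<in> H"
    using H by (auto simp: hereditary_saturated_def hereditary_def)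
  have Harc: "tail E e \<notin> H" if "e \<in> arcs E" "head E e \<notin> H" for e
    using Hher[of "tail E e" "[e]" "head E e"] that by (auto simp: arc_implies_awalk)
  \<comment> \<open>As \<open>H\<close> is hereditary, a path ending outside \<open>H\<close> avoids
    \<open>H\<close> altogether, so \<open>D u\<close> is empty for \<open>u\<close> in
    \<open>H\<close>. The start is recorded because an empty path does not show it.\<close>
  define D where "D u = {(u', \<mu>). u' = u \<and> (\<exists>w. awalk u \<mu> w \<and> w \<notin> H) \<and>
    (\<mu> = [] \<or> \<gamma> (tail E (last \<mu>)) \<noteq> Some (last \<mu>))}" for u
  \<comment> \<open>A chosen arc in front of the empty path is already part of the infinite
    continuation that the empty path stands for, so the normal form drops it.\<close>
  define f where "f e = (\<lambda>(u :: 'v, \<mu>). (tail E e, if \<mu> = [] \<and> \<gamma> (tail E e) = Some e then [] else e # \<mu>))" for e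
  have D_not_H: "u \<notin> H" if "x \<in> D u" for x u using that Hher by (auto simp: D_def)
  have D_Nil: "(u, []) \<in> D u \<longleftrightarrow> u \<in> verts E - H" for u by (auto simp: D_def awalk_simps)
  have into: "f e x \<in> D (tail E e)" if "e \<in> arcs E" "x \<in> D (head E e)" for e x
  proof -
    have "tail E e \<notin> H" using Harc[OF that(1) D_not_H[OF that(2)]] .
    thus ?thesis using that by (cases x) (auto simp: f_def D_def awalk_simps)
  qed
  have cover: "\<exists>e\<in>live_arcs E H v. (v, \<mu>) \<in> f e ` D (head E e)"
    if v: "(v, \<mu>) \<in> D v" "\<mu> = [] \<Longrightarrow> \<gamma> v \<noteq> None" for v \<mu>
  proof (cases \<mu>)
    case Nil
    then obtain e where "\<gamma> v = Some e" using v by blast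
    moreover from \<gamma>[OF this] have "e \<in> arcs E" "tail E e = v" "head E e \<in> verts E - H"
      by (auto simp: live_arcs_def)
    moreover have "(v, []) = f e (head E e, [])" using calculation by (simp add: f_def)
    ultimately show ?thesis using \<gamma> D_Nil Nil by blast
  next
    case (Cons e \<mu>')
    obtain w where w: "awalk v (e # \<mu>') w" "w \<notin> H" using v(1) by (auto simp: D_def Cons)
    hence e: "e \<in> arcs E" "tail E e = v" "awalk (head E e) \<mu>' w" by (auto simp: awalk_simps)
    hence "head E e \<notin> H" using Hher w(2) by blast
    hence "e \<in> live_arcs E H v" using e by (auto simp: live_arcs_def)
    moreover have "(head E e, \<mu>') \<in> D (head E e)"
      using v(1) e(3) w(2) by (auto simp: D_def Cons split: if_splits)
    moreover have "(v, \<mu>) = f e (head E e, \<mu>')"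
      using v(1) e by (auto simp: f_def Cons D_def)
    ultimately show ?thesis by blast
  qed
  interpret B: branching_system E D f id 0
  proof
    show "u = v" if "x \<in> D u" "x \<in> D v" for x u v using that by (auto simp: D_def)
    show "inj_on (f e) (D (head E e))" for e
      by (auto simp: inj_on_def f_def D_def split: if_splits)
    show "f e x \<in> D (tail E e)" if "e \<in> arcs E" "x \<in> D (head E e)" for e x using into that .
    show "e = e'" if "x \<in> D (head E e)" "x' \<in> D (head E e')" "f e x = f e' x'" for e e' x x'
      using that by (auto simp: f_def D_def split: if_splits)
    show "\<exists>e\<in>out_arcs E v. x \<in> f e ` D (head E e)" if reg: "regular_vertex E v" and xD: "x \<in> D v" for v x
    proof -
      obtain \<mu> where x: "x = (v, \<mu>)" using xD by (auto simp: D_def)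
      have "v \<in> verts E - H" using reg D_not_H[OF xD] by (auto simp: regular_vertex_def)
      hence "\<gamma> v \<noteq> None" using reg by (simp add: \<gamma>_def)
      thus ?thesis using cover[of v \<mu>] xD x live_arcs_def[of E H v] by blast
    qed
  qed auto
  let ?I = "B.annihilator :: ('v, 'e, 'k) lpa_poly set"
  have bal: "B.balanced \<phi>" for \<phi> :: "_ \<Rightarrow> 'k" by (simp add: B.balanced_def)
  have "vtx v \<in> ?I \<longleftrightarrow> v \<in> H" if "v \<in> verts E" for v
  proof
    assume "v \<in> H"
    hence "x \<notin> D v" for x using D_not_H by blast
    thus "vtx v \<in> ?I" by (simp add: B.annihilator_def lookup_lpa_mon_0 B.act_vtx)
  next
    assume "vtx v \<in> ?I"
    hence "B.act (vtx v) (\<lambda>_. 1 :: 'k) (v, []) = 0" using bal by (simp add: B.annihilator_def)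
    thus "v \<in> H" using that D_Nil[of v] by (auto simp: B.act_vtx)
  qed
  hence "ideal_vertices E ?I = H" using Hsub by (auto simp: ideal_vertices_def)
  moreover have "breaking_elt E H w \<in> ?I \<longleftrightarrow> w \<in> S" if w: "w \<in> breaking_vertices E H" for w
  proof -
    have fin: "finite (live_arcs E H w)" and sub: "live_arcs E H w \<subseteq> arcs E"
      and wH: "w \<in> verts E - H" and infin: "infinite (out_arcs E w)"
      using w by (auto simp: breaking_vertices_def live_arcs_def)
    have act: "B.act (breaking_elt E H w) \<phi> x = (if x \<in> D w then \<phi> x else 0)
      - (if \<exists>e\<in>live_arcs E H w. x \<in> f e ` D (head E e) then \<phi> x else 0)" for \<phi> :: "_ \<Rightarrow> 'k" and x
      using wH by (simp add: breaking_elt_def B.act_diff B.act_vtx B.act_arc_proj[OF fin sub])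
    have image_D: "x \<in> D w" if "e \<in> live_arcs E H w" "x \<in> f e ` D (head E e)" for e x
      using that into by (auto simp: live_arcs_def)
    show ?thesis
    proof
      assume "w \<in> S"
      hence "\<gamma> w \<noteq> None" using wH by (simp add: \<gamma>_def)
      have "x \<in> D w \<longleftrightarrow> (\<exists>e\<in>live_arcs E H w. x \<in> f e ` D (head E e))" for x
      proof
        assume "x \<in> D w"
        moreover then obtain \<mu> where "x = (w, \<mu>)" by (auto simp: D_def)
        ultimately show "\<exists>e\<in>live_arcs E H w. x \<in> f e ` D (head E e)"
          using cover[of w \<mu>] \<open>\<gamma> w \<noteq> None\<close> by blast
      qed (use image_D in blast)
      moreover have "poly_mapping.lookup (breaking_elt E H w :: ('v, 'e, 'k) lpa_poly) 0 = 0"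
        by (simp add: breaking_elt_def arc_proj_def lookup_minus lookup_sum lookup_times_0 lookup_lpa_mon_0)
      ultimately show "breaking_elt E H w \<in> ?I" by (simp add: B.annihilator_def act)
    next
      assume "breaking_elt E H w \<in> ?I"
      \<comment> \<open>At the empty path the vertex \<open>w\<close> contributes 1, and this can be
        cancelled only by a live arc whose image contains that path, that is, by a chosen
        arc.\<close>
      hence "B.act (breaking_elt E H w) (\<lambda>_. 1 :: 'k) (w, []) = 0" using bal by (simp add: B.annihilator_def)
      then obtain e where e: "e \<in> live_arcs E H w" "(w, []) \<in> f e ` D (head E e)"
        using wH D_Nil[of w] by (auto simp: act split: if_splits)
      hence "\<gamma> w = Some e" by (auto simp: f_def live_arcs_def split: if_splits)
      hence "regular_vertex E w \<or> w \<in> S" by (auto simp: \<gamma>_def split: if_splits)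
      thus "w \<in> S" using infin by (auto simp: regular_vertex_def)
    qed
  qed
  ultimately show ?thesis using B.leavitt_ideal_annihilator by blast
qed

text \<open>As \<open>h\<close> has period \<open>p\<close>, the sum over \<open>p\<close>
  consecutive integers does not depend on where they start; starting at 0 it is 1 - 1. This supplies
  a nonzero balanced function in every characteristic.\<close>

lemma sum_mod_indicator_zero:
  fixes p :: nat and n :: int
  defines "h \<equiv> \<lambda>n :: int. if n mod int p = 0 then 1 else if n mod int p = 1 then - 1 else (0 :: 'k::field)"
  assumes "p \<ge> 2"
  shows "(\<Sum>i<p. h (n + int i)) = 0"
proof -
  define T where "T n = (\<Sum>i<p. h (n + int i))" for n
  have step: "T (n + 1) = T n" for n
  proof -
    have "h n + T (n + 1) = (\<Sum>i<Suc p. h (n + int i))"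
      unfolding T_def sum.lessThan_Suc_shift by (simp add: algebra_simps)
    also have "\<dots> = T n + h (n + int p)" by (simp add: T_def)
    also have "h (n + int p) = h n" by (simp add: h_def)
    finally show ?thesis by simp
  qed
  have "T 0 = h 0 + (h 1 + (\<Sum>i<p - 2. h (int i + 2)))"
  proof -
    obtain q where q: "p = Suc (Suc q)" using \<open>p \<ge> 2\<close> by (metis add_2_eq_Suc le_Suc_ex)
    show ?thesis unfolding T_def by (subst (1) q) (simp del: sum.lessThan_Suc add: sum.lessThan_Suc_shift q add.commute)
  qed
  also have "(\<Sum>i<p - 2. h (int i + 2)) = 0"
    by (intro sum.neutral) (auto simp: h_def)
  also have "h 0 + (h 1 + 0) = 0" using \<open>p \<ge> 2\<close> by (simp add: h_def)
  finally have T0: "T 0 = 0" .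
  have "T n = 0"
  proof (induction n rule: int_induct[where k = 0])
    case base
    show ?case by (rule T0)
  next
    case (step1 i)
    thus ?case using step[of i] by simp
  next
    case (step2 i)
    thus ?case using step[of "i - 1"] by simp
  qed
  thus ?thesis by (simp add: T_def)
qed

text \<open>
  The points are the paths that meet \<open>v\<close> only at their end, with an integer. As every other closed path
  at \<open>v\<close> is a power of \<open>c\<close>, applying \<open>c\<close> at \<open>v\<close> only shifts the integer.
\<close>

lemma exists_ideal_unique_cycle:
  assumes "wf_digraph E" and v: "v \<in> verts E" and c: "simple_closed_path E v c"
    and unique: "\<And>c'. simple_closed_path E v c' \<Longrightarrow> c' = c" and p: "p \<ge> (2 :: nat)"
  shows "\<exists>I :: ('v, 'e, 'k::field) lpa_poly set. leavitt_ideal E I \<and> vtx v \<notin> I \<and>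
    vtx v * (\<Sum>i<p. pe c ^ i) \<in> I"
proof -
  interpret wf_digraph E by fact
  define D where "D u = {(\<mu>, n :: int). awalk u \<mu> v \<and> (\<forall>e\<in>set \<mu>. tail E e \<noteq> v)}" for u
  \<comment> \<open>If \<open>e\<close> leaves \<open>v\<close>, then \<open>e # \<mu>\<close> is a
    simple closed path, hence \<open>c\<close>; it is forgotten and recorded as a decrease of the
    integer. Since arcs act through the inverse of \<open>f\<close>, the element \<open>pe c\<close>
    evaluates functions one step higher.\<close>
  define f where "f e = (\<lambda>(\<mu>, n :: int). if tail E e = v then ([], n - 1) else (e # \<mu>, n))" for e
  define \<sigma> where "\<sigma> = (\<lambda>(\<mu> :: 'e list, n :: int). (\<mu>, n + 1))"
  have Dv: "x \<in> D v \<longleftrightarrow> fst x = []" for x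
  proof
    assume "x \<in> D v"
    thus "fst x = []" by (cases x; cases "fst x") (auto simp: D_def awalk_simps)
  qed (use v in \<open>cases x; auto simp: D_def awalk_simps\<close>)
  \<comment> \<open>Here uniqueness of \<open>c\<close> enters. Without it the forgotten path could
    not be recovered, and the images of two arcs leaving \<open>v\<close> would overlap.\<close>
  have first: "e # \<mu> = c" if "e \<in> arcs E" "tail E e = v" "(\<mu>, n) \<in> D (head E e)" for e \<mu> n
    using that by (intro unique) (auto simp: simple_closed_path_def D_def awalk_simps)
  interpret B: branching_system E D f \<sigma> p
  proof
    show "u = u'" if "x \<in> D u" "x \<in> D u'" for x u u'
    proof (cases x)
      case (Pair \<mu> n)
      thus ?thesis using that by (cases \<mu>) (auto simp: D_def awalk_simps)
    qed
    show "inj_on (f e) (D (head E e))" if "e \<in> arcs E" for e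
    proof (rule inj_onI)
      fix x y assume xy: "x \<in> D (head E e)" "y \<in> D (head E e)" "f e x = f e y"
      obtain \<mu> n \<mu>' n' where "x = (\<mu>, n)" "y = (\<mu>', n')" by (cases x; cases y)
      thus "x = y" using xy first[OF that] by (auto simp: f_def split: if_splits)
    qed
    show "f e x \<in> D (tail E e)" if "e \<in> arcs E" "x \<in> D (head E e)" for e x
      using that v by (cases x) (auto simp: f_def D_def awalk_simps)
    show "e = e'" if "e \<in> arcs E" "e' \<in> arcs E" "x \<in> D (head E e)" "x' \<in> D (head E e')"
      "f e x = f e' x'" for e e' x x'
    proof -
      obtain \<mu> n \<mu>' n' where x: "x = (\<mu>, n)" "x' = (\<mu>', n')" by (cases x; cases x')
      show ?thesis
      proof (cases "tail E e = v \<and> tail E e' = v")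
        case True
        hence "e # \<mu> = e' # \<mu>'" using first that x by metis
        thus ?thesis by simp
      next
        case False
        thus ?thesis using that(5) x by (auto simp: f_def split: if_splits)
      qed
    qed
    show "\<exists>e\<in>out_arcs E u. x \<in> f e ` D (head E e)" if "regular_vertex E u" and xD: "x \<in> D u" for u x
    proof (cases "u = v")
      case True
      obtain n where x: "x = ([], n)" using xD Dv True by (cases x) auto
      obtain e \<mu> where e: "c = e # \<mu>" using c by (cases c) (auto simp: simple_closed_path_def)
      have "e \<in> out_arcs E v" "(\<mu>, n + 1) \<in> D (head E e)"
        using c by (auto simp: e simple_closed_path_def D_def awalk_simps)
      moreover have "x = f e (\<mu>, n + 1)" using calculation x by (simp add: f_def)
      ultimately show ?thesis using True by blast
    next
      case False
      obtain \<mu> n where x: "x = (\<mu>, n)" by (cases x)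
      then obtain e \<mu>' where e: "\<mu> = e # \<mu>'"
        using xD False by (cases \<mu>) (auto simp: D_def awalk_simps)
      have "e \<in> out_arcs E u" "(\<mu>', n) \<in> D (head E e)"
        using xD by (auto simp: x e D_def awalk_simps)
      moreover have "x = f e (\<mu>', n)" using calculation x e False by (simp add: f_def)
      ultimately show ?thesis by blast
    qed
    show "bij \<sigma>"
      by (rule o_bij[of "\<lambda>(\<mu>, n). (\<mu>, n - 1)"]) (auto simp: \<sigma>_def fun_eq_iff)
    show "\<sigma> x \<in> D u \<longleftrightarrow> x \<in> D u" for x u by (cases x) (simp add: \<sigma>_def D_def)
    show "f e (\<sigma> x) = \<sigma> (f e x)" for e x by (cases x) (simp add: \<sigma>_def f_def)
  qed
  let ?I = "B.annihilator :: ('v, 'e, 'k) lpa_poly set"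
  have \<sigma>_pow: "(\<sigma> ^^ i) (\<mu>, n) = (\<mu>, n + int i)" for i \<mu> n
    by (induction i) (auto simp: \<sigma>_def)
  have path: "B.act (pe \<mu>) \<phi> (\<mu>, n) = \<phi> ([], n)" if "(\<mu>, n) \<in> D u" for \<mu> u n and \<phi> :: "_ \<Rightarrow> 'k"
    using that
  proof (induction \<mu> arbitrary: u)
    case (Cons e \<mu>)
    have e: "e \<in> arcs E" "tail E e \<noteq> v" "(\<mu>, n) \<in> D (head E e)"
      using Cons.prems by (auto simp: D_def awalk_simps)
    hence "f e (\<mu>, n) = (e # \<mu>, n)" by (simp add: f_def)
    thus ?case using B.act_edg_image[OF e(1,3), of "B.act (pe \<mu>) \<phi>"] Cons.IH[OF e(3)]
      by (simp add: pe_Cons B.act_mult)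
  qed (simp add: B.act_one)
  have cycle: "B.act (pe c) \<phi> ([], n) = \<phi> ([], n + 1)" for \<phi> :: "_ \<Rightarrow> 'k" and n
  proof -
    obtain e \<mu> where e: "c = e # \<mu>" using c by (cases c) (auto simp: simple_closed_path_def)
    have *: "e \<in> arcs E" "tail E e = v" "(\<mu>, n + 1) \<in> D (head E e)"
      using c by (auto simp: e simple_closed_path_def D_def awalk_simps)
    hence "f e (\<mu>, n + 1) = ([], n)" by (simp add: f_def)
    thus ?thesis using B.act_edg_image[OF *(1,3), of "B.act (pe \<mu>) \<phi>"] path[OF *(3)]
      by (simp add: e pe_Cons B.act_mult)
  qed
  have power: "B.act (pe c ^ i) \<phi> ([], n) = \<phi> ([], n + int i)" for \<phi> :: "_ \<Rightarrow> 'k" and n i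
  proof (induction i arbitrary: n)
    case (Suc i)
    thus ?case by (simp add: B.act_mult cycle algebra_simps)
  qed (simp add: B.act_one)
  \<comment> \<open>At \<open>([], n)\<close> the power \<open>pe c ^ i\<close> evaluates
    \<open>\<phi>\<close> at \<open>([], n + int i)\<close>, so the geometric sum produces exactly
    the sum that vanishes for balanced functions.\<close>
  have "B.act (vtx v * (\<Sum>i<p. pe c ^ i)) \<phi> x = 0" if "B.balanced \<phi>" for \<phi> :: "_ \<Rightarrow> 'k" and x
  proof (cases "x \<in> D v")
    case True
    then obtain n where x: "x = ([], n)" using Dv by (cases x) auto
    have "(\<Sum>i<p. \<phi> ((\<sigma> ^^ i) x)) = 0" using that unfolding B.balanced_def by blast
    thus ?thesis using True by (simp add: B.act_mult B.act_vtx B.act_sum x power \<sigma>_pow)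
  qed (simp add: B.act_mult B.act_vtx)
  hence "vtx v * (\<Sum>i<p. pe c ^ i) \<in> ?I"
    by (simp add: B.annihilator_def lookup_times_0 lookup_lpa_mon_0)
  moreover have "vtx v \<notin> ?I"
  proof
    assume "vtx v \<in> ?I"
    \<comment> \<open>A constant function would be balanced only if \<open>p\<close> vanishes in the
      field; this one is balanced always and has the value 1 at \<open>([], 0)\<close>.\<close>
    let ?\<phi> = "\<lambda>(\<mu> :: 'e list, n :: int). if n mod int p = 0 then 1 else if n mod int p = 1 then - 1 else (0 :: 'k)"
    have "B.balanced ?\<phi>"
      unfolding B.balanced_def using sum_mod_indicator_zero[OF p, where 'k = 'k] by (auto simp: \<sigma>_pow)
    hence "B.act (vtx v) ?\<phi> ([], 0) = 0" using \<open>vtx v \<in> ?I\<close> by (simp add: B.annihilator_def)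
    thus False using v Dv by (simp add: B.act_vtx)
  qed
  ultimately show ?thesis using B.leavitt_ideal_annihilator by blast
qed

section \<open>Ideals of the Leavitt path algebra\<close>

definition valid_word :: "('v, 'e) pre_digraph \<Rightarrow> ('v, 'e) lpa_gen free_monoid \<Rightarrow> bool" where
  "valid_word E w \<longleftrightarrow> set (letters w) \<subseteq> lpa_gens E"

lemma valid_word_add: "valid_word E (x + y) \<longleftrightarrow> valid_word E x \<and> valid_word E y"
  by (auto simp: valid_word_def plus_free_monoid_def)

lemma valid_word_0: "valid_word E 0"
  by (simp add: valid_word_def zero_free_monoid_def)

abbreviation keep_valid ::
    "('v, 'e) pre_digraph \<Rightarrow> ('v, 'e, 'k::field) lpa_poly \<Rightarrow> ('v, 'e, 'k) lpa_poly" where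
  "keep_valid E \<equiv> keep (valid_word E)"

text \<open>A concatenation is valid exactly if both factors are, so discarding the invalid words is
  an algebra homomorphism onto the words over \<open>E\<close>.\<close>

lemma keep_valid_mult: "keep_valid E (p * q) = keep_valid E p * keep_valid E q"
proof (induction p rule: poly_mapping_span_induct)
  case (single w c)
  show ?case
    by (induction q rule: poly_mapping_span_induct)
      (auto simp: mult_single keep_single keep_add distrib_left valid_word_add)
qed (simp add: distrib_right keep_add)

lemma keep_valid_mon_invalid: "g \<notin> lpa_gens E \<Longrightarrow> keep_valid E (lpa_mon g) = 0"
  by (simp add: lpa_mon_def keep_single valid_word_def)

lemma in_carrier_iff:
  "p \<in> carrier (free_nonunital_algebra E) \<longleftrightarrow> poly_mapping.lookup p 0 = 0 \<and> keep_valid E p = p"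
proof
  assume p: "p \<in> carrier (free_nonunital_algebra E)"
  hence "0 \<notin> Poly_Mapping.keys p" by (force simp: free_nonunital_algebra_def zero_free_monoid_def)
  moreover have "keep_valid E p = p"
    using p by (intro keep_id) (simp add: free_nonunital_algebra_def valid_word_def)
  ultimately show "poly_mapping.lookup p 0 = 0 \<and> keep_valid E p = p" by (simp add: in_keys_iff)
next
  assume p: "poly_mapping.lookup p 0 = 0 \<and> keep_valid E p = p"
  have "letters w \<noteq> [] \<and> set (letters w) \<subseteq> lpa_gens E" if w: "w \<in> Poly_Mapping.keys p" for w
  proof
    show "letters w \<noteq> []"
      using w p by (metis free_monoid.collapse Word_Nil in_keys_iff)
    show "set (letters w) \<subseteq> lpa_gens E"
      using w p keys_keep[of "valid_word E" p] by (auto simp: valid_word_def)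
  qed
  thus "p \<in> carrier (free_nonunital_algebra E)" by (simp add: free_nonunital_algebra_def)
qed

lemma keep_valid_idem [simp]: "keep_valid E (keep_valid E p) = keep_valid E p"
  by (rule poly_mapping_eqI) (simp add: lookup_keep)

lemma lookup_keep_valid_0 [simp]: "poly_mapping.lookup (keep_valid E p) 0 = poly_mapping.lookup p 0"
  by (simp add: lookup_keep valid_word_0)

text \<open>An invalid word contains a letter outside \<open>E\<close>, which lies in
  \<open>I\<close>, and so the whole word does. Hence nothing is lost modulo \<open>I\<close> by
  passing to valid words.\<close>

lemma (in leavitt_ideal) keep_valid_cong: "keep_valid E p \<asymp> p"
proof (induction p rule: poly_mapping_span_induct)
  case (single w c)
  show ?case
  proof (cases "valid_word E w")
    case False
    then obtain g where g: "g \<in> set (letters w)" "g \<notin> lpa_gens E" by (auto simp: valid_word_def)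
    then obtain u u' where w: "letters w = u @ g # u'" by (meson split_list)
    hence "w = Word u + (Word [g] + Word u')"
      by (metis append_Cons append_Nil free_monoid.collapse free_monoid.sel plus_free_monoid_def)
    hence "Poly_Mapping.single w c
        = Poly_Mapping.single (Word u) 1 * (lpa_mon g * Poly_Mapping.single (Word u') c)"
      by (simp add: lpa_mon_def mult_single)
    moreover have "\<dots> \<in> I" using g by (intro lmult_mem rmult_mem invalid_mem)
    ultimately have "Poly_Mapping.single w c \<in> I" by (simp only:)
    thus ?thesis using False by (simp add: keep_single cong_def uminus_mem)
  qed (simp add: keep_single)
qed (simp add: keep_add cong_add)

section \<open>The Leavitt path algebra as a ring of cosets\<close>

locale leavitt_quotient = wf_digraph E for E :: "('v, 'e) pre_digraph" +
  fixes K :: "'k::field itself"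
begin

abbreviation FA :: "('v, 'e, 'k) lpa_poly ring" where "FA \<equiv> free_nonunital_algebra E"

abbreviation RI :: "('v, 'e, 'k) lpa_poly set" where "RI \<equiv> lpa_relation_ideal E"

abbreviation LA :: "('v, 'e, 'k) lpa_poly set ring" where "LA \<equiv> leavitt_path_algebra K E"

abbreviation coset :: "('v, 'e, 'k) lpa_poly \<Rightarrow> ('v, 'e, 'k) lpa_poly set" where
  "coset p \<equiv> RI +>\<^bsub>FA\<^esub> p"

lemma FA_simps [simp]:
  "p \<otimes>\<^bsub>FA\<^esub> q = p * q" "\<zero>\<^bsub>FA\<^esub> = 0" "p \<oplus>\<^bsub>FA\<^esub> q = p + q"
  by (simp_all add: free_nonunital_algebra_def)

lemma FA_closed [simp]:
  "0 \<in> carrier FA"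
  "p \<in> carrier FA \<Longrightarrow> q \<in> carrier FA \<Longrightarrow> p + q \<in> carrier FA"
  "p \<in> carrier FA \<Longrightarrow> q \<in> carrier FA \<Longrightarrow> p - q \<in> carrier FA"
  "p \<in> carrier FA \<Longrightarrow> - p \<in> carrier FA"
  "p \<in> carrier FA \<Longrightarrow> q \<in> carrier FA \<Longrightarrow> p * q \<in> carrier FA"
  "p \<in> carrier FA \<Longrightarrow> cst k * p \<in> carrier FA"
  "p \<in> carrier FA \<Longrightarrow> p * cst k \<in> carrier FA"
proof -
  show *: "p - q \<in> carrier FA" if "p \<in> carrier FA" "q \<in> carrier FA" for p q
    using that by (simp add: in_carrier_iff keep_diff lookup_minus)
  show "0 \<in> carrier FA" by (simp add: in_carrier_iff)
  thus "p \<in> carrier FA \<Longrightarrow> - p \<in> carrier FA" using *[of 0 p] by simp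
qed (simp_all add: in_carrier_iff keep_add lookup_add keep_valid_mult lookup_times_0 keep_single valid_word_0)

lemma FA_sum: "(\<And>x. x \<in> A \<Longrightarrow> h x \<in> carrier FA) \<Longrightarrow> sum h A \<in> carrier FA"
  by (induction A rule: infinite_finite_induct) auto

lemma abelian_group_FA: "abelian_group FA"
proof (rule abelian_groupI)
  fix x assume "x \<in> carrier FA"
  thus "\<exists>y\<in>carrier FA. y \<oplus>\<^bsub>FA\<^esub> x = \<zero>\<^bsub>FA\<^esub>" by (intro bexI[of _ "- x"]) simp_all
qed (simp_all add: add.assoc add.commute)

lemma a_inv_FA: "p \<in> carrier FA \<Longrightarrow> \<ominus>\<^bsub>FA\<^esub> p = - p"
  using abelian_group.minus_equality[OF abelian_group_FA, of "- p" p] by simp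

lemma two_sided_ideal_FA_iff:
  "two_sided_ideal FA J \<longleftrightarrow> J \<subseteq> carrier FA \<and> 0 \<in> J \<and> (\<forall>p\<in>J. \<forall>q\<in>J. p - q \<in> J) \<and>
     (\<forall>p\<in>J. \<forall>a\<in>carrier FA. a * p \<in> J \<and> p * a \<in> J)"
proof
  assume J: "two_sided_ideal FA J"
  then interpret additive_subgroup J FA by (simp add: two_sided_ideal_def)
  have "p - q \<in> J" if "p \<in> J" "q \<in> J" for p q
    using a_closed[OF that(1) a_inv_closed[OF that(2)]] a_subset that(2) a_inv_FA by auto
  thus "J \<subseteq> carrier FA \<and> 0 \<in> J \<and> (\<forall>p\<in>J. \<forall>q\<in>J. p - q \<in> J) \<and>
     (\<forall>p\<in>J. \<forall>a\<in>carrier FA. a * p \<in> J \<and> p * a \<in> J)"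
    using J a_subset zero_closed by (auto simp: two_sided_ideal_def)
next
  assume J: "J \<subseteq> carrier FA \<and> 0 \<in> J \<and> (\<forall>p\<in>J. \<forall>q\<in>J. p - q \<in> J) \<and>
     (\<forall>p\<in>J. \<forall>a\<in>carrier FA. a * p \<in> J \<and> p * a \<in> J)"
  have uminus: "- p \<in> J" if "p \<in> J" for p
    using J that by (metis diff_0)
  have "subgroup J (add_monoid FA)"
  proof
    show "x \<otimes>\<^bsub>add_monoid FA\<^esub> y \<in> J" if "x \<in> J" "y \<in> J" for x y
    proof -
      have "x - (- y) \<in> J" using J that(1) uminus[OF that(2)] by blast
      thus ?thesis by simp
    qed
    show "inv\<^bsub>add_monoid FA\<^esub> x \<in> J" if "x \<in> J" for x
      using uminus[OF that] a_inv_FA[of x] J that by (auto simp: a_inv_def)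
  qed (use J in auto)
  thus "two_sided_ideal FA J" using J by (simp add: two_sided_ideal_def additive_subgroup_def)
qed

text \<open>The ideal is pulled back along \<open>keep_valid\<close>. A multiplier in the ambient
  algebra splits into its constant term and an element of the non-unital algebra; closure under
  scalars takes care of the constant term.\<close>

lemma leavitt_ideal_lift:
  assumes J: "two_sided_ideal FA J" and scale: "\<And>k p. p \<in> J \<Longrightarrow> cst k * p \<in> J"
    and rel: "lpa_relators E \<subseteq> J"
  shows "leavitt_ideal E {p. keep_valid E p \<in> J}"
proof
  note J' = J[unfolded two_sided_ideal_FA_iff]
  have add: "p + q \<in> J" if "p \<in> J" "q \<in> J" for p q
  proof -
    have "0 - q \<in> J" using J' that by blast
    hence "p - (0 - q) \<in> J" using J' that by blast
    thus ?thesis by simp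
  qed
  have mult: "a * p \<in> J \<and> p * a \<in> J" if "keep_valid E a = a" "p \<in> J" for a p
  proof -
    define k where "k = poly_mapping.lookup a 0"
    have "a - cst k \<in> carrier FA"
      using that(1) by (simp add: in_carrier_iff k_def lookup_minus keep_diff keep_single valid_word_0)
    hence "cst k * p + (a - cst k) * p \<in> J" "cst k * p + p * (a - cst k) \<in> J"
      using J' that(2) scale by (auto intro!: add)
    thus ?thesis by (simp add: left_diff_distrib right_diff_distrib cst_commute)
  qed
  show "0 \<in> {p. keep_valid E p \<in> J}" using J' by simp
  show "p + q \<in> {p. keep_valid E p \<in> J}"
    if "p \<in> {p. keep_valid E p \<in> J}" "q \<in> {p. keep_valid E p \<in> J}" for p q
    using that by (simp add: keep_add add)
  show "a * p \<in> {p. keep_valid E p \<in> J}" if "p \<in> {p. keep_valid E p \<in> J}" for a p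
    using that mult by (simp add: keep_valid_mult)
  show "p * a \<in> {p. keep_valid E p \<in> J}" if "p \<in> {p. keep_valid E p \<in> J}" for a p
    using that mult by (simp add: keep_valid_mult)
  show "poly_mapping.lookup p 0 = 0" if "p \<in> {p. keep_valid E p \<in> J}" for p
    using that J' by (metis in_carrier_iff lookup_keep_valid_0 mem_Collect_eq subsetD)
  show "lpa_relators E \<subseteq> {p. keep_valid E p \<in> J}"
    using rel J' by (auto simp: in_carrier_iff subset_iff)
  show "lpa_mon g \<in> {p. keep_valid E p \<in> J}" if "g \<notin> lpa_gens E" for g
    using J' that by (simp add: keep_valid_mon_invalid)
qed

lemma map_scale: "Poly_Mapping.map ((*) k) p = cst (k :: 'k) * p"
  by (rule mult_map_scale_conv_mult)

lemma mon_in_FA: "lpa_mon g \<in> carrier FA \<longleftrightarrow> g \<in> lpa_gens E"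
  by (simp add: free_nonunital_algebra_def lpa_mon_def)

lemma relators_in_FA: "lpa_relators E \<subseteq> carrier FA"
proof
  fix p :: "('v, 'e, 'k) lpa_poly"
  assume "p \<in> lpa_relators E"
  thus "p \<in> carrier FA" unfolding lpa_relators_def
    by (elim UnE CollectE exE conjE)
      (auto intro!: FA_closed FA_sum simp: mon_in_FA lpa_gens_def regular_vertex_def)
qed

lemma RI_properties:
  shows RI_ideal: "two_sided_ideal FA RI"
    and RI_scale: "p \<in> RI \<Longrightarrow> cst k * p \<in> RI"
    and RI_relators: "lpa_relators E \<subseteq> RI"
proof -
  define \<F> :: "('v, 'e, 'k) lpa_poly set set" where "\<F> = {J. two_sided_ideal FA J \<and>
    (\<forall>k. \<forall>p\<in>J. Poly_Mapping.map ((*) k) p \<in> J) \<and> lpa_relators E \<subseteq> J}"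
  have RI: "RI = \<Inter>\<F>" by (simp add: lpa_relation_ideal_def \<F>_def)
  \<comment> \<open>The family is nonempty, so its intersection stays inside the carrier.\<close>
  have "carrier FA \<in> \<F>" by (auto simp: \<F>_def two_sided_ideal_FA_iff map_scale relators_in_FA[THEN subsetD])
  thus "two_sided_ideal FA RI"
    unfolding RI two_sided_ideal_FA_iff by (auto simp: \<F>_def two_sided_ideal_FA_iff)
  show "p \<in> RI \<Longrightarrow> cst k * p \<in> RI" unfolding RI by (auto simp: \<F>_def map_scale)
  show "lpa_relators E \<subseteq> RI" unfolding RI by (auto simp: \<F>_def)
qed

lemma RI_subset: "RI \<subseteq> carrier FA"
  and RI_zero: "0 \<in> RI"
  and RI_diff: "p \<in> RI \<Longrightarrow> q \<in> RI \<Longrightarrow> p - q \<in> RI"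
  and RI_mult: "p \<in> RI \<Longrightarrow> a \<in> carrier FA \<Longrightarrow> a * p \<in> RI" "p \<in> RI \<Longrightarrow> a \<in> carrier FA \<Longrightarrow> p * a \<in> RI"
  using RI_ideal by (auto simp: two_sided_ideal_FA_iff)

lemma RI_add: "p \<in> RI \<Longrightarrow> q \<in> RI \<Longrightarrow> p + q \<in> RI"
  using RI_diff[of p "0 - q"] RI_diff[OF RI_zero, of q] by simp

lemma RI_sum: "(\<And>x. x \<in> A \<Longrightarrow> h x \<in> RI) \<Longrightarrow> sum h A \<in> RI"
  by (induction A rule: infinite_finite_induct) (auto intro: RI_zero RI_add)

lemma RI_subset_ideal:
  assumes "leavitt_ideal E I"
  shows "RI \<subseteq> I"
proof -
  interpret leavitt_ideal E I by fact
  have "two_sided_ideal FA (I \<inter> carrier FA)"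
    by (auto simp: two_sided_ideal_FA_iff zero_mem diff_mem lmult_mem rmult_mem)
  hence "RI \<subseteq> I \<inter> carrier FA"
    unfolding lpa_relation_ideal_def using relators_mem relators_in_FA
    by (intro Inter_lower) (auto simp: map_scale lmult_mem)
  thus ?thesis by blast
qed

lemma mem_coset: "x \<in> coset p \<longleftrightarrow> x - p \<in> RI"
  unfolding a_r_coset_def' by (force simp: algebra_simps)

lemma coset_eq_iff: "coset p = coset q \<longleftrightarrow> p - q \<in> RI"
proof
  assume "coset p = coset q"
  moreover have "p \<in> coset p" by (simp add: mem_coset RI_zero)
  ultimately show "p - q \<in> RI" using mem_coset by blast
next
  assume pq: "p - q \<in> RI"
  have "x - p \<in> RI \<longleftrightarrow> x - q \<in> RI" for x
    using RI_add[of "x - p" "p - q"] RI_diff[of "x - q" "p - q"] pq by auto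
  thus "coset p = coset q" by (auto simp: mem_coset)
qed

lemma carrier_LA: "carrier LA = coset ` carrier FA"
  by (auto simp: leavitt_path_algebra_def FactRing_def A_RCOSETS_def')

lemma zero_LA: "\<zero>\<^bsub>LA\<^esub> = coset 0"
  by (auto simp: leavitt_path_algebra_def FactRing_def mem_coset)

lemma add_LA: "coset p \<oplus>\<^bsub>LA\<^esub> coset q = coset (p + q)"
proof -
  have "coset p \<oplus>\<^bsub>LA\<^esub> coset q = (\<Union>h\<in>coset p. \<Union>k\<in>coset q. {h + k})"
    by (simp add: leavitt_path_algebra_def FactRing_def set_add_def')
  also have "\<dots> = coset (p + q)"
  proof (intro equalityI subsetI)
    fix x assume "x \<in> (\<Union>h\<in>coset p. \<Union>k\<in>coset q. {h + k})"
    then obtain h k where "h - p \<in> RI" "k - q \<in> RI" "x = h + k" by (auto simp: mem_coset)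
    thus "x \<in> coset (p + q)" using RI_add[of "h - p" "k - q"] by (simp add: mem_coset algebra_simps)
  next
    fix x assume "x \<in> coset (p + q)"
    hence "x - p \<in> coset q" "p \<in> coset p" "x = p + (x - p)"
      by (simp_all add: mem_coset RI_zero algebra_simps)
    thus "x \<in> (\<Union>h\<in>coset p. \<Union>k\<in>coset q. {h + k})" by blast
  qed
  finally show ?thesis .
qed

lemma mult_LA:
  assumes "p \<in> carrier FA" "q \<in> carrier FA"
  shows "coset p \<otimes>\<^bsub>LA\<^esub> coset q = coset (p * q)"
proof -
  have "coset (a * b) = coset (p * q)" if "a \<in> coset p" "b \<in> coset q" for a b
  proof -
    have ab: "a - p \<in> RI" "b - q \<in> RI" using that by (simp_all add: mem_coset)
    hence "a = p + (a - p)" "a - p \<in> carrier FA" using RI_subset by auto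
    hence "a \<in> carrier FA" using assms(1) by (metis FA_closed(2))
    hence "a * (b - q) + (a - p) * q \<in> RI" using ab assms(2) by (intro RI_add RI_mult)
    thus ?thesis by (simp add: coset_eq_iff algebra_simps)
  qed
  moreover have "p \<in> coset p" "q \<in> coset q" by (simp_all add: mem_coset RI_zero)
  ultimately have "(\<Union>a\<in>coset p. \<Union>b\<in>coset q. coset (a * b)) = coset (p * q)" by blast
  thus ?thesis by (simp add: leavitt_path_algebra_def FactRing_def rcoset_mult_def)
qed

lemma abelian_group_LA: "abelian_group LA"
proof (rule abelian_groupI)
  fix x assume "x \<in> carrier LA"
  then obtain p where "p \<in> carrier FA" "x = coset p" by (auto simp: carrier_LA)
  thus "\<exists>y\<in>carrier LA. y \<oplus>\<^bsub>LA\<^esub> x = \<zero>\<^bsub>LA\<^esub>"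
    by (intro bexI[of _ "coset (- p)"]) (auto simp: carrier_LA add_LA zero_LA)
qed (auto simp: carrier_LA zero_LA add_LA add_ac)

lemma a_inv_LA: "p \<in> carrier FA \<Longrightarrow> \<ominus>\<^bsub>LA\<^esub> (coset p) = coset (- p)"
  by (rule abelian_group.minus_equality[OF abelian_group_LA])
    (auto simp: carrier_LA add_LA zero_LA)

text \<open>This and \<open>quotient_ideal\<close> are mutually inverse translations between ideals
  of the ring of cosets and the ideals of the ambient algebra for which everything above is
  proved.\<close>

definition full_ideal :: "('v, 'e, 'k) lpa_poly set set \<Rightarrow> ('v, 'e, 'k) lpa_poly set" where
  "full_ideal P = {p. keep_valid E p \<in> carrier FA \<and> coset (keep_valid E p) \<in> P}"

definition quotient_ideal :: "('v, 'e, 'k) lpa_poly set \<Rightarrow> ('v, 'e, 'k) lpa_poly set set" where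
  "quotient_ideal I = coset ` (I \<inter> carrier FA)"

lemma mem_full_ideal: "p \<in> carrier FA \<Longrightarrow> p \<in> full_ideal P \<longleftrightarrow> coset p \<in> P"
  by (simp add: full_ideal_def in_carrier_iff)

lemma two_sided_ideal_LA_D:
  assumes "two_sided_ideal LA P"
  shows "P \<subseteq> coset ` carrier FA" "coset 0 \<in> P"
    "p \<in> carrier FA \<Longrightarrow> q \<in> carrier FA \<Longrightarrow> coset p \<in> P \<Longrightarrow> coset q \<in> P \<Longrightarrow> coset (p - q) \<in> P"
    "p \<in> carrier FA \<Longrightarrow> a \<in> carrier FA \<Longrightarrow> coset p \<in> P \<Longrightarrow> coset (a * p) \<in> P"
    "p \<in> carrier FA \<Longrightarrow> a \<in> carrier FA \<Longrightarrow> coset p \<in> P \<Longrightarrow> coset (p * a) \<in> P"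
proof -
  interpret additive_subgroup P LA using assms by (simp add: two_sided_ideal_def)
  show "P \<subseteq> coset ` carrier FA" using a_subset by (simp add: carrier_LA)
  show "coset 0 \<in> P" using zero_closed by (simp add: zero_LA)
  show "coset (p - q) \<in> P" if "p \<in> carrier FA" "q \<in> carrier FA" "coset p \<in> P" "coset q \<in> P"
    using a_closed[OF that(3) a_inv_closed[OF that(4)]] that by (simp add: a_inv_LA add_LA)
  show "coset (a * p) \<in> P" "coset (p * a) \<in> P"
    if "p \<in> carrier FA" "a \<in> carrier FA" "coset p \<in> P"
    using assms that mult_LA[of a p] mult_LA[of p a] unfolding two_sided_ideal_def
    by (auto simp: carrier_LA) (metis imageI)+
qed

lemma leavitt_ideal_full_ideal:
  assumes P: "two_sided_ideal LA P"
  shows "leavitt_ideal E (full_ideal P)"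
proof -
  note P' = two_sided_ideal_LA_D[OF P]
  define J where "J = {p \<in> carrier FA. coset p \<in> P}"
  have J: "two_sided_ideal FA J"
    using P'(2-) by (simp add: two_sided_ideal_FA_iff J_def)
  have RJ: "RI \<subseteq> J"
  proof
    fix r assume r: "r \<in> RI"
    hence "coset r = coset 0" by (simp add: coset_eq_iff)
    thus "r \<in> J" using r RI_subset P'(2) by (auto simp: J_def)
  qed
  have "cst k * p \<in> J" if p: "p \<in> J" for k p
  proof -
    interpret R: leavitt_ideal E "{p. keep_valid E p \<in> RI}"
      by (rule leavitt_ideal_lift[OF RI_ideal RI_scale RI_relators])
    have pF: "p \<in> carrier FA" using p by (simp add: J_def)
    then obtain V where V: "finite V" "V \<subseteq> verts E" "R.cong (p * (\<Sum>v\<in>V. vtx v)) p"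
      using R.local_unit[of p] by (auto simp: in_carrier_iff)
    define u where "u = (\<Sum>v\<in>V. vtx v :: ('v, 'e, 'k) lpa_poly)"
    have u: "u \<in> carrier FA"
      unfolding u_def using V(2) by (intro FA_sum) (auto simp: mon_in_FA lpa_gens_def)
    have "keep_valid E (p * u - p) \<in> RI" using V(3) by (simp add: R.cong_def u_def)
    moreover have "p * u - p \<in> carrier FA" using pF u by simp
    ultimately have "p * u - p \<in> RI" by (simp add: in_carrier_iff)
    hence "cst k * (p * u - p) \<in> J" using RI_scale RJ by blast
    moreover have "p * (cst k * u) \<in> J" using J p u by (simp add: two_sided_ideal_FA_iff)
    ultimately have "p * (cst k * u) - cst k * (p * u - p) \<in> J"
      using J by (simp add: two_sided_ideal_FA_iff)
    thus ?thesis by (simp add: cst_left_commute right_diff_distrib)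
  qed
  from leavitt_ideal_lift[OF J this] RJ RI_relators
  have "leavitt_ideal E {p. keep_valid E p \<in> J}" by blast
  moreover have "{p. keep_valid E p \<in> J} = full_ideal P" by (auto simp: J_def full_ideal_def)
  ultimately show ?thesis by simp
qed

lemma mem_quotient_ideal:
  assumes "leavitt_ideal E I" "p \<in> carrier FA"
  shows "coset p \<in> quotient_ideal I \<longleftrightarrow> p \<in> I"
proof
  interpret leavitt_ideal E I by fact
  assume "coset p \<in> quotient_ideal I"
  then obtain q where q: "q \<in> I" "coset p = coset q" by (auto simp: quotient_ideal_def)
  hence "p - q \<in> I" using RI_subset_ideal[OF assms(1)] by (auto simp: coset_eq_iff)
  thus "p \<in> I" using q(1) add_mem by fastforce
qed (use assms in \<open>auto simp: quotient_ideal_def\<close>)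

lemma two_sided_ideal_quotient_ideal:
  assumes "leavitt_ideal E I"
  shows "two_sided_ideal LA (quotient_ideal I)"
proof -
  interpret leavitt_ideal E I by fact
  have "subgroup (quotient_ideal I) (add_monoid LA)"
  proof
    show "quotient_ideal I \<subseteq> carrier (add_monoid LA)" by (auto simp: carrier_LA quotient_ideal_def)
    show "x \<otimes>\<^bsub>add_monoid LA\<^esub> y \<in> quotient_ideal I"
      if "x \<in> quotient_ideal I" "y \<in> quotient_ideal I" for x y
      using that by (auto simp: quotient_ideal_def add_LA add_mem)
    show "\<one>\<^bsub>add_monoid LA\<^esub> \<in> quotient_ideal I"
      by (auto simp: quotient_ideal_def zero_LA zero_mem)
    show "inv\<^bsub>add_monoid LA\<^esub> x \<in> quotient_ideal I" if x: "x \<in> quotient_ideal I" for x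
    proof -
      obtain p where "p \<in> I" "p \<in> carrier FA" "x = coset p" using x by (auto simp: quotient_ideal_def)
      thus ?thesis using a_inv_LA[of p] by (auto simp: a_inv_def quotient_ideal_def uminus_mem)
    qed
  qed
  moreover have "y \<otimes>\<^bsub>LA\<^esub> x \<in> quotient_ideal I \<and> x \<otimes>\<^bsub>LA\<^esub> y \<in> quotient_ideal I"
    if "x \<in> quotient_ideal I" "y \<in> carrier LA" for x y
    using that by (auto simp: quotient_ideal_def carrier_LA mult_LA lmult_mem rmult_mem)
  ultimately show ?thesis by (simp add: two_sided_ideal_def additive_subgroup_def)
qed

lemma quotient_full_ideal:
  assumes "two_sided_ideal LA P"
  shows "quotient_ideal (full_ideal P) = P"
  using two_sided_ideal_LA_D(1)[OF assms] mem_full_ideal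
  by (auto simp: quotient_ideal_def)

lemma full_quotient_ideal:
  assumes "leavitt_ideal E I"
  shows "full_ideal (quotient_ideal I) = I"
proof (rule Set.set_eqI)
  interpret leavitt_ideal E I by fact
  fix p
  have eq: "keep_valid E p \<in> I \<longleftrightarrow> p \<in> I" by (rule cong_mem_iff[OF keep_valid_cong])
  show "p \<in> full_ideal (quotient_ideal I) \<longleftrightarrow> p \<in> I"
  proof
    assume "p \<in> full_ideal (quotient_ideal I)"
    thus "p \<in> I" using mem_quotient_ideal[OF assms, of "keep_valid E p"] eq
      by (auto simp: full_ideal_def)
  next
    assume p: "p \<in> I"
    hence "keep_valid E p \<in> carrier FA" using const_coeff by (simp add: in_carrier_iff)
    thus "p \<in> full_ideal (quotient_ideal I)"
      using mem_quotient_ideal[OF assms, of "keep_valid E p"] eq p by (auto simp: full_ideal_def)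
  qed
qed

lemma finite_ideals_LA:
  assumes "finite {I :: ('v, 'e, 'k) lpa_poly set. leavitt_ideal E I}"
  shows "finite {P. two_sided_ideal LA P}"
proof -
  have "{P. two_sided_ideal LA P} \<subseteq> quotient_ideal ` {I. leavitt_ideal E I}"
    using quotient_full_ideal leavitt_ideal_full_ideal by (metis (mono_tags) image_eqI mem_Collect_eq subsetI)
  thus ?thesis using assms finite_surj by blast
qed

text \<open>Homogeneous components are defined on polynomials; since the relation ideal is closed
  under taking them, they are well defined on cosets, which makes the decomposition unique. The
  hypothesis on the core says that the components of an element of \<open>P\<close> stay in
  \<open>P\<close>.\<close>

lemma graded_idealI:
  assumes P: "two_sided_ideal LA P" and core: "homogeneous_core (full_ideal P) = full_ideal P"
  shows "graded_ideal K E P"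
proof -
  define I where "I = full_ideal P"
  have memI: "p \<in> I \<longleftrightarrow> coset p \<in> P" if "p \<in> carrier FA" for p
    using that by (simp add: I_def mem_full_ideal)
  interpret I: leavitt_ideal E I unfolding I_def by (rule leavitt_ideal_full_ideal[OF P])
  interpret R: leavitt_ideal E "{p. keep_valid E p \<in> RI}"
    by (rule leavitt_ideal_lift[OF RI_ideal RI_scale RI_relators])
  interpret LA: abelian_group LA by (rule abelian_group_LA)
  have comp_carrier: "component n p \<in> carrier FA" if "p \<in> carrier FA" for n p
    using that by (auto simp: free_nonunital_algebra_def keys_keep)
  \<comment> \<open>The core of the lifted relation ideal is again an ideal containing the relators,
    and the relation ideal is the least one.\<close>
  have R_comp: "component n p \<in> RI" if "p \<in> RI" for n p
  proof -
    have pF: "p \<in> carrier FA" using that RI_subset by blast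
    have "RI \<subseteq> homogeneous_core {p. keep_valid E p \<in> RI}"
      by (rule RI_subset_ideal[OF R.leavitt_ideal_homogeneous_core])
    hence "keep_valid E (component n p) \<in> RI" using that by (auto simp: homogeneous_core_def)
    thus ?thesis using comp_carrier[OF pF] by (simp add: in_carrier_iff)
  qed
  have component: "lpa_component K E n = coset ` {p \<in> carrier FA. homogeneous n p}" for n
    by (auto simp: lpa_component_def homogeneous_def)
  have finsum: "(\<Oplus>\<^bsub>LA\<^esub>i\<in>A. c i) = coset (\<Sum>i\<in>A. p i)"
    if "finite A" "\<And>i. i \<in> A \<Longrightarrow> p i \<in> carrier FA" "\<And>i. i \<in> A \<Longrightarrow> c i = coset (p i)" for A :: "int set" and c p
    using that
  proof (induction A rule: finite_induct)
    case (insert i A)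
    thus ?case by (subst LA.finsum_insert) (auto simp: carrier_LA add_LA)
  qed (simp add: zero_LA)
  let ?C = "{c. (\<forall>i. c i \<in> P \<inter> lpa_component K E i) \<and> finite {i. c i \<noteq> \<zero>\<^bsub>LA\<^esub>}}"
  let ?s = "\<lambda>c. \<Oplus>\<^bsub>LA\<^esub>i\<in>{i. c i \<noteq> \<zero>\<^bsub>LA\<^esub>}. c i"
  \<comment> \<open>A zero component gets the representative 0, so that the sums for two families
    can be taken over a common finite index set.\<close>
  have repr: "\<exists>p. (\<forall>i. p i \<in> carrier FA \<and> homogeneous i (p i) \<and> c i = coset (p i) \<and>
      (c i = \<zero>\<^bsub>LA\<^esub> \<longrightarrow> p i = 0))" if "c \<in> ?C" for c
  proof -
    have "\<exists>q. q \<in> carrier FA \<and> homogeneous i q \<and> c i = coset q \<and> (c i = \<zero>\<^bsub>LA\<^esub> \<longrightarrow> q = 0)" for i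
    proof (cases "c i = \<zero>\<^bsub>LA\<^esub>")
      case True
      thus ?thesis by (intro exI[of _ 0]) (simp add: homogeneous_def zero_LA)
    next
      case False
      thus ?thesis using that by (auto simp: component)
    qed
    thus ?thesis by metis
  qed
  have sum_repr: "?s c = coset (\<Sum>i\<in>A. p i)"
    if c: "c \<in> ?C" and p: "\<And>i. p i \<in> carrier FA \<and> homogeneous i (p i) \<and> c i = coset (p i) \<and>
      (c i = \<zero>\<^bsub>LA\<^esub> \<longrightarrow> p i = 0)" and A: "finite A" "{i. c i \<noteq> \<zero>\<^bsub>LA\<^esub>} \<subseteq> A" for c p A
  proof -
    have "?s c = coset (\<Sum>i\<in>{i. c i \<noteq> \<zero>\<^bsub>LA\<^esub>}. p i)"
      by (rule finsum) (use c p in blast)+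
    also have "(\<Sum>i\<in>{i. c i \<noteq> \<zero>\<^bsub>LA\<^esub>}. p i) = (\<Sum>i\<in>A. p i)"
      by (rule sum.mono_neutral_left[OF A]) (use p in blast)
    finally show ?thesis .
  qed
  have comp_sum: "component n (\<Sum>i\<in>A. p i) = p n"
    if "finite A" "\<And>i. homogeneous i (p i)" "n \<in> A" for n A and p :: "int \<Rightarrow> ('v, 'e, 'k) lpa_poly"
  proof -
    have "component n (\<Sum>i\<in>A. p i) = (\<Sum>i\<in>A. component n (p i))"
      by (induction A rule: infinite_finite_induct) (simp_all add: keep_add)
    also have "\<dots> = (\<Sum>i\<in>A. if n = i then p i else 0)"
      by (intro sum.cong homogeneous_component that) simp
    finally show ?thesis using that by simp
  qed
  have "inj_on ?s ?C"
  proof (rule inj_onI)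
    fix c d assume c: "c \<in> ?C" and d: "d \<in> ?C" and eq: "?s c = ?s d"
    obtain p where p: "\<And>i. p i \<in> carrier FA \<and> homogeneous i (p i) \<and> c i = coset (p i) \<and>
      (c i = \<zero>\<^bsub>LA\<^esub> \<longrightarrow> p i = 0)" using repr[OF c] by blast
    obtain q where q: "\<And>i. q i \<in> carrier FA \<and> homogeneous i (q i) \<and> d i = coset (q i) \<and>
      (d i = \<zero>\<^bsub>LA\<^esub> \<longrightarrow> q i = 0)" using repr[OF d] by blast
    show "c = d"
    proof
      fix n
      define A where "A = insert n ({i. c i \<noteq> \<zero>\<^bsub>LA\<^esub>} \<union> {i. d i \<noteq> \<zero>\<^bsub>LA\<^esub>})"
      have A: "finite A" "n \<in> A" using c d by (auto simp: A_def)
      have "coset (\<Sum>i\<in>A. p i) = coset (\<Sum>i\<in>A. q i)"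
        using eq sum_repr[OF c p A(1)] sum_repr[OF d q A(1)] by (auto simp: A_def)
      hence "component n ((\<Sum>i\<in>A. p i) - (\<Sum>i\<in>A. q i)) \<in> RI" by (intro R_comp) (simp add: coset_eq_iff)
      hence "p n - q n \<in> RI" using p q A by (simp add: keep_diff comp_sum)
      thus "c n = d n" using p[of n] q[of n] by (simp add: coset_eq_iff)
    qed
  qed
  moreover have "?s ` ?C = P"
  proof (intro equalityI subsetI)
    fix x assume "x \<in> ?s ` ?C"
    then obtain c where c: "c \<in> ?C" "x = ?s c" by blast
    obtain p where p: "\<And>i. p i \<in> carrier FA \<and> homogeneous i (p i) \<and> c i = coset (p i) \<and>
      (c i = \<zero>\<^bsub>LA\<^esub> \<longrightarrow> p i = 0)" using repr[OF c(1)] by blast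
    have "x = coset (\<Sum>i\<in>{i. c i \<noteq> \<zero>\<^bsub>LA\<^esub>}. p i)"
      using sum_repr[OF c(1) p _ subset_refl] c by auto
    moreover have "p i \<in> I" for i
    proof -
      have "c i \<in> P" using c(1) by blast
      thus ?thesis using memI[of "p i"] p[of i] by metis
    qed
    hence "(\<Sum>i\<in>{i. c i \<noteq> \<zero>\<^bsub>LA\<^esub>}. p i) \<in> I" by (intro I.sum_mem)
    moreover have "(\<Sum>i\<in>{i. c i \<noteq> \<zero>\<^bsub>LA\<^esub>}. p i) \<in> carrier FA" using p by (intro FA_sum) blast
    ultimately show "x \<in> P" using memI by blast
  next
    fix x assume x: "x \<in> P"
    then obtain p where p: "p \<in> carrier FA" "x = coset p" using two_sided_ideal_LA_D(1)[OF P] by blast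
    hence pI: "p \<in> I" using memI x by blast
    define c where "c n = coset (component n p)" for n
    define N where "N = word_degree ` Poly_Mapping.keys p"
    have c0: "component n p = 0" if "n \<notin> N" for n
      using that by (intro keep_none) (auto simp: N_def)
    have fin: "finite {i. c i \<noteq> \<zero>\<^bsub>LA\<^esub>}"
      by (rule finite_subset[of _ N]) (auto simp: N_def c_def zero_LA dest: c0[unfolded N_def])
    have "component n p \<in> I" for n using pI core by (auto simp: I_def homogeneous_core_def)
    hence "c n \<in> P" for n using memI comp_carrier[OF p(1)] by (simp add: c_def)
    moreover have "c n \<in> lpa_component K E n" for n
      using comp_carrier[OF p(1)] by (auto simp: component c_def homogeneous_def keys_keep)
    ultimately have cC: "c \<in> ?C" using fin by blast
    have "(\<Oplus>\<^bsub>LA\<^esub>i\<in>{i. c i \<noteq> \<zero>\<^bsub>LA\<^esub>}. c i) = coset (\<Sum>n\<in>{i. c i \<noteq> \<zero>\<^bsub>LA\<^esub>}. component n p)"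
      using fin comp_carrier[OF p(1)] by (intro finsum) (auto simp: c_def)
    also have "\<dots> = coset (\<Sum>n\<in>N. component n p)"
    proof -
      \<comment> \<open>A component can be nonzero as a polynomial and still lie in
        \<open>RI\<close>; its index is then in \<open>N\<close> but not in the support of
        \<open>c\<close>.\<close>
      have "(\<Sum>n\<in>{i. c i \<noteq> \<zero>\<^bsub>LA\<^esub>} \<union> N. component n p) - (\<Sum>n\<in>{i. c i \<noteq> \<zero>\<^bsub>LA\<^esub>}. component n p)
          = (\<Sum>n\<in>{i. c i \<noteq> \<zero>\<^bsub>LA\<^esub>} \<union> N - {i. c i \<noteq> \<zero>\<^bsub>LA\<^esub>}. component n p)"
        using fin by (intro sum_diff[symmetric]) (auto simp: N_def)
      also have "\<dots> \<in> RI"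
      proof -
        have "component n p \<in> RI" if "n \<notin> {i. c i \<noteq> \<zero>\<^bsub>LA\<^esub>}" for n
          using that by (auto simp: c_def zero_LA coset_eq_iff)
        thus ?thesis by (intro RI_sum) blast
      qed
      also have "{i. c i \<noteq> \<zero>\<^bsub>LA\<^esub>} \<union> N = N"
        using c0 by (auto simp: c_def zero_LA)
      finally show ?thesis using coset_eq_iff by blast
    qed
    also have "\<dots> = x" using sum_components[of N p] by (simp add: N_def p(2))
    finally show "x \<in> ?s ` ?C" using cC by blast
  qed
  ultimately show ?thesis
    using P by (simp add: graded_ideal_def internal_direct_sum_def bij_betw_def)
qed

end

section \<open>Prime ideals\<close>

lemma leavitt_ideal_Union_chain:
  assumes "\<C> \<noteq> {}" "\<And>I. I \<in> \<C> \<Longrightarrow> leavitt_ideal E I"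
    and chain: "\<And>I J. I \<in> \<C> \<Longrightarrow> J \<in> \<C> \<Longrightarrow> I \<subseteq> J \<or> J \<subseteq> I"
  shows "leavitt_ideal E (\<Union>\<C>)"
proof -
  note L = assms(2)
  obtain I0 where I0: "I0 \<in> \<C>" using assms(1) by blast
  interpret I0: leavitt_ideal E I0 by (rule L[OF I0])
  show ?thesis
  proof
    show "0 \<in> \<Union>\<C>" using I0 I0.zero_mem by blast
    show "p + q \<in> \<Union>\<C>" if "p \<in> \<Union>\<C>" "q \<in> \<Union>\<C>" for p q
    proof -
      obtain I J where IJ: "I \<in> \<C>" "p \<in> I" "J \<in> \<C>" "q \<in> J" using \<open>p \<in> \<Union>\<C>\<close> \<open>q \<in> \<Union>\<C>\<close> by blast
      thus ?thesis using chain[OF IJ(1,3)] leavitt_ideal.add_mem[OF L] by blast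
    qed
    show "a * p \<in> \<Union>\<C>" if "p \<in> \<Union>\<C>" for a p using that leavitt_ideal.lmult_mem[OF L] by blast
    show "p * a \<in> \<Union>\<C>" if "p \<in> \<Union>\<C>" for a p using that leavitt_ideal.rmult_mem[OF L] by blast
    show "poly_mapping.lookup p 0 = 0" if "p \<in> \<Union>\<C>" for p
      using that leavitt_ideal.const_coeff[OF L] by blast
    show "lpa_relators E \<subseteq> \<Union>\<C>" using I0 I0.relators_mem by blast
    show "lpa_mon g \<in> \<Union>\<C>" if "g \<notin> lpa_gens E" for g using I0 I0.invalid_mem[OF that] by blast
  qed
qed

lemma leavitt_ideal_sum:
  assumes "leavitt_ideal E I" "leavitt_ideal E J"
  shows "leavitt_ideal E {p + q | p q. p \<in> I \<and> q \<in> J}"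
proof -
  interpret I: leavitt_ideal E I by fact
  interpret J: leavitt_ideal E J by fact
  have left: "p \<in> {p + q | p q. p \<in> I \<and> q \<in> J}" if "p \<in> I" for p
    using that J.zero_mem by force
  show ?thesis
  proof
    show "0 \<in> {p + q | p q. p \<in> I \<and> q \<in> J}" by (rule left[OF I.zero_mem])
    show "x + y \<in> {p + q | p q. p \<in> I \<and> q \<in> J}"
      if "x \<in> {p + q | p q. p \<in> I \<and> q \<in> J}" "y \<in> {p + q | p q. p \<in> I \<and> q \<in> J}" for x y
    proof -
      obtain p q p' q' where *: "x = p + q" "y = p' + q'" "p \<in> I" "p' \<in> I" "q \<in> J" "q' \<in> J"
        using \<open>x \<in> _\<close> \<open>y \<in> _\<close> by blast
      have "x + y = (p + p') + (q + q')" using * by (simp add: algebra_simps)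
      thus ?thesis using * I.add_mem J.add_mem by blast
    qed
    show "a * x \<in> {p + q | p q. p \<in> I \<and> q \<in> J}" if "x \<in> {p + q | p q. p \<in> I \<and> q \<in> J}" for a x
      using that I.lmult_mem J.lmult_mem by (force simp: distrib_left)
    show "x * a \<in> {p + q | p q. p \<in> I \<and> q \<in> J}" if "x \<in> {p + q | p q. p \<in> I \<and> q \<in> J}" for a x
      using that I.rmult_mem J.rmult_mem by (force simp: distrib_right)
    show "poly_mapping.lookup x 0 = 0" if "x \<in> {p + q | p q. p \<in> I \<and> q \<in> J}" for x
      using that I.const_coeff J.const_coeff by (auto simp: lookup_add)
    show "lpa_relators E \<subseteq> {p + q | p q. p \<in> I \<and> q \<in> J}" using left I.relators_mem by blast
    show "lpa_mon g \<in> {p + q | p q. p \<in> I \<and> q \<in> J}" if "g \<notin> lpa_gens E" for g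
      using left I.invalid_mem[OF that] by blast
  qed
qed

context leavitt_quotient
begin

text \<open>Let \<open>M\<close> be maximal among the ideals that contain \<open>I\<close> and avoid
  \<open>a\<close>. If neither \<open>A\<close> nor \<open>B\<close> lies in \<open>M\<close>, then
  \<open>a\<close> is in the sum of \<open>M\<close> with each of them, so \<open>a * a\<close> is
  in the sum of \<open>M\<close> and their product. As \<open>a\<close> is idempotent modulo
  \<open>I\<close>, that product is not inside \<open>M\<close>.\<close>

lemma exists_prime_avoiding_idempotent:
  assumes I: "leavitt_ideal E I" and a: "poly_mapping.lookup a 0 = 0" "a \<notin> I" "a * a - a \<in> I"
  shows "\<exists>P. prime_two_sided_ideal LA P \<and> I \<subseteq> full_ideal P \<and> a \<notin> full_ideal P"
proof -
  define \<A> where "\<A> = {J. leavitt_ideal E J \<and> I \<subseteq> J \<and> a \<notin> J}"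
  have "\<exists>M\<in>\<A>. \<forall>X\<in>\<A>. M \<subseteq> X \<longrightarrow> X = M"
  proof (rule subset_Zorn_nonempty)
    show "\<A> \<noteq> {}" using I a by (auto simp: \<A>_def)
    show "\<Union>\<C> \<in> \<A>" if \<C>: "\<C> \<noteq> {}" "subset.chain \<A> \<C>" for \<C>
    proof -
      have sub: "\<C> \<subseteq> \<A>" and ch: "\<And>X Y. X \<in> \<C> \<Longrightarrow> Y \<in> \<C> \<Longrightarrow> X \<subseteq> Y \<or> Y \<subseteq> X"
        using \<C>(2) by (auto simp: subset_chain_def)
      have "leavitt_ideal E (\<Union>\<C>)"
        using sub ch by (intro leavitt_ideal_Union_chain[OF \<C>(1)]) (auto simp: \<A>_def)
      thus ?thesis using \<C>(1) sub by (auto simp: \<A>_def)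
    qed
  qed
  then obtain M where M: "leavitt_ideal E M" "I \<subseteq> M" "a \<notin> M"
    and max: "\<And>X. leavitt_ideal E X \<Longrightarrow> M \<subseteq> X \<Longrightarrow> a \<notin> X \<Longrightarrow> X = M"
    by (auto simp: \<A>_def)
  interpret M: leavitt_ideal E M by (rule M)
  let ?P = "quotient_ideal M"
  have full: "full_ideal ?P = M" by (rule full_quotient_ideal[OF M(1)])
  have "prime_two_sided_ideal LA ?P"
    unfolding prime_two_sided_ideal_def
  proof (intro conjI allI impI)
    show "two_sided_ideal LA ?P" by (rule two_sided_ideal_quotient_ideal[OF M(1)])
    have "keep_valid E a \<in> carrier FA" using a(1) by (simp add: in_carrier_iff)
    moreover have "keep_valid E a \<notin> M" using M(3) M.cong_mem_iff[OF M.keep_valid_cong] by blast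
    ultimately show "?P \<noteq> carrier LA"
      using mem_quotient_ideal[OF M(1)] by (auto simp: carrier_LA)
    fix A B
    assume A: "two_sided_ideal LA A" and B: "two_sided_ideal LA B" and AB: "ideal_prod LA A B \<subseteq> ?P"
    have split: "\<exists>m p. m \<in> M \<and> p \<in> full_ideal C \<and> a = m + p"
      if C: "two_sided_ideal LA C" "\<not> C \<subseteq> ?P" for C
    proof (rule ccontr)
      assume no: "\<nexists>m p. m \<in> M \<and> p \<in> full_ideal C \<and> a = m + p"
      note FC = leavitt_ideal_full_ideal[OF C(1)]
      let ?X = "{p + q | p q. p \<in> M \<and> q \<in> full_ideal C}"
      have "0 \<in> full_ideal C" by (rule leavitt_ideal.zero_mem[OF FC])
      hence "M \<subseteq> ?X" by force
      moreover have "a \<notin> ?X" using no by blast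
      ultimately have X: "?X = M" by (intro max leavitt_ideal_sum M(1) FC)
      have "full_ideal C \<subseteq> M"
      proof
        fix q assume "q \<in> full_ideal C"
        hence "0 + q \<in> ?X" using M.zero_mem by blast
        thus "q \<in> M" unfolding X by simp
      qed
      hence "quotient_ideal (full_ideal C) \<subseteq> ?P" by (auto simp: quotient_ideal_def)
      thus False using quotient_full_ideal[OF C(1)] C(2) by simp
    qed
    show "A \<subseteq> ?P \<or> B \<subseteq> ?P"
    proof (rule ccontr)
      assume "\<not> (A \<subseteq> ?P \<or> B \<subseteq> ?P)"
      then obtain m p n q where *: "m \<in> M" "p \<in> full_ideal A" "a = m + p"
        "n \<in> M" "q \<in> full_ideal B" "a = n + q" using split[OF A] split[OF B] by blast
      let ?p = "keep_valid E p" and ?q = "keep_valid E q"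
      have pq: "?p \<in> carrier FA" "?q \<in> carrier FA" "coset ?p \<in> A" "coset ?q \<in> B"
        using *(2,5) by (auto simp: full_ideal_def)
      hence "coset (?p * ?q) \<in> ?P"
        using AB ideal_prod.prod[OF pq(3,4), of LA] by (auto simp: mult_LA)
      hence "?p * ?q \<in> M" using mem_quotient_ideal[OF M(1)] pq by simp
      moreover have "?p * ?q = keep_valid E (p * q)" by (simp add: keep_valid_mult)
      ultimately have "p * q \<in> M" using M.cong_mem_iff[OF M.keep_valid_cong] by metis
      moreover have "a * a = m * (n + q) + p * n + p * q"
        using *(3,6) by (metis distrib_left distrib_right add.assoc)
      ultimately have "a * a \<in> M"
        using M.rmult_mem[OF *(1)] M.lmult_mem[OF *(4)] M.add_mem by simp
      moreover have "a = a * a - (a * a - a)" by simp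
      ultimately show False using a(3) M(2,3) M.diff_mem by (metis subsetD)
    qed
  qed
  thus ?thesis using full M by blast
qed

end

section \<open>Separating primes\<close>

context leavitt_ideal
begin

lemma pe_vtx:
  assumes "awalk u p v" "p \<noteq> []"
  shows "pe p * vtx v \<asymp> pe p"
proof -
  obtain q e where p: "p = q @ [e]" using assms(2) by (metis rev_exhaust)
  have "v = head E e" using assms(1) by (auto simp: p awalk_simps)
  thus ?thesis using cong_lmult[OF edg_head[of e], of "pe q"] by (simp add: p pe_append pe_Cons mult.assoc)
qed

text \<open>Each factor \<open>pe c\<close> is cancelled by multiplying with \<open>gh c\<close> on
  the left.\<close>

lemma cycle_power_cancel:
  assumes c: "awalk v c v" "c \<noteq> []" and mem: "vtx v * (pe c ^ n * y) \<in> I"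
  shows "vtx v * y \<in> I"
  using mem
proof (induction n)
  case (Suc n)
  have "gh c * (vtx v * pe c) \<asymp> gh c * (vtx v * (pe c * vtx v))"
    by (intro cong_lmult cong_sym[OF pe_vtx[OF c]])
  also have "\<dots> \<asymp> vtx v" by (rule gh_vtx_pe_same[OF c(1)])
  finally have "gh c * (vtx v * pe c) * (pe c ^ n * y) \<asymp> vtx v * (pe c ^ n * y)" by (rule cong_rmult)
  moreover have "gh c * (vtx v * pe c) * (pe c ^ n * y) = gh c * (vtx v * (pe c ^ Suc n * y))"
    by (simp add: mult.assoc)
  ultimately show ?case using Suc lmult_mem cong_mem_iff by metis
qed simp

text \<open>Subtractive Euclidean algorithm on the lengths: the sum of length \<open>k + l\<close>
  minus that of length \<open>k\<close> is \<open>pe c ^ k\<close> times the sum of length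
  \<open>l\<close>, and the power can be cancelled.\<close>

lemma cycle_geometric_gcd:
  assumes c: "awalk v c v" "c \<noteq> []"
    and "vtx v * (\<Sum>i<m. pe c ^ i) \<in> I" "vtx v * (\<Sum>i<n. pe c ^ i) \<in> I"
  shows "vtx v * (\<Sum>i<gcd m n. pe c ^ i) \<in> I"
  using assms(3,4)
proof (induction "m + n" arbitrary: m n rule: less_induct)
  case less
  have shift: "vtx v * (\<Sum>i<l. pe c ^ i) \<in> I"
    if "vtx v * (\<Sum>i<k. pe c ^ i) \<in> I" "vtx v * (\<Sum>i<k + l. pe c ^ i) \<in> I" for k l
  proof -
    have split: "(\<Sum>i<k + l. pe c ^ i) = (\<Sum>i<k. pe c ^ i) + pe c ^ k * (\<Sum>i<l. pe c ^ i :: ('v, 'e, 'k) lpa_poly)"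
      by (induction l) (simp_all add: power_add[symmetric] distrib_left add.assoc)
    have "vtx v * (pe c ^ k * (\<Sum>i<l. pe c ^ i)) \<in> I"
      using diff_mem[OF that(2,1)] unfolding split by (simp add: distrib_left)
    thus ?thesis by (rule cycle_power_cancel[OF c])
  qed
  consider "m = 0" | "n = 0" | "0 < m" "m \<le> n" | "0 < n" "n \<le> m" by linarith
  thus ?case
  proof cases
    case 3
    then obtain k where k: "n = m + k" using le_Suc_ex by blast
    thus ?thesis using less(1)[of m k] shift[of m k] less(2,3) 3 by simp
  next
    case 4
    then obtain k where k: "m = n + k" using le_Suc_ex by blast
    thus ?thesis using less(1)[of n k] shift[of n k] less(2,3) 4
      by (simp add: gcd.commute[of "n + k" n])
  qed (use less in auto)
qed

end

context leavitt_quotient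
begin

context
  assumes fin: "finite {P. prime_two_sided_ideal LA P}"
begin

lemma primes_imp_condition_K: "condition_K E"
proof (rule ccontr)
  assume "\<not> condition_K E"
  then obtain v c where v: "v \<in> verts E" and c: "simple_closed_path E v c"
    and unique: "\<And>c'. simple_closed_path E v c' \<Longrightarrow> c' = c"
    unfolding condition_K_def by blast
  have c': "awalk v c v" "c \<noteq> []" using c by (auto simp: simple_closed_path_def)
  let ?g = "\<lambda>n. vtx v * (\<Sum>i<n. pe c ^ i) :: ('v, 'e, 'k) lpa_poly"
  have "\<exists>P. prime_two_sided_ideal LA P \<and> ?g p \<in> full_ideal P \<and> vtx v \<notin> full_ideal P"
    if p: "prime p" for p :: nat
  proof -
    obtain I :: "('v, 'e, 'k) lpa_poly set" where I: "leavitt_ideal E I" "vtx v \<notin> I" "?g p \<in> I"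
      using exists_ideal_unique_cycle[OF wf_digraph v c unique, of p] prime_ge_2_nat[OF p] by blast
    have "vtx v * vtx v - vtx v \<in> I"
      using leavitt_ideal.vtx_idem[OF I(1)] by (simp add: leavitt_ideal.cong_def[OF I(1)])
    from exists_prime_avoiding_idempotent[OF I(1) lookup_lpa_mon_0 I(2) this] I(3)
    show ?thesis by blast
  qed
  then obtain P where P: "\<And>p :: nat. prime p \<Longrightarrow>
      prime_two_sided_ideal LA (P p) \<and> ?g p \<in> full_ideal (P p) \<and> vtx v \<notin> full_ideal (P p)"
    by metis
  have "inj_on P {p. prime p}"
  proof (rule inj_onI)
    fix p q :: nat assume p: "p \<in> {p. prime p}" and q: "q \<in> {p. prime p}" and eq: "P p = P q"
    show "p = q"
    proof (rule ccontr)
      assume "p \<noteq> q"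
      hence gcd: "gcd p q = 1" using p q by (simp add: primes_coprime coprime_imp_gcd_eq_1)
      have Pp: "leavitt_ideal E (full_ideal (P p))"
        using P p by (intro leavitt_ideal_full_ideal) (simp add: prime_two_sided_ideal_def)
      have "?g p \<in> full_ideal (P p)" "?g q \<in> full_ideal (P p)" using P[of p] P[of q] p q eq by auto
      from leavitt_ideal.cycle_geometric_gcd[OF Pp c' this]
      \<comment> \<open>The sum of length 1 is the vertex \<open>v\<close>, which this prime ideal
        avoids.\<close>
      have "?g 1 \<in> full_ideal (P p)" unfolding gcd .
      thus False using P p by simp
    qed
  qed
  moreover have "P ` {p. prime p} \<subseteq> {P. prime_two_sided_ideal LA P}" using P by blast
  ultimately have "finite {p :: nat. prime p}" using fin finite_subset finite_imageD by blast
  thus False using primes_infinite by blast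
qed

text \<open>\<open>H\<close> consists of the vertices common to all prime ideals containing
  \<open>H\<close>, because some prime ideal containing \<open>H\<close> avoids any given vertex
  outside it. So \<open>H\<close> is encoded by a subset of the finite set of prime ideals.\<close>

lemma primes_imp_finite_hereditary_saturated: "finite {H. hereditary_saturated E H}"
proof -
  define \<P> where "\<P> H = {P. prime_two_sided_ideal LA P \<and> (\<forall>v\<in>H. vtx v \<in> full_ideal P)}" for H
  have sep: "u \<in> H \<longleftrightarrow> u \<in> verts E \<and> (\<forall>P\<in>\<P> H. vtx u \<in> full_ideal P)"
    if H: "hereditary_saturated E H" for H u
  proof
    assume "u \<in> H"
    thus "u \<in> verts E \<and> (\<forall>P\<in>\<P> H. vtx u \<in> full_ideal P)"
      using H by (auto simp: \<P>_def hereditary_saturated_def hereditary_def)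
  next
    assume u: "u \<in> verts E \<and> (\<forall>P\<in>\<P> H. vtx u \<in> full_ideal P)"
    show "u \<in> H"
    proof (rule ccontr)
      assume "u \<notin> H"
      obtain I :: "('v, 'e, 'k) lpa_poly set" where I: "leavitt_ideal E I" "ideal_vertices E I = H"
        using exists_ideal_hereditary_saturated[OF wf_digraph H, of "{}"] by blast
      have "vtx u \<notin> I" using \<open>u \<notin> H\<close> I(2) u by (auto simp: ideal_vertices_def)
      moreover have "vtx u * vtx u - vtx u \<in> I"
        using leavitt_ideal.vtx_idem[OF I(1)] by (simp add: leavitt_ideal.cong_def[OF I(1)])
      ultimately obtain P where P: "prime_two_sided_ideal LA P" "I \<subseteq> full_ideal P" "vtx u \<notin> full_ideal P"
        using exists_prime_avoiding_idempotent[OF I(1) lookup_lpa_mon_0] by blast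
      have "P \<in> \<P> H" using P(1,2) I(2) by (auto simp: \<P>_def ideal_vertices_def)
      thus False using u P(3) by blast
    qed
  qed
  have "inj_on \<P> {H. hereditary_saturated E H}"
    by (rule inj_onI) (use sep in \<open>auto simp: set_eq_iff\<close>)
  moreover have "\<P> ` {H. hereditary_saturated E H} \<subseteq> Pow {P. prime_two_sided_ideal LA P}"
    by (auto simp: \<P>_def)
  ultimately show ?thesis using fin finite_subset finite_imageD by (metis finite_Pow_iff)
qed

text \<open>Taking for \<open>S\<close> all breaking vertices except \<open>w\<close> produces a
  prime ideal that contains every breaking element of \<open>H\<close> but the one at
  \<open>w\<close>. Different \<open>w\<close> thus give different prime ideals.\<close>

lemma primes_imp_finite_breaking_vertices:
  assumes H: "hereditary_saturated E H"
  shows "finite (breaking_vertices E H)"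
proof -
  let ?b = "\<lambda>w. breaking_elt E H w :: ('v, 'e, 'k) lpa_poly"
  have "\<exists>P. prime_two_sided_ideal LA P \<and> ?b w \<notin> full_ideal P \<and>
      (\<forall>u\<in>breaking_vertices E H - {w}. ?b u \<in> full_ideal P)" if w: "w \<in> breaking_vertices E H" for w
  proof -
    obtain I :: "('v, 'e, 'k) lpa_poly set" where I: "leavitt_ideal E I" "ideal_vertices E I = H"
      "\<forall>u\<in>breaking_vertices E H. ?b u \<in> I \<longleftrightarrow> u \<in> breaking_vertices E H - {w}"
      using exists_ideal_hereditary_saturated[OF wf_digraph H, of "breaking_vertices E H - {w}"] by blast
    interpret I: leavitt_ideal E I by (rule I)
    have "w \<in> verts E" "finite (live_arcs E H w)" using w by (auto simp: breaking_vertices_def live_arcs_def)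
    hence "?b w * ?b w - ?b w \<in> I" using I.breaking_elt_idem[of w] I(2) by (simp add: I.cong_def)
    moreover have "poly_mapping.lookup (?b w) 0 = 0"
      by (simp add: breaking_elt_def arc_proj_def lookup_minus lookup_sum lookup_times_0 lookup_lpa_mon_0)
    moreover have "?b w \<notin> I" using I(3) w by blast
    ultimately obtain P where "prime_two_sided_ideal LA P" "I \<subseteq> full_ideal P" "?b w \<notin> full_ideal P"
      using exists_prime_avoiding_idempotent[OF I(1)] by blast
    thus ?thesis using I(3) by blast
  qed
  then obtain P where P: "\<And>w. w \<in> breaking_vertices E H \<Longrightarrow> prime_two_sided_ideal LA (P w) \<and>
      ?b w \<notin> full_ideal (P w) \<and> (\<forall>u\<in>breaking_vertices E H - {w}. ?b u \<in> full_ideal (P w))"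
    by metis
  have "inj_on P (breaking_vertices E H)"
    by (rule inj_onI) (metis P Diff_iff singletonD)
  moreover have "P ` breaking_vertices E H \<subseteq> {P. prime_two_sided_ideal LA P}" using P by blast
  ultimately show ?thesis using fin finite_subset finite_imageD by blast
qed

end

end

theorem proposition2p10:
  fixes E :: "('v, 'e) pre_digraph"
    and K :: "'k::field itself"
    and L :: "('v, 'e, 'k) lpa_poly set ring"
  assumes "wf_digraph E"
    and "L = leavitt_path_algebra K E"
  shows "(finite {P. prime_two_sided_ideal L P} \<longleftrightarrow>
            finite {P. prime_two_sided_ideal L P} \<and>
            (\<forall>P. prime_two_sided_ideal L P \<longrightarrow> graded_ideal K E P)) \<and>
         (finite {P. prime_two_sided_ideal L P} \<longleftrightarrow>
            condition_K E \<and> finite {H. hereditary_saturated E H} \<and>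
            (\<forall>H. hereditary_saturated E H \<longrightarrow> finite (breaking_vertices E H))) \<and>
         (finite {P. prime_two_sided_ideal L P} \<longleftrightarrow>
            finite {I. two_sided_ideal L I})"
proof -
  interpret wf_digraph E by fact
  interpret leavitt_quotient E K by unfold_locales
  have L: "L = LA" by fact
  let ?a = "finite {P. prime_two_sided_ideal L P}"
  let ?c = "condition_K E \<and> finite {H. hereditary_saturated E H} \<and>
    (\<forall>H. hereditary_saturated E H \<longrightarrow> finite (breaking_vertices E H))"
  let ?d = "finite {I. two_sided_ideal L I}"
  have da: ?a if ?d
    using that by (rule rev_finite_subset) (auto simp: prime_two_sided_ideal_def)
  have ac: ?c if ?a
    using that primes_imp_condition_K primes_imp_finite_hereditary_saturated
      primes_imp_finite_breaking_vertices unfolding L by blast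
  have cd: ?d if ?c
    using that finite_ideals_LA[OF finite_leavitt_ideals] unfolding L by blast
  \<comment> \<open>Statement (b) follows from (a) by way of Condition (K), while (a), (c) and (d)
    are linked in a cycle.\<close>
  have graded: "graded_ideal K E P" if "condition_K E" "prime_two_sided_ideal L P" for P
  proof -
    have P: "two_sided_ideal LA P" using that(2) by (simp add: L prime_two_sided_ideal_def)
    show ?thesis
      by (rule graded_idealI[OF P leavitt_ideal.condition_K_homogeneous[OF leavitt_ideal_full_ideal[OF P] that(1)]])
  qed
  show ?thesis using da ac cd graded by blast
qed

end
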